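(* Let $G$ be a finite simple connected graph of order $n\geq 3$ with maximum degree $\Delta(G)$, and let $M(G)$ be its middle graph. If $G$ is not isomorphic to any of the graphs $C_4, K_4, C_6, K_{3,3}$, then $\chi_D(M(G))=\Delta(G)+1$. If $G$ is isomorphic to one of $C_4, K_4, C_6, K_{3,3}$, then $\chi_D(M(G))=\Delta(G)+2$.
   Context: $C_n$ is the cycle on $n$ vertices, $K_n$ the complete graph on $n$ vertices, and $K_{n,m}$ the complete bipartite graph with parts of sizes $n$ and $m$. The middle graph $M(G)$ of a graph $G=(V(G),E(G))$ is the graph with vertex set $V(G)\cup E(G)$ (disjoint union) in which two distinct vertices $x,y$ are adjacent if and only if either (1) $x,y\in E(G)$ and the edges $x,y$ share a common endpoint in $G$, or (2) one of them is a vertex of $G$, the other is an edge of $G$, and they are incident in $G$. A vertex coloring $h:V(H)\to\{1,\dots,r\}$ of a graph $H$ is preserved by an automorphism $\psi$ of $H$ if $h(\psi(v))=h(v)$ for all $v\in V(H)$; $h$ is $r$-distinguishing if the only automorphism of $H$ preserving $h$ is the identity. The distinguishing chromatic number $\chi_D(H)$ is the least integer $r$ such that $H$ has a vertex coloring with colors $\{1,\dots,r\}$ that is both proper and distinguishing. *)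

theory Defs
  imports "Graph_Theory.Graph_Theory"
begin

text \<open>
  A finite simple graph is a \<^locale>\<open>pair_graph\<close>: a finite vertex set with a symmetric
  irreflexive arc relation, each undirected edge being represented by its two opposite arcs.
\<close>

definition uedges :: "'a pair_pre_digraph \<Rightarrow> 'a set set" where
  "uedges G = {{u, v} | u v. (u, v) \<in> parcs G}"

text \<open>In a symmetric graph in- and out-degree coincide with the usual degree.\<close>

definition max_degree :: "'a pair_pre_digraph \<Rightarrow> nat" where
  "max_degree G = Max (out_degree (with_proj G) ` pverts G)"

text \<open>A cycle for \<open>n \<ge> 3\<close>; for \<open>n = 1\<close> this definition gives a loop.\<close>

definition cycle_graph :: "nat \<Rightarrow> nat pair_pre_digraph" where
  "cycle_graph n = \<lparr> pverts = {..<n},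
     parcs = {(i, j). i < n \<and> j < n \<and> (j = Suc i mod n \<or> i = Suc j mod n)} \<rparr>"

definition middle_graph :: "'a pair_pre_digraph \<Rightarrow> ('a + 'a set) pair_pre_digraph" where
  "middle_graph G = \<lparr> pverts = pverts G <+> uedges G,
     parcs = {(Inr e, Inr f) | e f. e \<in> uedges G \<and> f \<in> uedges G \<and> e \<noteq> f \<and> e \<inter> f \<noteq> {}}
           \<union> {(Inl v, Inr e) | v e. v \<in> pverts G \<and> e \<in> uedges G \<and> v \<in> e}
           \<union> {(Inr e, Inl v) | v e. v \<in> pverts G \<and> e \<in> uedges G \<and> v \<in> e} \<rparr>"

text \<open>Only the values of \<open>\<psi>\<close> on the vertex set matter.\<close>

definition automorphism :: "'a pair_pre_digraph \<Rightarrow> ('a \<Rightarrow> 'a) \<Rightarrow> bool" where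
  "automorphism H \<psi> \<longleftrightarrow> bij_betw \<psi> (pverts H) (pverts H) \<and>
     (\<forall>u\<in>pverts H. \<forall>v\<in>pverts H. (\<psi> u, \<psi> v) \<in> parcs H \<longleftrightarrow> (u, v) \<in> parcs H)"

definition vertex_coloring :: "'a pair_pre_digraph \<Rightarrow> nat \<Rightarrow> ('a \<Rightarrow> nat) \<Rightarrow> bool" where
  "vertex_coloring H r h \<longleftrightarrow> h ` pverts H \<subseteq> {1..r}"

definition proper_coloring :: "'a pair_pre_digraph \<Rightarrow> ('a \<Rightarrow> nat) \<Rightarrow> bool" where
  "proper_coloring H h \<longleftrightarrow> (\<forall>(u, v)\<in>parcs H. h u \<noteq> h v)"

definition preserves_coloring ::
    "'a pair_pre_digraph \<Rightarrow> ('a \<Rightarrow> nat) \<Rightarrow> ('a \<Rightarrow> 'a) \<Rightarrow> bool" where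
  "preserves_coloring H h \<psi> \<longleftrightarrow> (\<forall>v\<in>pverts H. h (\<psi> v) = h v)"

definition distinguishing :: "'a pair_pre_digraph \<Rightarrow> ('a \<Rightarrow> nat) \<Rightarrow> bool" where
  "distinguishing H h \<longleftrightarrow>
     (\<forall>\<psi>. automorphism H \<psi> \<and> preserves_coloring H h \<psi> \<longrightarrow> (\<forall>v\<in>pverts H. \<psi> v = v))"

text \<open>
  For a finite loop-free graph the least number exists, since an injective coloring is both proper
  and distinguishing.
\<close>

definition dist_chromatic_number :: "'a pair_pre_digraph \<Rightarrow> nat" where
  "dist_chromatic_number H =
     (LEAST r. \<exists>h. vertex_coloring H r h \<and> proper_coloring H h \<and> distinguishing H h)"

text \<open>
  \<^const>\<open>complete_digraph\<close> and \<^const>\<open>complete_bipartite_digraph\<close> are predicates, which already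
  mean ``is isomorphic to $K_n$'' and ``is isomorphic to $K_{m,n}$''.
\<close>

definition exceptional_graph :: "'a pair_pre_digraph \<Rightarrow> bool" where
  "exceptional_graph G \<longleftrightarrow>
     digraph_iso (with_proj G) (with_proj (cycle_graph 4)) \<or>
     complete_digraph 4 (with_proj G) \<or>
     digraph_iso (with_proj G) (with_proj (cycle_graph 6)) \<or>
     complete_bipartite_digraph 3 3 (with_proj G)"

end

theory Submission
  imports Defs "HOL-Combinatorics.Transposition"
begin

text \<open>
  The original vertices of the middle graph are those whose neighbourhood is a clique, so
  \<open>M(G)\<close> has the same automorphisms as \<open>G\<close>, and a proper colouring of \<open>M(G)\<close> is a proper edge
  colouring of \<open>G\<close> together with a colour at each vertex that is missing at it.  In a connected
  graph a colour-preserving automorphism with a fixed point is the identity.  Hence, given an edge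
  colouring with \<open>\<Delta> + 1\<close> colours (Vizing), a vertex of degree less than \<open>\<Delta>\<close> can be pinned down by
  its own colour, and only the \<open>\<Delta>\<close>-regular case is difficult.  There vertex colours are forced.

  Take as many disjoint perfect matchings as possible, each with its own colour, and let \<open>H\<close> be the
  rest.  If \<open>H\<close> is not empty, it has no perfect matching.  For a matching of \<open>H\<close> such that the
  uncovered vertices span a star, \<open>H\<close> can be coloured so that this matching is a colour class
  (Fournier).  Modifying a maximum matching of \<open>H\<close>, one can make the centre of the star, or
  some uncovered vertex, invariant under all colour-preserving automorphisms, unless \<open>H\<close> has a
  component that is a complete graph of odd order.  In that case recolouring one edge between two
  components of \<open>H\<close> suffices, or else \<open>G\<close> has a \<open>\<Delta>\<close>-edge-colouring.

  If \<open>G\<close> has a \<open>\<Delta>\<close>-edge-colouring, recolour one edge, or two disjoint edges of different colours,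
  with the unused colour.  If this never destroys all symmetry, then the automorphism inverting an
  edge \<open>x y\<close> inverts all edges of other colours disjoint from it.  This bounds the degree by 3
  and leaves only \<open>K\<^sub>4\<close>, \<open>K\<^sub>3\<^sub>,\<^sub>3\<close>, \<open>C\<^sub>4\<close> and \<open>C\<^sub>6\<close>, whose edge colourings with \<open>\<Delta> + 1\<close> colours are all
  preserved by an involution.
\<close>

text \<open>With \<Delta> + 1 colours a vertex of degree \<Delta> has exactly one colour left, so in
  a regular graph the vertex colours add no information and the edge colouring alone must break all
  symmetry. In a counterexample every such edge colouring keeps an automorphism that moves every
  vertex. The arguments share one shape: build a colouring in which some matching or vertex is
  recognisable, and read a structural restriction off the automorphism that must still exist.

  The obstacle is to prescribe a colour class. Vizing's theorem does not allow this, whence the star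
  version: after deleting a matching, only uncovered vertices keep degree \<Delta>. A perfect
  matching has no uncovered vertex to recognise, so perfect matchings are split off. Their colours
  are kept fixed, so the rest \<open>H\<close>, although possibly disconnected, inherits an
  automorphism without fixed vertices for each of its colourings.\<close>

section \<open>Edge colourings\<close>

text \<open>A two-coloured path is an orbit of its two partner maps, which generate a dihedral
  group. A point fixed by \<open>a\<close> other than \<open>s\<close> lies half a period away from
  \<open>s\<close>, so there is at most one. This takes the place of counting the ends of a
  path.\<close>

lemma involution_orbit_two_fixpoints:
  fixes a b :: "'a \<Rightarrow> 'a"
  assumes aa: "\<And>x. a (a x) = x" and bb: "\<And>x. b (b x) = x"
    and D: "\<And>x y. (x, y) \<in> D \<Longrightarrow> y = a x \<or> y = b x"
    and fp: "a s = s" "a t = t" "a r = r"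
    and reach: "(s, t) \<in> D\<^sup>*" "(s, r) \<in> D\<^sup>*"
    and ne: "t \<noteq> s" "r \<noteq> s"
  shows "t = r"
proof -
  \<comment> \<open>Rotations: \<open>q\<close> inverts \<open>p\<close>, and the reflection
    \<open>a\<close> exchanges \<open>(p ^^ n) s\<close> with \<open>(q ^^ n) s\<close>.\<close>
  define p where "p = (\<lambda>x. b (a x))"
  define q where "q = (\<lambda>x. a (b x))"
  have pq: "p (q x) = x" for x by (simp add: p_def q_def aa bb)
  have pnqn: "(p ^^ n) ((q ^^ n) x) = x" for n x
    by (induction n arbitrary: x) (simp_all add: funpow_swap1 pq)
  have ap: "a ((p ^^ n) s) = (q ^^ n) s" for n
    by (induction n) (use fp in \<open>simp_all add: p_def q_def\<close>)
  have aq: "a ((q ^^ n) s) = (p ^^ n) s" for n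
    using ap[of n] aa by metis
  have orbit: "\<exists>n. x = (p ^^ n) s \<or> x = (q ^^ n) s" if "(s, x) \<in> D\<^sup>*" for x
    using that
  proof (induction rule: rtrancl_induct)
    case base
    show ?case by (rule exI[of _ 0]) simp
  next
    case (step y z)
    then obtain n where n: "y = (p ^^ n) s \<or> y = (q ^^ n) s" by blast
    have bp: "\<exists>m. b ((p ^^ n) s) = (p ^^ m) s \<or> b ((p ^^ n) s) = (q ^^ m) s"
    proof -
      have e: "b ((p ^^ n) s) = p ((q ^^ n) s)"
        by (metis aq p_def)
      show ?thesis
      proof (cases n)
        case 0
        have "b ((p ^^ n) s) = (p ^^ Suc 0) s" using e 0 by simp
        then show ?thesis by blast
      next
        case (Suc m)
        then have "b ((p ^^ n) s) = (q ^^ m) s" using e by (simp add: pq)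
        then show ?thesis by blast
      qed
    qed
    have bq: "b ((q ^^ n) s) = (p ^^ Suc n) s"
      by (metis ap p_def funpow.simps(2) comp_apply)
    from D[OF step(2)] n show ?case
      using bp bq ap aq by metis
  qed
  have fixed: "\<exists>n. x = (p ^^ n) s \<and> (p ^^ (2 * n)) s = s" if x: "(s, x) \<in> D\<^sup>*" "a x = x" for x
  proof -
    obtain n where "x = (p ^^ n) s \<or> x = (q ^^ n) s" using orbit[OF x(1)] by blast
    then have "x = (p ^^ n) s" "x = (q ^^ n) s" using ap aq x(2) by metis+
    then have "(p ^^ n) ((p ^^ n) s) = s" using pnqn[of n s] by simp
    then show ?thesis using \<open>x = (p ^^ n) s\<close> by (auto simp: mult_2 funpow_add)
  qed
  obtain i where i: "t = (p ^^ i) s" "(p ^^ (2 * i)) s = s" using fixed reach fp by blast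
  obtain k where k: "r = (p ^^ k) s" "(p ^^ (2 * k)) s = s" using fixed reach fp by blast
  have "i \<noteq> 0" using i ne by (metis funpow_0)
  \<comment> \<open>\<open>N\<close> is the period of \<open>s\<close> under \<open>p\<close>. If
    \<open>2 * m\<close> rotations return to \<open>s\<close> but \<open>m\<close> do not, then
    \<open>m\<close> is congruent to \<open>N div 2\<close>.\<close>
  define N where "N = (LEAST n. n > 0 \<and> (p ^^ n) s = s)"
  have N: "N > 0" "(p ^^ N) s = s"
    using LeastI[of "\<lambda>n. n > 0 \<and> (p ^^ n) s = s" "2 * i"] i \<open>i \<noteq> 0\<close> by (auto simp: N_def)
  have least: "N \<le> n" if "n > 0" "(p ^^ n) s = s" for n
    unfolding N_def by (rule Least_le) (use that in simp)
  have "m mod N = N div 2 \<and> N = 2 * (N div 2)"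
    if m: "(p ^^ m) s \<noteq> s" "(p ^^ (2 * m)) s = s" for m
  proof -
    let ?m = "m mod N"
    have "(p ^^ ?m) s = (p ^^ m) s" by (rule funpow_mod_eq) (rule N)
    then have pos: "?m > 0" using m by (metis funpow_0 gr0I)
    have "(p ^^ (2 * m mod N)) s = s" using funpow_mod_eq[OF N(2)] m by metis
    then have "2 * m mod N = 0" using least[of "2 * m mod N"] N(1)
      by (metis gr0I mod_less_divisor not_le)
    then have "N dvd 2 * ?m" by (metis dvd_eq_mod_eq_0 mod_mult_right_eq)
    then obtain c where c: "2 * ?m = N * c" by auto
    have "?m < N" using N(1) by simp
    then have "N * c < N * 2" using c by linarith
    then have "c < 2" using N(1) by simp
    moreover have "c \<noteq> 0" using c pos by (metis less_numeral_extra(3) mult_0_right mult_eq_0_iff zero_neq_numeral)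
    ultimately have "2 * ?m = N" using c by (metis One_nat_def less_2_cases mult.right_neutral)
    then show ?thesis by (metis nonzero_mult_div_cancel_left zero_neq_numeral)
  qed
  then have "i mod N = k mod N" using i k ne by metis
  then show ?thesis using i(1) k(1) funpow_mod_eq[OF N(2)] by metis
qed

section \<open>Proper edge colourings and Kempe swaps\<close>

definition edge_coloring :: "nat \<Rightarrow> ('a \<times> 'a) set \<Rightarrow> ('a \<Rightarrow> 'a \<Rightarrow> nat) \<Rightarrow> bool" where
  "edge_coloring k R c \<longleftrightarrow> (\<forall>x y. (x, y) \<in> R \<longrightarrow> c x y < k \<and> c y x = c x y) \<and>
     (\<forall>x y z. (x, y) \<in> R \<longrightarrow> (x, z) \<in> R \<longrightarrow> c x y = c x z \<longrightarrow> y = z)"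

definition misses :: "('a \<times> 'a) set \<Rightarrow> ('a \<Rightarrow> 'a \<Rightarrow> nat) \<Rightarrow> 'a \<Rightarrow> nat \<Rightarrow> bool" where
  "misses R c x i \<longleftrightarrow> (\<forall>y. (x, y) \<in> R \<longrightarrow> c x y \<noteq> i)"

definition recolor :: "('a \<Rightarrow> 'a \<Rightarrow> nat) \<Rightarrow> 'a \<Rightarrow> 'a \<Rightarrow> nat \<Rightarrow> 'a \<Rightarrow> 'a \<Rightarrow> nat" where
  "recolor c u v i = (\<lambda>x y. if {x, y} = {u, v} then i else c x y)"

text \<open>Testing only the first end of an edge is still symmetric on a set satisfying
  \<open>chain_closed\<close>, as an edge leaving such a set has neither colour. The set may be a
  union of several chains.\<close>

definition kempe_swap :: "('a \<Rightarrow> 'a \<Rightarrow> nat) \<Rightarrow> 'a set \<Rightarrow> nat \<Rightarrow> nat \<Rightarrow> 'a \<Rightarrow> 'a \<Rightarrow> nat" where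
  "kempe_swap c S i j = (\<lambda>x y. if x \<in> S then transpose i j (c x y) else c x y)"

definition chain_closed ::
    "('a \<times> 'a) set \<Rightarrow> ('a \<Rightarrow> 'a \<Rightarrow> nat) \<Rightarrow> nat \<Rightarrow> nat \<Rightarrow> 'a set \<Rightarrow> bool" where
  "chain_closed R c i j S \<longleftrightarrow> (\<forall>x\<in>S. \<forall>y. (x, y) \<in> R \<longrightarrow> c x y \<in> {i, j} \<longrightarrow> y \<in> S)"

lemma edge_coloring_less: "edge_coloring k R c \<Longrightarrow> (x, y) \<in> R \<Longrightarrow> c x y < k"
  and edge_coloring_sym: "edge_coloring k R c \<Longrightarrow> (x, y) \<in> R \<Longrightarrow> c y x = c x y"
  and edge_coloring_inj:
    "edge_coloring k R c \<Longrightarrow> (x, y) \<in> R \<Longrightarrow> (x, z) \<in> R \<Longrightarrow> c x y = c x z \<Longrightarrow> y = z"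
  by (auto simp: edge_coloring_def)

lemma edge_coloring_subset: "edge_coloring k R c \<Longrightarrow> R' \<subseteq> R \<Longrightarrow> edge_coloring k R' c"
  unfolding edge_coloring_def by blast

lemma edge_coloring_add_edge:
  assumes c: "edge_coloring k (R - {(u, v), (v, u)}) c" and i: "i < k"
    and miss: "misses (R - {(u, v), (v, u)}) c u i" "misses (R - {(u, v), (v, u)}) c v i"
  shows "edge_coloring k R (recolor c u v i)"
  unfolding edge_coloring_def
proof (intro conjI allI impI)
  let ?R = "R - {(u, v), (v, u)}"
  have new: "recolor c u v i x y = i" if "{x, y} = {u, v}" for x y
    using that by (simp add: recolor_def)
  have old: "recolor c u v i x y = c x y \<and> (x, y) \<in> ?R"
    if "{x, y} \<noteq> {u, v}" "(x, y) \<in> R" for x y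
    using that by (auto simp: recolor_def)
  have missed: "c x y \<noteq> i" if "x \<in> {u, v}" "(x, y) \<in> ?R" for x y
    using that miss by (auto simp: misses_def)
  {
    fix x y assume xy: "(x, y) \<in> R"
    show "recolor c u v i x y < k"
      using new old[OF _ xy] i edge_coloring_less[OF c] by metis
    show "recolor c u v i y x = recolor c u v i x y"
      using edge_coloring_sym[OF c, of x y] xy
      by (cases "{x, y} = {u, v}") (auto simp: recolor_def insert_commute)
  }
  fix x y z assume xy: "(x, y) \<in> R" and xz: "(x, z) \<in> R"
    and eq: "recolor c u v i x y = recolor c u v i x z"
  show "y = z"
  proof (cases "{x, y} = {u, v}"; cases "{x, z} = {u, v}")
    assume "{x, y} = {u, v}" "{x, z} = {u, v}"
    then show ?thesis by (metis doubleton_eq_iff)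
  next
    assume a: "{x, y} = {u, v}" "{x, z} \<noteq> {u, v}"
    then show ?thesis using new[OF a(1)] old[OF a(2) xz] missed[of x z] eq by auto
  next
    assume a: "{x, y} \<noteq> {u, v}" "{x, z} = {u, v}"
    then show ?thesis using new[OF a(2)] old[OF a(1) xy] missed[of x y] eq by auto
  next
    assume "{x, y} \<noteq> {u, v}" "{x, z} \<noteq> {u, v}"
    then show ?thesis using old xy xz eq edge_coloring_inj[OF c] by metis
  qed
qed

lemma edge_coloring_kempe_swap:
  assumes c: "edge_coloring k R c" and ij: "i < k" "j < k" and R: "sym R"
    and S: "chain_closed R c i j S"
  shows "edge_coloring k R (kempe_swap c S i j)"
  unfolding edge_coloring_def
proof (intro conjI allI impI)
  fix x y assume xy: "(x, y) \<in> R"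
  then have yx: "(y, x) \<in> R" using R by (auto dest: symD)
  have cs: "c y x = c x y" "c x y < k" using c xy by (auto simp: edge_coloring_def)
  show "kempe_swap c S i j x y < k" using cs ij by (auto simp: kempe_swap_def transpose_def)
  show "kempe_swap c S i j y x = kempe_swap c S i j x y"
  proof (cases "x \<in> S \<longleftrightarrow> y \<in> S")
    case True
    then show ?thesis using cs by (simp add: kempe_swap_def)
  next
    case False
    then have "c x y \<notin> {i, j}" using S xy yx cs(1) unfolding chain_closed_def by metis
    then show ?thesis using cs(1) by (simp add: kempe_swap_def)
  qed
next
  fix x y z assume "(x, y) \<in> R" "(x, z) \<in> R" "kempe_swap c S i j x y = kempe_swap c S i j x z"
  then show "y = z" using edge_coloring_inj[OF c]
    by (auto simp: kempe_swap_def inj_eq split: if_splits)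
qed

text \<open>The swap turns the colour \<open>j\<close> missing at \<open>v\<close> into
  \<open>i\<close> and does not touch \<open>u\<close>; then both ends of the uncoloured edge miss
  \<open>i\<close>.\<close>

lemma edge_coloring_extend_kempe:
  assumes c: "edge_coloring k (R - {(u, v), (v, u)}) c" and R: "sym R"
    and ij: "i < k" "j < k"
    and miss: "misses (R - {(u, v), (v, u)}) c u i" "misses (R - {(u, v), (v, u)}) c v j"
    and S: "chain_closed (R - {(u, v), (v, u)}) c i j S" "v \<in> S" "u \<notin> S"
  shows "\<exists>c'. edge_coloring k R c'"
proof -
  have "sym (R - {(u, v), (v, u)})" using R by (auto simp: sym_def)
  then have "edge_coloring k (R - {(u, v), (v, u)}) (kempe_swap c S i j)"
    using edge_coloring_kempe_swap c ij S(1) by blast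
  moreover note ij(1)
  moreover have "misses (R - {(u, v), (v, u)}) (kempe_swap c S i j) u i"
    using miss S by (auto simp: misses_def kempe_swap_def)
  moreover have "misses (R - {(u, v), (v, u)}) (kempe_swap c S i j) v i"
    using miss S by (auto simp: misses_def kempe_swap_def transpose_def)
  ultimately have "edge_coloring k R (recolor (kempe_swap c S i j) u v i)"
    by (rule edge_coloring_add_edge)
  then show ?thesis by blast
qed

lemma ex_missing_color:
  assumes "finite R" "card (R `` {x}) < k"
  shows "\<exists>i<k. misses R c x i"
proof -
  have "card (c x ` (R `` {x})) < k"
    using card_image_le[of "R `` {x}" "c x"] assms by auto
  then have "\<not> {..<k} \<subseteq> c x ` (R `` {x})"
    using card_mono[of "c x ` (R `` {x})" "{..<k}"] assms by (auto simp: not_le)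
  then show ?thesis by (auto simp: misses_def)
qed

section \<open>Vizing fans\<close>

text \<open>A Vizing fan centred at \<open>u\<close>, starting from the uncoloured edge to \<open>w 0\<close>.\<close>

definition fan ::
    "('a \<times> 'a) set \<Rightarrow> ('a \<Rightarrow> 'a \<Rightarrow> nat) \<Rightarrow> 'a \<Rightarrow> nat \<Rightarrow> (nat \<Rightarrow> 'a) \<Rightarrow> bool" where
  "fan R c u n w \<longleftrightarrow> inj_on w {..n} \<and> (\<forall>i\<le>n. (u, w i) \<in> R) \<and>
     (\<forall>i<n. misses (R - {(u, w 0), (w 0, u)}) c (w i) (c u (w (Suc i))))"

lemma fan_injD: "fan R c u n w \<Longrightarrow> i \<le> n \<Longrightarrow> j \<le> n \<Longrightarrow> w i = w j \<longleftrightarrow> i = j"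
  and fan_edgeD: "fan R c u n w \<Longrightarrow> i \<le> n \<Longrightarrow> (u, w i) \<in> R"
  and fan_missesD: "fan R c u n w \<Longrightarrow> i < n \<Longrightarrow>
    misses (R - {(u, w 0), (w 0, u)}) c (w i) (c u (w (Suc i)))"
  by (auto simp: fan_def dest: inj_onD)

text \<open>Each spoke before \<open>w i\<close> takes the colour of its successor, so the
  uncoloured edge moves from \<open>w 0\<close> to \<open>w i\<close>. Nothing changes away from the
  centre, hence chains avoiding \<open>u\<close> are the same for all shifts.\<close>

definition fan_shifted ::
    "nat \<Rightarrow> ('a \<times> 'a) set \<Rightarrow> ('a \<Rightarrow> 'a \<Rightarrow> nat) \<Rightarrow> 'a \<Rightarrow> (nat \<Rightarrow> 'a) \<Rightarrow> nat \<Rightarrow> ('a \<Rightarrow> 'a \<Rightarrow> nat) \<Rightarrow> bool"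
  where "fan_shifted k R c u w i c' \<longleftrightarrow> edge_coloring k (R - {(u, w i), (w i, u)}) c' \<and>
      (\<forall>x y. x \<noteq> u \<longrightarrow> y \<noteq> u \<longrightarrow> c' x y = c x y) \<and>
      (\<forall>j<i. c' u (w j) = c u (w (Suc j))) \<and> (\<forall>y. y \<notin> w ` {..i} \<longrightarrow> c' u y = c u y)"

lemma fan_shifted_coloring:
    "fan_shifted k R c u w i c' \<Longrightarrow> edge_coloring k (R - {(u, w i), (w i, u)}) c'"
  and fan_shifted_off: "fan_shifted k R c u w i c' \<Longrightarrow> x \<noteq> u \<Longrightarrow> y \<noteq> u \<Longrightarrow> c' x y = c x y"
  and fan_shifted_less: "fan_shifted k R c u w i c' \<Longrightarrow> j < i \<Longrightarrow> c' u (w j) = c u (w (Suc j))"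
  and fan_shifted_rest: "fan_shifted k R c u w i c' \<Longrightarrow> y \<notin> w ` {..i} \<Longrightarrow> c' u y = c u y"
  unfolding fan_shifted_def by blast+

lemma fan_shift:
  assumes c: "edge_coloring k (R - {(u, w 0), (w 0, u)}) c" and R: "sym R" "irrefl R"
    and w: "fan R c u n w" and i: "i \<le> n"
  shows "\<exists>c'. fan_shifted k R c u w i c'"
  using i
proof (induction i)
  case 0
  show ?case using c unfolding fan_shifted_def by blast
next
  case (Suc i)
  from Suc.IH[OF Suc_leD[OF Suc.prems]] obtain c' where fs: "fan_shifted k R c u w i c'"
    by blast
  note c' = fan_shifted_coloring[OF fs] and off = fan_shifted_off[OF fs]
    and sh = fan_shifted_less[OF fs] and rest = fan_shifted_rest[OF fs]
  have inj: "w j = w l \<longleftrightarrow> j = l" if "j \<le> n" "l \<le> n" for j l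
    using fan_injD[OF w] that by blast
  have edge: "(u, w j) \<in> R" if "j \<le> n" for j using fan_edgeD[OF w that] .
  have neu: "w j \<noteq> u" if "j \<le> n" for j using edge[OF that] R(2) by (auto simp: irrefl_def)
  \<comment> \<open>This colour is missing at \<open>w i\<close> by the fan condition, and it
    becomes free at \<open>u\<close> once the next spoke is uncoloured.\<close>
  let ?b = "c u (w (Suc i))"
  let ?R = "R - {(u, w i), (w i, u)} - {(u, w (Suc i)), (w (Suc i), u)}"
  let ?R' = "R - {(u, w (Suc i)), (w (Suc i), u)} - {(u, w i), (w i, u)}"
  have eq: "?R' = ?R" by blast
  have "w (Suc i) \<notin> w ` {..i}"
  proof
    assume "w (Suc i) \<in> w ` {..i}"
    then obtain l where "l \<le> i" "w (Suc i) = w l" by blast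
    then show False using inj[of "Suc i" l] Suc.prems by simp
  qed
  then have b: "c' u (w (Suc i)) = ?b" by (rule rest)
  have e1: "(u, w (Suc i)) \<in> R - {(u, w i), (w i, u)}"
    using edge[of "Suc i"] inj[of i "Suc i"] neu[of "Suc i"] Suc.prems by auto
  have "?b < k" using edge_coloring_less[OF c' e1] b by simp
  moreover have "edge_coloring k ?R c'" using c' by (rule edge_coloring_subset) blast
  moreover have "misses ?R c' u ?b"
    unfolding misses_def
  proof (intro allI impI notI)
    fix y assume "(u, y) \<in> ?R" "c' u y = ?b"
    then show False using edge_coloring_inj[OF c' _ e1, of y] b by simp
  qed
  moreover have "misses ?R c' (w i) ?b"
  proof -
    have m: "misses (R - {(u, w 0), (w 0, u)}) c (w i) ?b"
      using fan_missesD[OF w, of i] Suc.prems by simp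
    show ?thesis unfolding misses_def
    proof (intro allI impI)
      fix y assume y: "(w i, y) \<in> ?R"
      have 1: "w i \<noteq> u" using neu[of i] Suc.prems by simp
      have 2: "y \<noteq> u" using y by blast
      have 3: "(w i, y) \<in> R - {(u, w 0), (w 0, u)}" using y 1 2 by blast
      show "c' (w i) y \<noteq> ?b" using m 3 off[OF 1 2] unfolding misses_def by metis
    qed
  qed
  ultimately have "edge_coloring k (R - {(u, w (Suc i)), (w (Suc i), u)}) (recolor c' u (w i) ?b)"
    by (intro edge_coloring_add_edge) (simp_all only: eq)
  moreover have "recolor c' u (w i) ?b x y = c x y" if "x \<noteq> u" "y \<noteq> u" for x y
    using off[OF that] that by (auto simp: recolor_def doubleton_eq_iff)
  moreover have "recolor c' u (w i) ?b u (w j) = c u (w (Suc j))" if "j < Suc i" for j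
    using sh[of j] that inj[of j i] Suc.prems neu[of j]
    by (cases "j = i") (auto simp: recolor_def doubleton_eq_iff)
  moreover have "recolor c' u (w i) ?b u y = c u y" if "y \<notin> w ` {..Suc i}" for y
  proof -
    have "y \<noteq> w i" "y \<notin> w ` {..i}" using that by auto
    then show ?thesis
      using rest[of y] neu[of i] Suc.prems by (simp add: recolor_def doubleton_eq_iff)
  qed
  ultimately show ?case unfolding fan_shifted_def by blast
qed


text \<open>
  Every vertex other than the centre \<open>u\<close> keeps its set of missing colours when the fan is shifted,
  so a colour missing at two fan vertices produces a two-coloured path with three ends.
\<close>

lemma edge_coloring_extend_vizing:
  assumes fin: "finite R" and R: "sym R" "irrefl R" and uv: "(u, v) \<in> R"
    and c: "edge_coloring k (R - {(u, v), (v, u)}) c"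
    and deg: "card (R `` {u}) \<le> k" "card (R `` {v}) \<le> k"
      "\<And>y. (u, y) \<in> R \<Longrightarrow> y \<noteq> v \<Longrightarrow> card (R `` {y}) < k"
  shows "\<exists>c'. edge_coloring k R c'"
proof -
  let ?R0 = "R - {(u, v), (v, u)}"
  have finI: "finite (R `` {x})" for x using fin by (simp add: finite_Image)
  have fan_bound: "n < card (R `` {u})" if "fan R c u n w" for n w
  proof -
    have "w ` {..n} \<subseteq> R `` {u}" using fan_edgeD[OF that] by auto
    moreover have "card (w ` {..n}) = Suc n"
      using that by (simp add: fan_def card_image)
    ultimately show ?thesis using card_mono[OF finI, of "w ` {..n}" u] by simp
  qed
  \<comment> \<open>The degree of \<open>u\<close> bounds the length of a fan, so a longest fan
    starting at \<open>v\<close> exists.\<close>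
  define P where "P = (\<lambda>n. \<exists>w. fan R c u n w \<and> w 0 = v)"
  have "P 0" unfolding P_def by (rule exI[of _ "\<lambda>_. v"]) (use uv in \<open>simp add: fan_def\<close>)
  moreover have "\<forall>n. P n \<longrightarrow> n \<le> card (R `` {u})" using fan_bound by (auto simp: P_def less_imp_le)
  ultimately obtain n where n: "P n" "\<And>m. P m \<Longrightarrow> m \<le> n"
    by (metis Greatest_le_nat GreatestI_nat)
  then obtain w where w: "fan R c u n w" and w0: "w 0 = v" by (auto simp: P_def)
  have c0: "edge_coloring k (R - {(u, w 0), (w 0, u)}) c" using c w0 by simp
  have inj: "w i = w j \<longleftrightarrow> i = j" if "i \<le> n" "j \<le> n" for i j
    using fan_injD[OF w] that .
  have edge: "(u, w i) \<in> R" if "i \<le> n" for i using fan_edgeD[OF w that] .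
  have neu: "w i \<noteq> u" if "i \<le> n" for i using edge[OF that] R(2) by (auto simp: irrefl_def)
  have vu: "(v, u) \<in> R" using uv R(1) by (auto dest: symD)
  have fin0: "finite ?R0" using fin by simp
  have "?R0 `` {u} \<subset> R `` {u}" using uv by auto
  then have "card (?R0 `` {u}) < k" using deg(1) psubset_card_mono[OF finI, of _ u] by (meson less_le_trans)
  then obtain \<alpha> where \<alpha>: "\<alpha> < k" "misses ?R0 c u \<alpha>" using ex_missing_color[OF fin0] by blast
  \<comment> \<open>The end \<open>v\<close> has lost an edge in \<open>?R0\<close>, so degree
    \<open>k\<close> is allowed there; every other fan vertex has degree less than
    \<open>k\<close>.\<close>
  have "card (?R0 `` {w n}) < k"
  proof (cases "n = 0")
    case True
    have "?R0 `` {v} \<subset> R `` {v}" using vu by auto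
    then have "card (?R0 `` {v}) < k"
      using deg(2) psubset_card_mono[OF finI, of _ v] by (meson less_le_trans)
    then show ?thesis using w0 True by simp
  next
    case False
    then have "w n \<noteq> v" using inj[of n 0] w0 by simp
    then have "card (R `` {w n}) < k" using deg(3) edge by blast
    moreover have "card (?R0 `` {w n}) \<le> card (R `` {w n})"
      by (rule card_mono[OF finI]) auto
    ultimately show ?thesis by simp
  qed
  then obtain \<beta> where \<beta>: "\<beta> < k" "misses ?R0 c (w n) \<beta>" using ex_missing_color[OF fin0] by blast
  have shift: "\<exists>c'. fan_shifted k R c u w i c'" if "i \<le> n" for i
    by (rule fan_shift[OF c0 R w that])
  have shift_u: "\<exists>z. (u, z) \<in> ?R0 \<and> c' u y = c u z"
    if i: "i \<le> n" and y: "(u, y) \<in> R - {(u, w i), (w i, u)}" and fs: "fan_shifted k R c u w i c'"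
    for i y c'
  proof (cases "y \<in> w ` {..i}")
    case True
    then obtain j where j: "y = w j" "j \<le> i" by auto
    moreover have "j \<noteq> i" using y j by auto
    ultimately have "j < i" by simp
    moreover have "(u, w (Suc j)) \<in> ?R0"
      using edge[of "Suc j"] inj[of "Suc j" 0] neu[of "Suc j"] w0 \<open>j < i\<close> i by auto
    ultimately show ?thesis using fan_shifted_less[OF fs] j by blast
  next
    case False
    then have "y \<noteq> v" using w0 by auto
    then have "(u, y) \<in> ?R0" using y vu R(2) by (auto simp: irrefl_def)
    then show ?thesis using fan_shifted_rest[OF fs False] by blast
  qed
  have shift_x: "misses (R - {(u, w i), (w i, u)}) c' (w i) \<gamma>"
    if i: "i \<le> n" and m: "misses ?R0 c (w i) \<gamma>"
      and fs: "fan_shifted k R c u w i c'" for i c' \<gamma>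
    unfolding misses_def
  proof (intro allI impI)
    fix y assume y: "(w i, y) \<in> R - {(u, w i), (w i, u)}"
    have 1: "w i \<noteq> u" "y \<noteq> u" using neu i y by auto
    then have "(w i, y) \<in> ?R0" using y by auto
    then show "c' (w i) y \<noteq> \<gamma>"
      using m fan_shifted_off[OF fs 1] unfolding misses_def by metis
  qed
  show ?thesis
  proof (cases "misses ?R0 c u \<beta>")
    case True
    obtain c' where c': "fan_shifted k R c u w n c'" using shift[OF order_refl] by blast
    have "misses (R - {(u, w n), (w n, u)}) c' u \<beta>"
      using shift_u[OF order_refl _ c'] True unfolding misses_def by metis
    then show ?thesis
      using edge_coloring_add_edge[OF fan_shifted_coloring[OF c'] \<beta>(1)]
        shift_x[OF order_refl \<beta>(2) c'] by blast
  next
    case False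
    then obtain y where y: "(u, y) \<in> ?R0" "c u y = \<beta>" by (auto simp: misses_def)
    have "y \<in> w ` {..n}"
    proof (rule ccontr)
      assume ny: "y \<notin> w ` {..n}"
      \<comment> \<open>\<open>y\<close> would prolong the longest fan, because \<open>w n\<close>
        misses the colour \<beta> of the edge from \<open>u\<close> to \<open>y\<close>.\<close>
      let ?w = "w(Suc n := y)"
      have "inj_on ?w {..Suc n}"
        using w ny by (auto simp: fan_def atMost_Suc inj_on_fun_updI)
      moreover have "(u, ?w i) \<in> R" if "i \<le> Suc n" for i
        using that edge[of i] y by (auto simp: le_Suc_eq)
      moreover have "misses (R - {(u, ?w 0), (?w 0, u)}) c (?w i) (c u (?w (Suc i)))"
        if "i < Suc n" for i
        using that fan_missesD[OF w, of i] \<beta>(2) y(2) w0 by (cases "i = n") auto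
      ultimately have "fan R c u (Suc n) ?w" unfolding fan_def by blast
      then have "P (Suc n)" using w0 unfolding P_def by (intro exI[of _ ?w]) simp
      then show False using n(2) by fastforce
    qed
    then obtain j where j: "y = w j" "j \<le> n" by auto
    have "(u, v) \<notin> ?R0" by simp
    then have "j \<noteq> 0" using y(1) j(1) w0 by metis
    then obtain i where i: "j = Suc i" by (cases j) auto
    have "(w n, u) \<in> ?R0" if "j = n"
      using y j that R(1) by (auto dest: symD)
    then have "j \<noteq> n"
      using edge_coloring_sym[OF c y(1)] \<beta>(2) y j unfolding misses_def by metis
    then have lt: "i < n" "Suc i < n" using i j by auto
    have cSi: "c u (w (Suc i)) = \<beta>" using y j i by simp
    have mi: "misses ?R0 c (w i) \<beta>" using fan_missesD[OF w lt(1)] w0 cSi by simp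
    have ySi: "(u, w (Suc i)) \<in> ?R0" using y(1) j(1) i by simp
    \<comment> \<open>The two-coloured graph with the centre deleted; it is the same for
      \<open>c\<close> and for every shifted colouring.\<close>
    define D where "D = {(x, y) \<in> R. x \<noteq> u \<and> y \<noteq> u \<and> c x y \<in> {\<alpha>, \<beta>}}"
    have D0: "(x, y) \<in> ?R0 \<and> c x y \<in> {\<alpha>, \<beta>}" if "(x, y) \<in> D" for x y
      using that by (auto simp: D_def)
    have Dsym: "sym D"
    proof (rule symI)
      fix x y assume "(x, y) \<in> D"
      then show "(y, x) \<in> D"
        using edge_coloring_sym[OF c] D0[of x y] R(1) by (auto simp: D_def dest: symD)
    qed
    have nreach: "u \<notin> D\<^sup>* `` {w l}" if "l \<le> n" for l
    proof
      assume "u \<in> D\<^sup>* `` {w l}"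
      then have "(w l, u) \<in> D\<^sup>*" by simp
      then show False using neu[OF that] by (cases rule: rtranclE) (auto simp: D_def)
    qed
    \<comment> \<open>After the shift to \<open>w m\<close> the only \<beta>-edge at
      \<open>u\<close> leads to \<open>w l\<close>, and \<alpha> is missing at \<open>u\<close>. If
      the chain of \<open>w m\<close> avoids \<open>w l\<close>, it never reaches \<open>u\<close>
      and can be swapped.\<close>
    have chain: "w l \<in> D\<^sup>* `` {w m} \<or> (\<exists>c'. edge_coloring k R c')"
      if m: "m \<le> n" "misses ?R0 c (w m) \<beta>" and l: "l \<le> n"
        and c': "fan_shifted k R c u w m c'"
        and next_beta: "c' u (w l) = \<beta>" "l \<noteq> m" for m l c'
    proof -
      have ext: "\<exists>c'. edge_coloring k R c'" if nl: "w l \<notin> D\<^sup>* `` {w m}"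
      proof -
        let ?Rm = "R - {(u, w m), (w m, u)}"
        have a: "misses ?Rm c' u \<alpha>"
          using shift_u[OF m(1) _ c'] \<alpha>(2) unfolding misses_def by metis
        have wl: "(u, w l) \<in> ?Rm"
          using edge[OF l] inj[OF l m(1)] neu[OF l] next_beta(2) by auto
        have "chain_closed ?Rm c' \<alpha> \<beta> (D\<^sup>* `` {w m})"
          unfolding chain_closed_def
        proof (intro ballI allI impI)
          fix x y assume x: "x \<in> D\<^sup>* `` {w m}" and xy: "(x, y) \<in> ?Rm" and cxy: "c' x y \<in> {\<alpha>, \<beta>}"
          have xu: "x \<noteq> u" using nreach[OF m(1)] x by auto
          have "y \<noteq> u"
          proof
            assume yu: "y = u"
            have ux: "(u, x) \<in> ?Rm" using xy yu R(1) by (auto dest: symD)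
            have "c' u x = c' x u" using edge_coloring_sym[OF fan_shifted_coloring[OF c'], of x u] xy yu by simp
            then have "c' u x = \<beta>" using a ux cxy yu unfolding misses_def by auto
            then have "x = w l"
              using edge_coloring_inj[OF fan_shifted_coloring[OF c'] ux wl] next_beta by simp
            then show False using x nl by simp
          qed
          then have "(x, y) \<in> D" using xu xy cxy fan_shifted_off[OF c' xu] by (auto simp: D_def)
          then show "y \<in> D\<^sup>* `` {w m}" using x by (auto intro: rtrancl_into_rtrancl)
        qed
        then show "\<exists>c'. edge_coloring k R c'"
          using edge_coloring_extend_kempe[OF fan_shifted_coloring[OF c'] R(1) \<alpha>(1) \<beta>(1) a shift_x[OF m c']]
            nreach[OF m(1)] by auto
      qed
      then show ?thesis by blast
    qed
    show ?thesis
    proof (rule ccontr)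
      assume no: "\<nexists>c'. edge_coloring k R c'"
      obtain c1 where c1: "fan_shifted k R c u w n c1"
        using shift[OF order_refl] by blast
      have "c1 u (w i) = \<beta>" using fan_shifted_less[OF c1] lt cSi by simp
      then have r1: "(w n, w i) \<in> D\<^sup>*"
        using chain[OF order_refl \<beta>(2) _ c1, of i] lt no by auto
      obtain c2 where c2: "fan_shifted k R c u w i c2"
        using shift[of i] lt by auto
      have "w (Suc i) \<noteq> w l" if "l \<le> i" for l using inj[of "Suc i" l] lt that by simp
      then have "w (Suc i) \<notin> w ` {..i}" by blast
      then have "c2 u (w (Suc i)) = \<beta>" using fan_shifted_rest[OF c2] cSi by simp
      then have r2: "(w i, w (Suc i)) \<in> D\<^sup>*"
        using chain[OF _ mi _ c2, of "Suc i"] lt no by auto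
      \<comment> \<open>The partner along colour \<gamma> inside \<open>D\<close>, or the vertex
        itself if there is none. For \<beta> the vertices \<open>w n\<close>, \<open>w i\<close> and
        \<open>w (Suc i)\<close> are fixed, the last one because its \<beta>-edge leads to the
        deleted centre.\<close>
      define a where "a = (\<lambda>\<gamma> x. if \<exists>y. (x, y) \<in> D \<and> c x y = \<gamma> then THE y. (x, y) \<in> D \<and> c x y = \<gamma> else x)"
      have aI: "a \<gamma> x = y" if "(x, y) \<in> D" "c x y = \<gamma>" for \<gamma> x y
      proof -
        have "(THE y. (x, y) \<in> D \<and> c x y = \<gamma>) = y"
          by (rule the_equality) (use that edge_coloring_inj[OF c] D0 in blast)+
        then show ?thesis using that by (auto simp: a_def)
      qed
      have aid: "a \<gamma> x = x" if "\<And>y. (x, y) \<in> D \<Longrightarrow> c x y \<noteq> \<gamma>" for \<gamma> x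
        using that by (auto simp: a_def)
      have aa: "a \<gamma> (a \<gamma> x) = x" for \<gamma> x
      proof (cases "\<exists>y. (x, y) \<in> D \<and> c x y = \<gamma>")
        case True
        then obtain y where y: "(x, y) \<in> D" "c x y = \<gamma>" by blast
        moreover have "(y, x) \<in> D" "c y x = \<gamma>"
          using y Dsym edge_coloring_sym[OF c] D0 by (auto dest: symD)
        ultimately show ?thesis using aI by simp
      next
        case False
        then show ?thesis using aid[of x \<gamma>] by auto
      qed
      have fixn: "a \<beta> (w n) = w n" using \<beta>(2) D0 by (intro aid) (auto simp: misses_def)
      have fixi: "a \<beta> (w i) = w i" using mi D0 by (intro aid) (auto simp: misses_def)
      have fixj: "a \<beta> (w (Suc i)) = w (Suc i)"
      proof (rule aid)
        fix y assume d: "(w (Suc i), y) \<in> D"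
        have "(u, w (Suc i)) \<in> ?R0" using ySi by simp
        then have "(w (Suc i), u) \<in> ?R0" "c (w (Suc i)) u = \<beta>"
          using R(1) edge_coloring_sym[OF c] cSi by (auto dest: symD)
        then show "c (w (Suc i)) y \<noteq> \<beta>"
          using edge_coloring_inj[OF c, of "w (Suc i)" u y] D0[OF d] d by (auto simp: D_def)
      qed
      have Dab: "y = a \<beta> x \<or> y = a \<alpha> x" if "(x, y) \<in> D" for x y
        using aI[OF that] D0[OF that] by auto
      have "w i = w (Suc i)"
        by (rule involution_orbit_two_fixpoints[of "a \<beta>" "a \<alpha>" D "w n"])
          (use aa Dab fixn fixi fixj r1 r2 lt inj in \<open>auto intro: rtrancl_trans\<close>)
      then show False using inj[of i "Suc i"] lt by simp
    qed
  qed
qed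

text \<open>
  A weak form of Fournier's theorem: the vertices of degree \<open>k\<close> may span a star with centre \<open>a\<close>.
\<close>

theorem edge_coloring_exists_star_core:
  assumes "finite R" "sym R" "irrefl R" "\<And>x. card (R `` {x}) \<le> k"
    and "\<And>x y. (x, y) \<in> R \<Longrightarrow> card (R `` {x}) = k \<Longrightarrow> card (R `` {y}) = k \<Longrightarrow> x = a \<or> y = a"
  shows "\<exists>c. edge_coloring k R c"
  using assms
proof (induction "card R" arbitrary: R rule: less_induct)
  case less
  note fin = less.prems(1) and R = less.prems(2,3) and deg = less.prems(4) and star = less.prems(5)
  have finI: "finite (R `` {x})" for x using fin by (simp add: finite_Image)
  show ?case
  proof (cases "R = {}")
    case True
    then show ?thesis by (auto simp: edge_coloring_def)
  next
    case False
    \<comment> \<open>The edge to delete runs from a leaf of the star to its centre \<open>a\<close>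
      if two vertices of degree \<open>k\<close> are adjacent; otherwise it is any edge at a vertex
      of degree \<open>k\<close>, or any edge at all if there is no such vertex.\<close>
    obtain u v where uv: "(u, v) \<in> R"
      and nbr: "\<And>y. (u, y) \<in> R \<Longrightarrow> y \<noteq> v \<Longrightarrow> card (R `` {y}) < k"
    proof (cases "\<exists>u v. (u, v) \<in> R \<and> card (R `` {u}) = k \<and> card (R `` {v}) = k")
      case True
      then obtain u v where "(u, v) \<in> R" "card (R `` {u}) = k" "card (R `` {v}) = k" by blast
      then obtain u v where uv: "(u, v) \<in> R" "card (R `` {u}) = k" "v = a"
        using star R by (metis symD)
      then have "u \<noteq> a" using R by (auto simp: irrefl_def)
      then have "card (R `` {y}) < k" if "(u, y) \<in> R" "y \<noteq> v" for y
        using that star[OF that(1)] uv deg[of y] by (auto simp: le_less)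
      then show ?thesis using that uv by blast
    next
      case none: False
      show ?thesis
      proof (cases "\<exists>u v. (u, v) \<in> R \<and> card (R `` {u}) = k")
        case True
        then show ?thesis using that none deg by (metis le_neq_implies_less)
      next
        case False
        then have "card (R `` {y}) < k" if "(u, y) \<in> R" for u y
          using that deg[of y] R by (metis le_neq_implies_less symD)
        then show ?thesis using that \<open>R \<noteq> {}\<close> by (metis ex_in_conv surj_pair)
      qed
    qed
    let ?R = "R - {(u, v), (v, u)}"
    have sub: "?R `` {x} \<subseteq> R `` {x}" for x by auto
    have le: "card (?R `` {x}) \<le> card (R `` {x})" for x by (rule card_mono[OF finI sub])
    have "card ?R < card R" by (rule psubset_card_mono[OF fin]) (use uv in auto)
    moreover have "finite ?R" "sym ?R" "irrefl ?R"
      using fin R by (auto simp: sym_def irrefl_def)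
    moreover have "card (?R `` {x}) \<le> k" for x using le[of x] deg[of x] by simp
    moreover have "x = a \<or> y = a"
      if "(x, y) \<in> ?R" "card (?R `` {x}) = k" "card (?R `` {y}) = k" for x y
      using star[of x y] that le[of x] le[of y] deg[of x] deg[of y] by auto
    ultimately obtain c where "edge_coloring k ?R c" using less.hyps by blast
    then show ?thesis using edge_coloring_extend_vizing[OF fin R uv] deg nbr by blast
  qed
qed

section \<open>Colour-preserving automorphisms\<close>

lemma even_card_involution:
  assumes "finite S" "\<And>x. x \<in> S \<Longrightarrow> f x \<in> S \<and> f x \<noteq> x \<and> f (f x) = x"
  shows "even (card S)"
  using assms
proof (induction "card S" arbitrary: S rule: less_induct)
  case less
  show ?case
  proof (cases "S = {}")
    case False
    then obtain x where x: "x \<in> S" by blast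
    let ?S = "S - {x, f x}"
    have fx: "f x \<in> S" "f x \<noteq> x" "f (f x) = x" using less.prems(2) x by auto
    have "card ?S = card S - 2"
      using less.prems(1) x fx by (subst card_Diff_subset) auto
    moreover have "card {x, f x} \<le> card S" using less.prems(1) x fx by (intro card_mono) auto
    then have "card S \<ge> 2" using fx(2) by simp
    moreover have "even (card ?S)"
    proof (rule less.hyps)
      show "card ?S < card S" using calculation by linarith
      show "f y \<in> ?S \<and> f y \<noteq> y \<and> f (f y) = y" if "y \<in> ?S" for y
        using that less.prems(2)[of y] fx by auto
    qed (use less.prems in simp)
    ultimately show ?thesis by simp
  qed simp
qed

definition graph_aut :: "'a set \<Rightarrow> ('a \<times> 'a) set \<Rightarrow> ('a \<Rightarrow> 'a) \<Rightarrow> bool" where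
  "graph_aut V R g \<longleftrightarrow> bij_betw g V V \<and> (\<forall>x\<in>V. \<forall>y\<in>V. (g x, g y) \<in> R \<longleftrightarrow> (x, y) \<in> R)"

definition color_aut ::
    "'a set \<Rightarrow> ('a \<times> 'a) set \<Rightarrow> ('a \<Rightarrow> 'a \<Rightarrow> nat) \<Rightarrow> ('a \<Rightarrow> 'a) \<Rightarrow> bool" where
  "color_aut V R c g \<longleftrightarrow> graph_aut V R g \<and> (\<forall>x y. (x, y) \<in> R \<longrightarrow> c (g x) (g y) = c x y)"

text \<open>
  Matchings are represented by involutions, the uncovered vertices being the fixed points.
\<close>

definition matching :: "('a \<times> 'a) set \<Rightarrow> ('a \<Rightarrow> 'a) \<Rightarrow> bool" where
  "matching R f \<longleftrightarrow> (\<forall>x. f (f x) = x) \<and> (\<forall>x. f x \<noteq> x \<longrightarrow> (x, f x) \<in> R)"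

lemma matching_invol: "matching R f \<Longrightarrow> f (f x) = x"
  and matching_edge: "matching R f \<Longrightarrow> f x \<noteq> x \<Longrightarrow> (x, f x) \<in> R"
  by (auto simp: matching_def)

lemma graph_aut_mem: "graph_aut V R g \<Longrightarrow> x \<in> V \<Longrightarrow> g x \<in> V"
  and graph_aut_inj: "graph_aut V R g \<Longrightarrow> x \<in> V \<Longrightarrow> y \<in> V \<Longrightarrow> g x = g y \<longleftrightarrow> x = y"
  and graph_aut_surj: "graph_aut V R g \<Longrightarrow> y \<in> V \<Longrightarrow> \<exists>x\<in>V. y = g x"
  and graph_aut_edge: "graph_aut V R g \<Longrightarrow> x \<in> V \<Longrightarrow> y \<in> V \<Longrightarrow> (g x, g y) \<in> R \<longleftrightarrow> (x, y) \<in> R"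
  by (auto simp: graph_aut_def bij_betw_def inj_on_eq_iff)

lemma graph_aut_rtrancl:
  assumes "graph_aut V R g" "R \<subseteq> V \<times> V" "(x, y) \<in> R\<^sup>*" "x \<in> V"
  shows "(g x, g y) \<in> R\<^sup>*"
  using assms(3)
proof (induction rule: rtrancl_induct)
  case (step y z)
  then have "(g y, g z) \<in> R" using assms(1,2) by (auto simp: graph_aut_def)
  then show ?case using step by (meson rtrancl_into_rtrancl)
qed simp

lemma color_aut_aut: "color_aut V R c g \<Longrightarrow> graph_aut V R g"
  and color_aut_color: "color_aut V R c g \<Longrightarrow> (x, y) \<in> R \<Longrightarrow> c (g x) (g y) = c x y"
  by (auto simp: color_aut_def)

lemma color_aut_misses:
  assumes g: "color_aut V R c g" and R: "R \<subseteq> V \<times> V" and x: "x \<in> V"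
  shows "misses R c (g x) i \<longleftrightarrow> misses R c x i"
proof -
  note aut = color_aut_aut[OF g]
  have "misses R c x i" if "misses R c (g x) i"
    unfolding misses_def
  proof (intro allI impI)
    fix y assume y: "(x, y) \<in> R"
    then have "(g x, g y) \<in> R" using graph_aut_edge[OF aut] R by auto
    then show "c x y \<noteq> i" using that color_aut_color[OF g y] by (auto simp: misses_def)
  qed
  moreover have "misses R c (g x) i" if "misses R c x i"
    unfolding misses_def
  proof (intro allI impI)
    fix z assume z: "(g x, z) \<in> R"
    then obtain y where y: "y \<in> V" "z = g y" using graph_aut_surj[OF aut] R by blast
    then have "(x, y) \<in> R" using graph_aut_edge[OF aut x y(1)] z by simp
    then show "c (g x) z \<noteq> i" using that color_aut_color[OF g] y by (auto simp: misses_def)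
  qed
  ultimately show ?thesis by blast
qed

lemma color_aut_fixpoint:
  assumes c: "edge_coloring k R c" and g: "color_aut V R c g" and R: "R \<subseteq> V \<times> V"
    and x: "x \<in> V" "g x = x" and xy: "(x, y) \<in> R\<^sup>*"
  shows "g y = y"
  using xy
proof (induction rule: rtrancl_induct)
  case (step y z)
  then have "(y, g z) \<in> R" using graph_aut_edge[OF color_aut_aut[OF g], of y z] R by auto
  moreover have "c y (g z) = c y z" using color_aut_color[OF g step(2)] step.IH by simp
  ultimately show ?case using edge_coloring_inj[OF c] step(2) by metis
qed (rule x)

section \<open>Simple and regular graphs\<close>

locale simple_graph =
  fixes V :: "'a set" and R :: "('a \<times> 'a) set"
  assumes finV: "finite V" and RV: "R \<subseteq> V \<times> V" and symR: "sym R" and irreflR: "irrefl R"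
begin

lemma finR: "finite R"
  using finV RV by (meson finite_SigmaI finite_subset)

lemma fin_nbrs: "finite (R `` {x})"
  using finR by (simp add: finite_Image)

lemma edge_sym: "(x, y) \<in> R \<Longrightarrow> (y, x) \<in> R"
  using symR by (auto dest: symD)

lemma edge_ne: "(x, y) \<in> R \<Longrightarrow> x \<noteq> y"
  using irreflR by (auto simp: irrefl_def)

lemma edge_in: "(x, y) \<in> R \<Longrightarrow> x \<in> V \<and> y \<in> V"
  using RV by auto

lemma reach_sym: "(x, y) \<in> R\<^sup>* \<Longrightarrow> (y, x) \<in> R\<^sup>*"
  using symR by (meson sym_rtrancl symD)

lemma nbrs_sub: "R `` {x} \<subseteq> V"
  using RV by auto

end

locale regular_graph = simple_graph +
  fixes d :: nat
  assumes reg: "x \<in> V \<Longrightarrow> card (R `` {x}) = d"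
begin

lemma deg_le: "card (R `` {x}) \<le> d"
proof (cases "x \<in> V")
  case False
  then have "R `` {x} = {}" using RV by auto
  then show ?thesis by simp
qed (simp add: reg)

text \<open>A covered vertex loses an edge when the matching is deleted, so only uncovered vertices
  can keep degree \<open>d\<close>, and \<open>edge_coloring_exists_star_core\<close> colours the
  rest with \<open>d\<close> colours. The matching receives the additional colour
  \<open>d\<close>.\<close>

lemma star_matching_coloring:
  assumes f: "matching R f"
    and star: "\<And>x y. (x, y) \<in> R \<Longrightarrow> f x = x \<Longrightarrow> f y = y \<Longrightarrow> x = a \<or> y = a"
  shows "\<exists>c. edge_coloring (Suc d) R c \<and> (\<forall>x y. (x, y) \<in> R \<longrightarrow> (c x y = d \<longleftrightarrow> y = f x))"
proof -
  let ?R = "R - {(x, f x) | x. True}"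
  note ff = matching_invol[OF f]
  have sub: "?R `` {x} \<subseteq> R `` {x}" for x by auto
  have nb: "card (?R `` {x}) < d" if "f x \<noteq> x" for x
  proof -
    have "?R `` {x} \<subset> R `` {x}" using matching_edge[OF f that] by auto
    then show ?thesis using psubset_card_mono[OF fin_nbrs] deg_le[of x] by (meson less_le_trans)
  qed
  have deg: "card (?R `` {x}) \<le> d" for x
    using card_mono[OF fin_nbrs sub[of x]] deg_le[of x] by simp
  have "sym ?R"
  proof (rule symI)
    fix x y assume "(x, y) \<in> ?R"
    then show "(y, x) \<in> ?R" using edge_sym ff by auto
  qed
  moreover have "irrefl ?R" using irreflR by (auto simp: irrefl_def)
  ultimately obtain c where c: "edge_coloring d ?R c"
    using edge_coloring_exists_star_core[of ?R d a] finR deg nb star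
    by (metis (no_types, lifting) DiffD1 finite_Diff less_irrefl)
  let ?c = "\<lambda>x y. if y = f x then d else c x y"
  have cd: "c x y < d \<and> c y x = c x y" if "(x, y) \<in> R" "y \<noteq> f x" for x y
    using that c by (auto simp: edge_coloring_def)
  have "edge_coloring (Suc d) R ?c"
    unfolding edge_coloring_def
  proof (intro conjI allI impI)
    fix x y assume xy: "(x, y) \<in> R"
    show "?c x y < Suc d" using cd[OF xy] by auto
    show "?c y x = ?c x y" using cd[OF xy] ff by metis
  next
    fix x y z assume "(x, y) \<in> R" "(x, z) \<in> R" "?c x y = ?c x z"
    then show "y = z" using cd[of x y] cd[of x z] edge_coloring_inj[OF c, of x y z]
      by (auto split: if_splits)
  qed
  moreover have "\<forall>x y. (x, y) \<in> R \<longrightarrow> (?c x y = d \<longleftrightarrow> y = f x)" using cd by force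
  ultimately show ?thesis by blast
qed

text \<open>The class of colour \<open>d\<close> and the set of vertices missing \<open>d\<close>
  are both preserved; for the involution \<open>f\<close> this means commutation.\<close>

lemma color_aut_matching:
  assumes g: "color_aut V R c g" and f: "matching R f"
    and cf: "\<And>x y. (x, y) \<in> R \<Longrightarrow> c x y = d \<longleftrightarrow> y = f x" and x: "x \<in> V"
  shows "f (g x) = g (f x)"
proof (cases "f x = x")
  case True
  then have "misses R c x d" using cf edge_ne by (auto simp: misses_def)
  then have "misses R c (g x) d" using color_aut_misses[OF g RV x] by simp
  then have "f (g x) = g x" using matching_edge[OF f, of "g x"] cf by (auto simp: misses_def)
  then show ?thesis using True by simp
next
  case False
  then have e: "(x, f x) \<in> R" using matching_edge[OF f] by simp
  then have "(g x, g (f x)) \<in> R"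
    using graph_aut_edge[OF color_aut_aut[OF g]] edge_in by blast
  moreover have "c (g x) (g (f x)) = d" using color_aut_color[OF g e] cf[OF e] by simp
  ultimately show ?thesis using cf by metis
qed

end

section \<open>Regular graphs without a perfect matching\<close>

text \<open>
  By \<open>color_aut_fixpoint\<close>, in a connected graph a colour-preserving automorphism other than the
  identity moves every vertex; the assumption \<open>moving\<close> is to be refuted for most graphs.
\<close>

locale no_perfect_matching = regular_graph +
  assumes nonempty: "V \<noteq> {}"
    and imperfect: "matching R f \<Longrightarrow> \<exists>x\<in>V. f x = x"
    and moving: "edge_coloring (Suc d) R c \<Longrightarrow> \<exists>g. color_aut V R c g \<and> (\<forall>x\<in>V. g x \<noteq> x)"
begin

definition uncovered :: "('a \<Rightarrow> 'a) \<Rightarrow> 'a set" where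
  "uncovered f = {x\<in>V. f x = x}"

definition maximum :: "('a \<Rightarrow> 'a) \<Rightarrow> bool" where
  "maximum f \<longleftrightarrow> matching R f \<and>
     (\<forall>f'. matching R f' \<longrightarrow> card (uncovered f) \<le> card (uncovered f'))"

lemma ex_maximum: "\<exists>f. maximum f"
proof -
  have "matching R id" by (simp add: matching_def)
  from ex_has_least_nat[of "matching R", OF this, of "\<lambda>f. card (uncovered f)"] show ?thesis
    by (auto simp: maximum_def)
qed

lemma maximum_not_smaller:
  assumes "maximum f" "matching R f'" shows "\<not> uncovered f' \<subset> uncovered f"
proof
  assume "uncovered f' \<subset> uncovered f"
  then have "card (uncovered f') < card (uncovered f)"
    using finV by (intro psubset_card_mono) (auto simp: uncovered_def)
  then show False using assms by (auto simp: maximum_def not_le)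
qed

lemma moving_matching:
  assumes f: "matching R f"
    and star: "\<And>x y. (x, y) \<in> R \<Longrightarrow> f x = x \<Longrightarrow> f y = y \<Longrightarrow> x = a \<or> y = a"
  shows "\<exists>g. graph_aut V R g \<and> (\<forall>x\<in>V. g x \<noteq> x) \<and> (\<forall>x\<in>V. f (g x) = g (f x))"
proof -
  obtain c where c: "edge_coloring (Suc d) R c"
    "\<And>x y. (x, y) \<in> R \<Longrightarrow> (c x y = d \<longleftrightarrow> y = f x)"
    using star_matching_coloring[OF f star] by blast
  obtain g where g: "color_aut V R c g" "\<forall>x\<in>V. g x \<noteq> x" using moving[OF c(1)] by blast
  show ?thesis
    using color_aut_aut[OF g(1)] g(2) color_aut_matching[OF g(1) f c(2)] by blast
qed

lemma uncovered_indep: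
  assumes f: "maximum f" and u: "f u = u" and w: "f w = w" and uw: "(u, w) \<in> R"
  shows False
proof -
  note m = conjunct1[OF f[unfolded maximum_def]]
  let ?f = "f(u := w, w := u)"
  have ne: "u \<noteq> w" using edge_ne uw by blast
  have off: "f x \<noteq> u" "f x \<noteq> w" if "x \<noteq> u" "x \<noteq> w" for x
    using that u w matching_invol[OF m] by metis+
  have "matching R ?f"
    unfolding matching_def
  proof (intro conjI allI impI)
    fix x
    show "?f (?f x) = x" using off[of x] ne matching_invol[OF m, of x] by auto
    show "(x, ?f x) \<in> R" if "?f x \<noteq> x"
      using that matching_edge[OF m, of x] uw edge_sym[OF uw] by (auto split: if_splits)
  qed
  moreover have "uncovered ?f = uncovered f - {u, w}" using ne by (auto simp: uncovered_def)
  moreover have "u \<in> uncovered f" using u edge_in uw by (auto simp: uncovered_def)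
  ultimately show False using maximum_not_smaller[OF f] by blast
qed

text \<open>Otherwise the path \<open>u\<close>, \<open>a\<close>, \<open>f a\<close>,
  \<open>w\<close> would be augmenting.\<close>

lemma no_augmenting:
  assumes f: "maximum f" and u: "f u = u" and w: "f w = w" and ne: "u \<noteq> w"
    and a: "f a \<noteq> a" and e: "(u, a) \<in> R" "(w, f a) \<in> R"
  shows False
proof -
  note m = conjunct1[OF f[unfolded maximum_def]]
  define b where "b = f a"
  have fb: "f b = a" using matching_invol[OF m] by (simp add: b_def)
  have dist: "a \<noteq> b" "a \<noteq> u" "a \<noteq> w" "b \<noteq> u" "b \<noteq> w"
    using a u w fb by (auto simp: b_def)
  let ?f = "f(u := a, a := u, b := w, w := b)"
  have off: "f x \<noteq> u \<and> f x \<noteq> w \<and> f x \<noteq> a \<and> f x \<noteq> b"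
    if "x \<noteq> u" "x \<noteq> w" "x \<noteq> a" "x \<noteq> b" for x
    using that u w fb b_def matching_invol[OF m] by metis
  have E: "(a, u) \<in> R" "(b, w) \<in> R" "(w, b) \<in> R" using e edge_sym by (auto simp: b_def)
  have "matching R ?f"
    unfolding matching_def
  proof (intro conjI allI impI)
    fix x
    show "?f (?f x) = x"
      using off[of x] dist ne matching_invol[OF m, of x] by auto
    show "(x, ?f x) \<in> R" if "?f x \<noteq> x"
      using that off[of x] dist ne matching_edge[OF m, of x] e E by (auto split: if_splits)
  qed
  moreover have "uncovered ?f = uncovered f - {u, w}"
    using ne dist a fb by (auto simp: uncovered_def)
  moreover have "u \<in> uncovered f" using u edge_in e by (auto simp: uncovered_def)
  ultimately show False using maximum_not_smaller[OF f] by blast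
qed

text \<open>Otherwise removing the edge between \<open>a\<close> and \<open>f a\<close> would leave a star with at least two leaves.\<close>

lemma uncovered_adjacent_partner:
  assumes f: "maximum f" and u: "f u = u" and ua: "(u, a) \<in> R"
  shows "f a \<noteq> a \<and> (u, f a) \<in> R"
proof -
  note m = conjunct1[OF f[unfolded maximum_def]]
  have fa: "f a \<noteq> a" using uncovered_indep[OF f u _ ua] by blast
  define b where "b = f a"
  have fb: "f b = a" using matching_invol[OF m] by (simp add: b_def)
  have ab: "a \<noteq> b" using fa b_def by simp
  have "(u, b) \<in> R"
  proof (rule ccontr)
    assume nub: "(u, b) \<notin> R"
    \<comment> \<open>Both ends become uncovered. By \<open>no_augmenting\<close> no vertex left
      uncovered by \<open>f\<close> is adjacent to \<open>b\<close>, so the uncovered vertices span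
      a star with centre \<open>a\<close> that has \<open>b\<close> and \<open>u\<close> among its
      leaves.\<close>
    let ?f = "f(a := a, b := b)"
    have off: "f x \<noteq> a \<and> f x \<noteq> b" if "x \<noteq> a" "x \<noteq> b" for x
      using that fb b_def matching_invol[OF m] by metis
    have m': "matching R ?f"
      unfolding matching_def
    proof (intro conjI allI impI)
      fix x
      show "?f (?f x) = x" using off[of x] ab matching_invol[OF m, of x] by auto
      show "(x, ?f x) \<in> R" if "?f x \<noteq> x"
        using that matching_edge[OF m, of x] by (auto split: if_splits)
    qed
    have key: "(b, y) \<notin> R" if "f y = y" for y
      using no_augmenting[OF f u that _ fa ua] nub edge_sym b_def by metis
    have star: "x = a \<or> y = a" if "(x, y) \<in> R" "?f x = x" "?f y = y" for x y
    proof (rule ccontr)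
      assume na: "\<not> (x = a \<or> y = a)"
      then have "f x = x \<or> x = b" "f y = y \<or> y = b"
        using that(2,3) by (metis fun_upd_other)+
      moreover have "\<not> (f x = x \<and> f y = y)" using uncovered_indep[OF f _ _ that(1)] by blast
      moreover have "\<not> (x = b \<and> y = b)" using edge_ne[OF that(1)] by blast
      ultimately consider "x = b" "f y = y" | "y = b" "f x = x" by argo
      then show False
        by cases (use key[of x] key[of y] that(1) edge_sym[OF that(1)] in simp_all)
    qed
    obtain g where g: "graph_aut V R g" "\<And>x. x \<in> V \<Longrightarrow> g x \<noteq> x"
      and gf: "\<And>x. x \<in> V \<Longrightarrow> ?f (g x) = g (?f x)"
      using moving_matching[OF m' star] by blast
    have V: "u \<in> V" "a \<in> V" "b \<in> V"
      using edge_in[OF ua] edge_in[OF matching_edge[OF m fa]] by (auto simp: b_def)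
    have abR: "(a, b) \<in> R" using matching_edge[OF m fa] by (simp add: b_def)
    have ne: "u \<noteq> b" "u \<noteq> a" using u fa fb ab by auto
    have fixed: "?f (g x) = g x" if "x \<in> {u, a, b}" for x
    proof -
      have "x \<in> V" "?f x = x" using that V u ab by auto
      then show ?thesis using gf by metis
    qed
    \<comment> \<open>Two edges of the star map to edges of the star. As \<open>g\<close> moves the
      centre, the leaves \<open>b\<close> and \<open>u\<close> would both have to go to
      \<open>a\<close>.\<close>
    have "(g a, g b) \<in> R" "(g a, g u) \<in> R"
      using graph_aut_edge[OF g(1)] V abR edge_sym[OF ua] by auto
    then have "g b = a" "g u = a"
      using star[of "g a" "g b"] star[of "g a" "g u"] fixed g(2)[OF V(2)] by blast+
    then show False using graph_aut_inj[OF g(1), of b u] V ne by simp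
  qed
  then show ?thesis using fa by (simp add: b_def)
qed

text \<open>Exchange along the path \<open>u\<close>, \<open>f a\<close>, \<open>a\<close>: the
  uncovered vertex moves from \<open>u\<close> to \<open>a\<close>.\<close>

lemma switch_maximum:
  assumes f: "maximum f" and u: "f u = u" and a: "f a \<noteq> a" and ub: "(u, f a) \<in> R"
  obtains f' where "maximum f'" "f' a = a" "\<And>x. f x = x \<Longrightarrow> x \<noteq> u \<Longrightarrow> f' x = x"
proof -
  note m = conjunct1[OF f[unfolded maximum_def]]
  define b where "b = f a"
  have fb: "f b = a" using matching_invol[OF m] by (simp add: b_def)
  have ab: "a \<noteq> b" "u \<noteq> a" "u \<noteq> b" using a u fb by (auto simp: b_def)
  let ?f = "f(a := a, u := b, b := u)"
  have off: "f x \<noteq> a \<and> f x \<noteq> b \<and> f x \<noteq> u" if "x \<noteq> a" "x \<noteq> b" "x \<noteq> u" for x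
    using that fb b_def u matching_invol[OF m] by metis
  have E: "(u, b) \<in> R" "(b, u) \<in> R" using ub edge_sym by (auto simp: b_def)
  have m': "matching R ?f"
    unfolding matching_def
  proof (intro conjI allI impI)
    fix x
    show "?f (?f x) = x" using off[of x] ab matching_invol[OF m, of x] by auto
    show "(x, ?f x) \<in> R" if "?f x \<noteq> x"
      using that matching_edge[OF m, of x] E by (auto split: if_splits)
  qed
  have V: "u \<in> V" "a \<in> V" using edge_in[OF ub] edge_in[OF matching_edge[OF m a]] by auto
  have "uncovered ?f = insert a (uncovered f - {u})"
    using ab V a fb by (auto simp: uncovered_def b_def)
  moreover have "u \<in> uncovered f" "a \<notin> uncovered f" using u a V by (auto simp: uncovered_def)
  moreover have "finite (uncovered f)" using finV by (simp add: uncovered_def)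
  ultimately have "card (uncovered ?f) = card (uncovered f)"
    by (metis Diff_iff card_Suc_Diff1 card_insert_disjoint finite_Diff)
  then have "maximum ?f" using m' f by (auto simp: maximum_def)
  moreover have "?f a = a" using ab by simp
  moreover have "?f x = x" if "f x = x" "x \<noteq> u" for x
    using that fb ab by auto
  ultimately show thesis by (rule that)
qed

text \<open>As in Gallai's lemma, the uncovered vertex \<open>u\<close> is moved along a path
  towards \<open>w\<close>. The triangles of \<open>uncovered_adjacent_partner\<close> allow each
  single step while \<open>w\<close> stays uncovered; the step onto \<open>w\<close> is impossible,
  as the vertex stepped on was covered.\<close>

lemma uncovered_unreachable:
  assumes "(u, w) \<in> R\<^sup>*" "maximum f" "f u = u" "f w = w" shows "u = w"
  using assms
proof (induction arbitrary: f rule: converse_rtrancl_induct)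
  case (step u a)
  show ?case
  proof (rule ccontr)
    assume ne: "u \<noteq> w"
    have fa: "f a \<noteq> a" "(u, f a) \<in> R"
      using uncovered_adjacent_partner[OF step.prems(1,2) step.hyps(1)] by auto
    obtain f' where "maximum f'" "f' a = a" "f' w = w"
      using switch_maximum[OF step.prems(1,2) fa] step.prems(3) ne by metis
    then have "a = w" using step.IH by blast
    then show False using fa step.prems(3) by simp
  qed
qed simp

text \<open>Otherwise neither \<open>x\<close> nor its partner is adjacent to \<open>u\<close>, and
  uncovering these two adds a single edge between uncovered vertices. An automorphism preserving
  that edge maps the component of \<open>u\<close> to itself, and so fixes \<open>u\<close>, the
  only vertex of the component that \<open>f\<close> leaves uncovered.\<close>

lemma reachable_adjacent:
  assumes f: "maximum f" and u: "f u = u" "u \<in> V" and ux: "(u, x) \<in> R\<^sup>*" "x \<noteq> u"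
  shows "(u, x) \<in> R"
proof (rule ccontr)
  assume nux: "(u, x) \<notin> R"
  note m = conjunct1[OF f[unfolded maximum_def]]
  have fx: "f x \<noteq> x" using uncovered_unreachable[OF ux(1) f u(1)] ux(2) by blast
  define y where "y = f x"
  have fy: "f y = x" using matching_invol[OF m] by (simp add: y_def)
  have xy: "x \<noteq> y" "(x, y) \<in> R" using fx matching_edge[OF m fx] by (auto simp: y_def)
  have nuy: "(u, y) \<notin> R" using uncovered_adjacent_partner[OF f u(1), of y] fy nux by auto
  have uy: "(u, y) \<in> R\<^sup>*" using ux(1) xy(2) by (rule rtrancl_into_rtrancl)
  have ne: "u \<noteq> x" "u \<noteq> y" using u fx fy xy by auto
  let ?f = "f(x := x, y := y)"
  have off: "f z \<noteq> x \<and> f z \<noteq> y" if "z \<noteq> x" "z \<noteq> y" for z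
    using that fy y_def matching_invol[OF m] by metis
  have m': "matching R ?f"
    unfolding matching_def
  proof (intro conjI allI impI)
    fix z
    show "?f (?f z) = z" using off[of z] xy matching_invol[OF m, of z] by auto
    show "(z, ?f z) \<in> R" if "?f z \<noteq> z"
      using that matching_edge[OF m, of z] by (auto split: if_splits)
  qed
  have none: "(s, t) \<notin> R" if "f s = s" "t \<in> {x, y}" for s t
  proof
    assume st: "(s, t) \<in> R"
    then have "(u, s) \<in> R\<^sup>*"
      using that(2) ux(1) uy edge_sym by (auto intro: rtrancl_into_rtrancl)
    then have "s = u" using uncovered_unreachable[OF _ f u(1) that(1)] by simp
    then show False using st that(2) nux nuy by auto
  qed
  have single: "{s, t} = {x, y}" if "(s, t) \<in> R" "?f s = s" "?f t = t" for s t
  proof -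
    have "f s = s \<or> s \<in> {x, y}" "f t = t \<or> t \<in> {x, y}"
      using that(2,3) by (metis fun_upd_other insertI1 insertI2)+
    moreover have "\<not> (f s = s \<and> f t = t)" using uncovered_indep[OF f _ _ that(1)] by blast
    moreover have "\<not> (f s = s \<and> t \<in> {x, y})" using none[of s t] that(1) by argo
    moreover have "\<not> (f t = t \<and> s \<in> {x, y})" using none[of t s] edge_sym[OF that(1)] by argo
    ultimately have "s \<in> {x, y}" "t \<in> {x, y}" by argo+
    then show ?thesis using edge_ne[OF that(1)] by auto
  qed
  have star: "s = x \<or> t = x" if "(s, t) \<in> R" "?f s = s" "?f t = t" for s t
    using single[OF that] by blast
  obtain g where g: "graph_aut V R g" "\<And>x. x \<in> V \<Longrightarrow> g x \<noteq> x"
    and gf: "\<And>x. x \<in> V \<Longrightarrow> ?f (g x) = g (?f x)"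
    using moving_matching[OF m' star] by blast
  have V: "x \<in> V" "y \<in> V" using edge_in[OF xy(2)] by auto
  have fixed: "?f (g z) = g z" if "z \<in> {u, x, y}" for z
  proof -
    have "z \<in> V" "?f z = z" using that V u xy by auto
    then show ?thesis using gf by metis
  qed
  have "(g x, g y) \<in> R" using graph_aut_edge[OF g(1) V] xy by simp
  then have gxy: "{g x, g y} = {x, y}" using single fixed by blast
  have "g u \<noteq> g x" "g u \<noteq> g y" using graph_aut_inj[OF g(1)] u V ne by simp_all
  then have "g u \<notin> {x, y}" using gxy by blast
  then have fgu: "f (g u) = g u" using fixed[of u] by auto
  have "(g u, g x) \<in> R\<^sup>*" using graph_aut_rtrancl[OF g(1) RV ux(1) u(2)] .
  moreover have "(u, g x) \<in> R\<^sup>*" using gxy ux(1) uy by (auto simp: doubleton_eq_iff)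
  ultimately have "(u, g u) \<in> R\<^sup>*" using reach_sym by (meson rtrancl_trans)
  then have "u = g u" using uncovered_unreachable[OF _ f u(1) fgu] by simp
  then show False using g(2)[OF u(2)] by simp
qed

text \<open>The vertices left uncovered by a maximum matching are independent, so it can be a colour
  class, and \<open>u\<close> is moved to an uncovered vertex of another component. By
  \<open>reachable_adjacent\<close> the component of \<open>u\<close> is its closed neighbourhood;
  regularity makes it complete, and the matching pairs off the neighbours of
  \<open>u\<close>.\<close>

lemma ex_odd_clique_component:
  "\<exists>u\<in>V. (\<forall>y z. (u, y) \<in> R \<longrightarrow> (u, z) \<in> R \<longrightarrow> y \<noteq> z \<longrightarrow> (y, z) \<in> R) \<and>
     even d \<and> (\<exists>w\<in>V. (u, w) \<notin> R\<^sup>*)"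
proof -
  obtain f where f: "maximum f" using ex_maximum by blast
  note m = conjunct1[OF f[unfolded maximum_def]]
  obtain u where u: "u \<in> V" "f u = u" using imperfect[OF m] by blast
  obtain g where g: "graph_aut V R g" "\<And>x. x \<in> V \<Longrightarrow> g x \<noteq> x"
    and gf: "\<And>x. x \<in> V \<Longrightarrow> f (g x) = g (f x)"
    using moving_matching[OF m, of u] uncovered_indep[OF f] by blast
  have "f (g u) = g u" using gf[OF u(1)] u(2) by simp
  then have far: "(u, g u) \<notin> R\<^sup>*" using uncovered_unreachable[OF _ f u(2)] g(2)[OF u(1)] by metis
  have clique: "(y, z) \<in> R" if y: "(u, y) \<in> R" and z: "(u, z) \<in> R" and ne: "y \<noteq> z" for y z
  proof -
    have sub: "R `` {y} \<subseteq> insert u (R `` {u}) - {y}"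
    proof
      fix t assume t: "t \<in> R `` {y}"
      then have "(u, t) \<in> R\<^sup>*" using y by (simp add: rtrancl.rtrancl_into_rtrancl)
      then have "t = u \<or> (u, t) \<in> R" using reachable_adjacent[OF f u(2,1)] by blast
      then show "t \<in> insert u (R `` {u}) - {y}" using t edge_ne by auto
    qed
    have "card (insert u (R `` {u}) - {y}) = d"
    proof -
      have "u \<notin> R `` {u}" using edge_ne by blast
      then have "card (insert u (R `` {u})) = Suc d" using reg[OF u(1)] fin_nbrs by simp
      then show ?thesis using y fin_nbrs[of u] by (subst card_Diff_singleton) auto
    qed
    then have "R `` {y} = insert u (R `` {u}) - {y}"
      using card_subset_eq[OF _ sub] reg[of y] edge_in[OF y] fin_nbrs[of u] by simp
    then show ?thesis using z ne by auto
  qed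
  have "even (card (R `` {u}))"
    by (rule even_card_involution[of _ f])
      (use fin_nbrs uncovered_adjacent_partner[OF f u(2)] matching_invol[OF m] in auto)
  then have "even d" using reg[OF u(1)] by simp
  then show ?thesis using u(1) clique far graph_aut_mem[OF g(1) u(1)] by blast
qed

end

section \<open>Missing colours and complete components\<close>

context simple_graph
begin

lemma ex_edge_coloring:
  assumes "\<And>x. x \<in> V \<Longrightarrow> card (R `` {x}) < k" and "k > 0"
  shows "\<exists>c. edge_coloring k R c"
proof -
  have "card (R `` {x}) < k" for x
  proof (cases "x \<in> V")
    case False
    then have "R `` {x} = {}" using RV by auto
    then show ?thesis using assms(2) by simp
  qed (rule assms)
  then show ?thesis
    using edge_coloring_exists_star_core[of R k] finR symR irreflR by (metis less_irrefl less_imp_le)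
qed

end

context regular_graph
begin

lemma all_colors:
  assumes c: "edge_coloring d R c" and x: "x \<in> V" and i: "i < d"
  shows "\<exists>y. (x, y) \<in> R \<and> c x y = i"
proof -
  have "inj_on (c x) (R `` {x})"
    using edge_coloring_inj[OF c] by (auto intro!: inj_onI)
  then have "card (c x ` (R `` {x})) = card {..<d}" using reg[OF x] by (simp add: card_image)
  moreover have "c x ` (R `` {x}) \<subseteq> {..<d}" using edge_coloring_less[OF c] by auto
  ultimately have "c x ` (R `` {x}) = {..<d}" by (metis card_subset_eq finite_lessThan)
  then have "i \<in> c x ` (R `` {x})" using i by auto
  then show ?thesis by auto
qed

lemma ex1_missing:
  assumes c: "edge_coloring (Suc d) R c" and x: "x \<in> V"
  shows "\<exists>!i. i < Suc d \<and> misses R c x i"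
proof -
  have "inj_on (c x) (R `` {x})"
    using edge_coloring_inj[OF c] by (auto intro!: inj_onI)
  then have "card (c x ` (R `` {x})) = d" using reg[OF x] by (simp add: card_image)
  moreover have "c x ` (R `` {x}) \<subseteq> {..<Suc d}" using edge_coloring_less[OF c] by blast
  ultimately have "card ({..<Suc d} - c x ` (R `` {x})) = 1"
    by (simp add: card_Diff_subset finite_subset[OF _ finite_lessThan])
  then obtain i where i: "{..<Suc d} - c x ` (R `` {x}) = {i}" by (auto simp: card_1_singleton_iff)
  have "l < Suc d \<and> misses R c x l \<longleftrightarrow> l \<in> {..<Suc d} - c x ` (R `` {x})" for l
    by (auto simp: misses_def)
  then have "l < Suc d \<and> misses R c x l \<longleftrightarrow> l = i" for l unfolding i by simp
  then show ?thesis by (intro ex1I[of _ i]) simp_all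
qed

definition missing :: "('a \<Rightarrow> 'a \<Rightarrow> nat) \<Rightarrow> 'a \<Rightarrow> nat" where
  "missing c x = (THE i. i < Suc d \<and> misses R c x i)"

lemma missing:
  assumes "edge_coloring (Suc d) R c" "x \<in> V"
  shows "missing c x < Suc d" "misses R c x (missing c x)"
  using theI'[OF ex1_missing[OF assms]] by (simp_all add: missing_def)

lemma missing_eq:
  assumes "edge_coloring (Suc d) R c" "x \<in> V" "i < Suc d" "misses R c x i"
  shows "missing c x = i"
  using ex1_missing[OF assms(1,2)] missing[OF assms(1,2)] assms(3,4) by blast

lemma color_aut_missing:
  assumes c: "edge_coloring (Suc d) R c" and g: "color_aut V R c g" and x: "x \<in> V"
  shows "missing c (g x) = missing c x"
  by (rule missing_eq[OF c graph_aut_mem[OF color_aut_aut[OF g] x] missing(1)[OF c x]])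
    (use color_aut_misses[OF g RV x] missing[OF c x] in blast)

section \<open>Complete components of regular graphs\<close>

definition clique_vertex :: "'a \<Rightarrow> bool" where
  "clique_vertex x \<longleftrightarrow> (\<forall>y z. (x, y) \<in> R \<longrightarrow> (x, z) \<in> R \<longrightarrow> y \<noteq> z \<longrightarrow> (y, z) \<in> R)"

definition block :: "'a \<Rightarrow> 'a set" where
  "block x = insert x (R `` {x})"

lemma block_self: "x \<in> block x"
  by (simp add: block_def)

lemma block_edge: "x \<in> V \<Longrightarrow> y \<in> block x \<Longrightarrow> y \<noteq> x \<Longrightarrow> (x, y) \<in> R"
  by (auto simp: block_def)

lemma block_sub: "x \<in> V \<Longrightarrow> block x \<subseteq> V"
  using RV by (auto simp: block_def)

lemma card_block: "x \<in> V \<Longrightarrow> card (block x) = Suc d"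
  using irreflR fin_nbrs[of x] reg[of x] by (simp add: block_def card_insert_if irrefl_def)

lemma finite_block: "finite (block x)"
  by (simp add: block_def fin_nbrs)

text \<open>Each vertex of the block sees all of it, and regularity leaves no room for further
  neighbours: the block is a complete component.\<close>

lemma block_eq:
  assumes x: "x \<in> V" "clique_vertex x" and y: "y \<in> block x"
  shows "block y = block x"
proof -
  have yV: "y \<in> V" using block_sub[OF x(1)] y by blast
  have "block x \<subseteq> block y"
  proof
    fix z assume z: "z \<in> block x"
    show "z \<in> block y"
    proof (cases "z = y \<or> y = x")
      case True
      then show ?thesis using z block_self by auto
    next
      case False
      then have xy: "(x, y) \<in> R" using y block_edge x(1) by blast
      have "(y, z) \<in> R"
      proof (cases "z = x")
        case True
        then show ?thesis using edge_sym[OF xy] by simp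
      next
        case zx: False
        then have "(x, z) \<in> R" using z block_edge x(1) by blast
        then show ?thesis using x(2) xy False unfolding clique_vertex_def by blast
      qed
      then show ?thesis by (simp add: block_def)
    qed
  qed
  then show ?thesis
    using card_subset_eq[OF finite_block] card_block[OF x(1)] card_block[OF yV] by metis
qed

lemma clique_vertex_block:
  assumes x: "x \<in> V" "clique_vertex x" and y: "y \<in> block x"
  shows "clique_vertex y"
  unfolding clique_vertex_def
proof (intro allI impI)
  fix s t assume st: "(y, s) \<in> R" "(y, t) \<in> R" "s \<noteq> t"
  then have "s \<in> block x" "t \<in> block x" using block_eq[OF x y] by (auto simp: block_def)
  then show "(s, t) \<in> R"
    using st(3) x edge_sym unfolding clique_vertex_def block_def by blast
qed

lemma clique_vertex_aut:
  assumes g: "graph_aut V R g" and x: "x \<in> V" "clique_vertex x"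
  shows "clique_vertex (g x)"
  unfolding clique_vertex_def
proof (intro allI impI)
  fix s t assume st: "(g x, s) \<in> R" "(g x, t) \<in> R" "s \<noteq> t"
  then obtain s' t' where "s' \<in> V" "s = g s'" "t' \<in> V" "t = g t'"
    using graph_aut_surj[OF g] edge_in by metis
  then show "(s, t) \<in> R"
    using st x graph_aut_edge[OF g] unfolding clique_vertex_def by metis
qed

lemma block_aut:
  assumes g: "graph_aut V R g" and x: "x \<in> V" and y: "y \<in> block x"
  shows "g y \<in> block (g x)"
  using y graph_aut_edge[OF g x] edge_in by (auto simp: block_def)

text \<open>A colour missing nowhere would induce a perfect matching of a component of odd order.\<close>

lemma ex_missing_in_block:
  assumes c: "edge_coloring (Suc d) R c" and x: "x \<in> V" "clique_vertex x"
    and d: "even d" and i: "i < Suc d"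
  shows "\<exists>y\<in>block x. missing c y = i"
proof (rule ccontr)
  assume none: "\<not> ?thesis"
  have "\<exists>z. (y, z) \<in> R \<and> c y z = i" if "y \<in> block x" for y
    using missing_eq[OF c _ i, of y] none that block_sub[OF x(1)] by (auto simp: misses_def)
  then obtain f where f: "\<And>y. y \<in> block x \<Longrightarrow> (y, f y) \<in> R \<and> c y (f y) = i" by metis
  have "f y \<in> block x \<and> f y \<noteq> y \<and> f (f y) = y" if y: "y \<in> block x" for y
  proof -
    have fy: "f y \<in> block x" using f[OF y] block_eq[OF x y] by (auto simp: block_def)
    have "c (f y) y = i" using f[OF y] edge_coloring_sym[OF c] by metis
    then have "f (f y) = y"
      using edge_coloring_inj[OF c, of "f y" "f (f y)" y] f[OF fy] f[OF y] edge_sym by simp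
    then show ?thesis using fy f[OF y] edge_ne by metis
  qed
  then have "even (card (block x))" using even_card_involution[OF finite_block] by blast
  then show False using card_block[OF x(1)] d by simp
qed

text \<open>The block has \<open>d + 1\<close> vertices and each of the \<open>d + 1\<close> colours
  is missing somewhere in it, hence exactly once.\<close>

lemma missing_inj_on_block:
  assumes c: "edge_coloring (Suc d) R c" and x: "x \<in> V" "clique_vertex x" and d: "even d"
  shows "inj_on (missing c) (block x)"
proof -
  have "missing c ` block x = {..<Suc d}"
  proof
    show "missing c ` block x \<subseteq> {..<Suc d}"
      using missing(1)[OF c] block_sub[OF x(1)] by (intro image_subsetI) auto
    show "{..<Suc d} \<subseteq> missing c ` block x"
      using ex_missing_in_block[OF c x d] by (metis image_eqI lessThan_iff subsetI)
  qed
  then have "card (missing c ` block x) = card (block x)" using card_block[OF x(1)] by simp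
  then show ?thesis by (rule eq_card_imp_inj_on[OF finite_block])
qed

text \<open>Exchanging two colours on a whole component is a legal swap. It prescribes the missing
  colour at one vertex without affecting the other blocks.\<close>

lemma swap_block:
  assumes c: "edge_coloring (Suc d) R c" and x: "x \<in> V" "clique_vertex x"
    and i: "i < Suc d"
  shows "\<exists>c'. edge_coloring (Suc d) R c' \<and> missing c' x = i \<and>
           (\<forall>y\<in>V - block x. missing c' y = missing c y)"
proof -
  let ?k = "missing c x"
  let ?c = "kempe_swap c (block x) ?k i"
  have k: "?k < Suc d" "misses R c x ?k" using missing[OF c x(1)] by auto
  have "chain_closed R c ?k i (block x)"
    unfolding chain_closed_def
  proof (intro ballI allI impI)
    fix y z assume "y \<in> block x" "(y, z) \<in> R"
    then show "z \<in> block x" using block_eq[OF x, of y] by (auto simp: block_def[of y])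
  qed
  then have c': "edge_coloring (Suc d) R ?c"
    using edge_coloring_kempe_swap[OF c k(1) i symR] by blast
  moreover have "missing ?c x = i"
    by (rule missing_eq[OF c' x(1) i])
      (use k(2) block_self[of x] in \<open>auto simp: misses_def kempe_swap_def transpose_def\<close>)
  moreover have "missing ?c y = missing c y" if "y \<in> V - block x" for y
    by (rule missing_eq[OF c'])
      (use missing[OF c, of y] that in \<open>auto simp: misses_def kempe_swap_def\<close>)
  ultimately show ?thesis by blast
qed

end

section \<open>Colourings assembled from two layers\<close>

definition stack ::
    "nat \<Rightarrow> ('a \<times> 'a) set \<Rightarrow> ('a \<Rightarrow> 'a \<Rightarrow> nat) \<Rightarrow> ('a \<Rightarrow> 'a \<Rightarrow> nat) \<Rightarrow> 'a \<Rightarrow> 'a \<Rightarrow> nat" where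
  "stack j Q c0 c = (\<lambda>x y. if (x, y) \<in> Q then c0 x y else j + c x y)"

lemma edge_coloring_stack:
  assumes c0: "edge_coloring j Q c0" and c: "edge_coloring k (R - Q) c" and Q: "sym Q"
  shows "edge_coloring (j + k) R (stack j Q c0 c)"
  unfolding edge_coloring_def
proof (intro conjI allI impI)
  fix x y assume xy: "(x, y) \<in> R"
  have yx: "(y, x) \<in> Q \<longleftrightarrow> (x, y) \<in> Q" using Q by (auto dest: symD)
  show "stack j Q c0 c x y < j + k"
    using edge_coloring_less[OF c0, of x y] edge_coloring_less[OF c, of x y] xy
    by (auto simp: stack_def)
  show "stack j Q c0 c y x = stack j Q c0 c x y"
    using edge_coloring_sym[OF c0, of x y] edge_coloring_sym[OF c, of x y] xy yx
    by (auto simp: stack_def)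
next
  fix x y z assume "(x, y) \<in> R" "(x, z) \<in> R" "stack j Q c0 c x y = stack j Q c0 c x z"
  then show "y = z"
    using edge_coloring_inj[OF c0, of x y z] edge_coloring_inj[OF c, of x y z]
      edge_coloring_less[OF c0, of x y] edge_coloring_less[OF c0, of x z]
    by (auto simp: stack_def split: if_splits)
qed

text \<open>The colours below \<open>j\<close> mark the edges of \<open>Q\<close>, so each layer is
  preserved separately.\<close>

lemma color_aut_stack:
  assumes g: "color_aut V R (stack j Q c0 c) g" and c0: "edge_coloring j Q c0"
    and Q: "Q \<subseteq> R" and R: "R \<subseteq> V \<times> V"
  shows "color_aut V Q c0 g" "color_aut V (R - Q) c g"
proof -
  note aut = color_aut_aut[OF g]
  have low: "stack j Q c0 c x y < j \<longleftrightarrow> (x, y) \<in> Q" for x y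
    using edge_coloring_less[OF c0] by (auto simp: stack_def)
  have gQ: "(g x, g y) \<in> Q \<longleftrightarrow> (x, y) \<in> Q" if "x \<in> V" "y \<in> V" for x y
    using graph_aut_edge[OF aut that] color_aut_color[OF g, of x y] low[of x y]
      low[of "g x" "g y"] Q by (metis subsetD)
  have col: "stack j Q c0 c (g x) (g y) = stack j Q c0 c x y" if "(x, y) \<in> R" for x y
    using color_aut_color[OF g that] .
  show "color_aut V Q c0 g"
    unfolding color_aut_def graph_aut_def
  proof (intro conjI ballI allI impI)
    show "bij_betw g V V" using aut by (simp add: graph_aut_def)
    fix x y assume "(x, y) \<in> Q"
    moreover from this have "(g x, g y) \<in> Q" "(x, y) \<in> R" using gQ Q R by auto
    ultimately show "c0 (g x) (g y) = c0 x y" using col[of x y] by (simp add: stack_def)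
  qed (rule gQ)
  show "color_aut V (R - Q) c g"
    unfolding color_aut_def graph_aut_def
  proof (intro conjI ballI allI impI)
    show "bij_betw g V V" using aut by (simp add: graph_aut_def)
    show "(g x, g y) \<in> R - Q \<longleftrightarrow> (x, y) \<in> R - Q" if "x \<in> V" "y \<in> V" for x y
      using gQ[OF that] graph_aut_edge[OF aut that] by blast
    fix x y assume "(x, y) \<in> R - Q"
    moreover from this have "(g x, g y) \<notin> Q" using gQ R by auto
    ultimately show "c (g x) (g y) = c x y" using col[of x y] by (simp add: stack_def)
  qed
qed

section \<open>Counterexamples have class one\<close>

text \<open>What a regular counterexample amounts to: vertex colours are forced, so every edge
  colouring has an automorphism other than the identity, and by \<open>color_aut_fixpoint\<close> it
  moves every vertex.\<close>

locale bad_graph = regular_graph +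
  assumes conn: "x \<in> V \<Longrightarrow> y \<in> V \<Longrightarrow> (x, y) \<in> R\<^sup>*"
    and nonempty: "V \<noteq> {}"
    and bad: "edge_coloring (Suc d) R c \<Longrightarrow> \<exists>g. color_aut V R c g \<and> (\<forall>x\<in>V. g x \<noteq> x)"

text \<open>Each of the \<open>j\<close> colours of \<open>Q\<close> occurs at every vertex, so
  \<open>Q\<close> is a union of \<open>j\<close> disjoint perfect matchings.\<close>

locale layered_graph = bad_graph +
  fixes Q :: "('a \<times> 'a) set" and c0 :: "'a \<Rightarrow> 'a \<Rightarrow> nat" and j :: nat
  assumes Q: "Q \<subseteq> R" "sym Q" and Qreg: "x \<in> V \<Longrightarrow> card (Q `` {x}) = j"
    and c0: "edge_coloring j Q c0" and j: "j < d"
begin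

sublocale Q: regular_graph V Q j
  using finV RV irreflR Q Qreg by unfold_locales (auto simp: irrefl_def)

sublocale H: regular_graph V "R - Q" "d - j"
proof unfold_locales
  fix x assume x: "x \<in> V"
  have "(R - Q) `` {x} = R `` {x} - Q `` {x}" by auto
  moreover have "Q `` {x} \<subseteq> R `` {x}" using Q by auto
  ultimately show "card ((R - Q) `` {x}) = d - j"
    using card_Diff_subset[OF Q.fin_nbrs] reg[OF x] Qreg[OF x] by metis
next
  show "sym (R - Q)" using symR Q(2) by (auto simp: sym_def)
qed (use finV RV irreflR in \<open>auto simp: irrefl_def\<close>)

lemma stack_coloring:
  "edge_coloring (Suc (d - j)) (R - Q) c \<Longrightarrow> edge_coloring (Suc d) R (stack j Q c0 c)"
  using edge_coloring_stack[OF c0 _ Q(2), of "Suc (d - j)" R c] j by simp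

text \<open>
  Recolouring the edge \<open>x x'\<close> leaves \<open>x\<close> and \<open>x'\<close> as the only vertices that miss its old colour.
\<close>

lemma swapping_aut:
  assumes c: "edge_coloring (Suc (d - j)) (R - Q) c" and xx: "(x, x') \<in> Q"
    and m: "H.missing c x = H.missing c x'"
  shows "\<exists>g. color_aut V R (stack j Q c0 c) g \<and> g x = x'"
proof -
  let ?s = "stack j Q c0 c"
  let ?i = "c0 x x'"
  let ?\<mu> = "H.missing c x"
  \<comment> \<open>The new colour is free at both ends, because \<open>?\<mu>\<close> is the colour
    that both miss in \<open>H\<close>.\<close>
  let ?c = "recolor ?s x x' (j + ?\<mu>)"
  let ?R = "R - {(x, x'), (x', x)}"
  note s = stack_coloring[OF c]
  have V: "x \<in> V" "x' \<in> V" using Q.edge_in[OF xx] by auto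
  have x'x: "(x', x) \<in> Q" using Q.edge_sym[OF xx] .
  have i: "?i < j" "c0 x' x = ?i"
    using edge_coloring_less[OF c0 xx] edge_coloring_sym[OF c0 xx] by auto
  have \<mu>: "?\<mu> < Suc (d - j)" "misses (R - Q) c x ?\<mu>" "misses (R - Q) c x' ?\<mu>"
    using H.missing[OF c] V m by metis+
  have miss: "misses R ?s y (j + ?\<mu>)" if "misses (R - Q) c y ?\<mu>" for y
    using that edge_coloring_less[OF c0, of y] by (fastforce simp: misses_def stack_def)
  have cc: "edge_coloring (Suc d) R ?c"
  proof (rule edge_coloring_add_edge)
    show "edge_coloring (Suc d) ?R ?s" using s by (rule edge_coloring_subset) blast
    show "j + ?\<mu> < Suc d" using \<mu>(1) j by simp
    show "misses ?R ?s x (j + ?\<mu>)" "misses ?R ?s x' (j + ?\<mu>)"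
      using miss \<mu>(2,3) by (auto simp: misses_def)
  qed
  obtain g where g: "color_aut V R ?c g" "\<forall>x\<in>V. g x \<noteq> x" using bad[OF cc] by blast
  note aut = color_aut_aut[OF g(1)]
  have pair: "misses R ?c y ?i \<longleftrightarrow> y \<in> {x, x'}" if y: "y \<in> V" for y
  proof
    assume my: "misses R ?c y ?i"
    obtain z where z: "(y, z) \<in> Q" "c0 y z = ?i" using Q.all_colors[OF c0 y i(1)] by blast
    then have "?c y z \<noteq> ?i" using my Q(1) by (auto simp: misses_def)
    then have "{y, z} = {x, x'}" using z by (auto simp: recolor_def stack_def split: if_splits)
    then show "y \<in> {x, x'}" by blast
  next
    assume y: "y \<in> {x, x'}"
    show "misses R ?c y ?i"
      unfolding misses_def
    proof (intro allI impI)
      fix z assume yz: "(y, z) \<in> R"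
      show "?c y z \<noteq> ?i"
      proof (cases "{y, z} = {x, x'}")
        case True
        then show ?thesis using i by (simp add: recolor_def)
      next
        case False
        have "(x, z) \<in> Q \<Longrightarrow> z \<noteq> x' \<Longrightarrow> c0 x z \<noteq> ?i" for z
          using edge_coloring_inj[OF c0 xx, of z] by metis
        moreover have "(x', z) \<in> Q \<Longrightarrow> z \<noteq> x \<Longrightarrow> c0 x' z \<noteq> ?i" for z
          using edge_coloring_inj[OF c0 x'x, of z] i(2) by metis
        ultimately have "(y, z) \<in> Q \<Longrightarrow> c0 y z \<noteq> ?i"
          using y False by (metis insertE insert_commute singletonD)
        then show ?thesis using False i by (auto simp: recolor_def stack_def)
      qed
    qed
  qed
  have "g y \<in> {x, x'}" if "y \<in> {x, x'}" for y
    using pair[of y] pair[OF graph_aut_mem[OF aut, of y]] color_aut_misses[OF g(1) RV, of y] that V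
    by blast
  then have gx: "g x = x'" "g x' = x" using g(2) V by blast+
  \<comment> \<open>As \<open>g\<close> exchanges \<open>x\<close> and \<open>x'\<close>, it maps
    the recoloured edge to itself, so it preserves the original colouring too.\<close>
  have "?s (g y) (g z) = ?s y z" if yz: "(y, z) \<in> R" for y z
  proof (cases "{y, z} = {x, x'}")
    case True
    then have "y = x \<and> z = x' \<or> y = x' \<and> z = x" by (auto simp: doubleton_eq_iff)
    then show ?thesis using gx xx x'x i by (auto simp: stack_def)
  next
    case False
    have "{g y, g z} \<noteq> {x, x'}"
    proof
      assume "{g y, g z} = {x, x'}"
      then have "g y = g x' \<and> g z = g x \<or> g y = g x \<and> g z = g x'"
        using gx by (auto simp: doubleton_eq_iff)
      then show False using graph_aut_inj[OF aut] edge_in[OF yz] V False by auto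
    qed
    then show ?thesis using color_aut_color[OF g(1) yz] False by (simp add: recolor_def)
  qed
  then have "color_aut V R ?s g" using aut by (simp add: color_aut_def)
  then show ?thesis using gx by blast
qed

lemma ex_H_coloring: "\<exists>c. edge_coloring (Suc (d - j)) (R - Q) c"
  by (rule H.ex_edge_coloring) (simp_all add: H.reg)

text \<open>The block of \<open>x\<close> does not contain \<open>x'\<close>, so
  \<open>swap_block\<close> can make both vertices miss the same colour. Then
  \<open>swapping_aut\<close> yields an automorphism of \<open>H\<close> that carries
  \<open>x\<close> to \<open>x'\<close>.\<close>

lemma clique_vertex_Q:
  assumes x: "H.clique_vertex x" and xx: "(x, x') \<in> Q"
  shows "H.clique_vertex x'"
proof -
  have V: "x \<in> V" "x' \<in> V" using Q.edge_in[OF xx] by auto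
  obtain c where c: "edge_coloring (Suc (d - j)) (R - Q) c" using ex_H_coloring by blast
  have nb: "x' \<in> V - H.block x"
    using V xx Q.edge_ne[OF xx] by (auto simp: H.block_def)
  obtain c' where c': "edge_coloring (Suc (d - j)) (R - Q) c'"
    "H.missing c' x = H.missing c x'" "H.missing c' x' = H.missing c x'"
    using H.swap_block[OF c V(1) x H.missing(1)[OF c V(2)]] nb by blast
  obtain g where g: "color_aut V R (stack j Q c0 c') g" "g x = x'"
    using swapping_aut[OF c'(1) xx] c'(2,3) by auto
  show ?thesis
    using H.clique_vertex_aut[OF color_aut_aut[OF color_aut_stack(2)[OF g(1) c0 Q(1) RV]] V(1) x] g(2)
    by simp
qed

lemma all_clique_vertices:
  assumes u: "u \<in> V" "H.clique_vertex u" and x: "x \<in> V"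
  shows "H.clique_vertex x"
  using conn[OF u(1) x]
proof (induction rule: rtrancl_induct)
  case (step y z)
  show ?case
  proof (cases "(y, z) \<in> Q")
    case True
    then show ?thesis using clique_vertex_Q step.IH by blast
  next
    case False
    then have "z \<in> H.block y" using step(2) by (simp add: H.block_def)
    then show ?thesis using H.clique_vertex_block step edge_in by blast
  qed
qed (rule u)

text \<open>
  If an edge \<open>x F(x)\<close> is inverted by an automorphism \<open>g\<close>, then \<open>g\<close> is determined on the blocks of \<open>x\<close>
  and \<open>F x\<close> by the missing colours.  An edge \<open>p F(p)\<close> leading to a third block then allows
  to choose the missing colours at \<open>F p\<close> and at its forced image differently.
\<close>

lemma partner_block:
  assumes cl: "\<And>x. x \<in> V \<Longrightarrow> H.clique_vertex x" and ev: "even (d - j)" and i: "i < j"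
    and F: "\<And>x. x \<in> V \<Longrightarrow> (x, F x) \<in> Q \<and> c0 x (F x) = i"
    and x: "x \<in> V" and p: "p \<in> H.block x"
  shows "F p \<in> H.block (F x)"
proof (rule ccontr)
  assume np: "F p \<notin> H.block (F x)"
  let ?m = "d - j"
  let ?x' = "F x"
  let ?r = "F p"
  have pV: "p \<in> V" using H.block_sub[OF x] p by blast
  have V: "?x' \<in> V" "?r \<in> V" using F[OF x] F[OF pV] Q.edge_in by blast+
  have beq: "H.block z = H.block y" if "y \<in> V" "z \<in> H.block y" for y z
    by (rule H.block_eq[OF that(1) cl[OF that(1)] that(2)])
  have Qb: "F y \<notin> H.block y" if "y \<in> V" for y
    using F[OF that] Q.irreflR by (auto simp: H.block_def irrefl_def)
  have disj: "z \<notin> H.block y'" if "y \<in> V" "y' \<in> V" "y' \<notin> H.block y" "z \<in> H.block y" for y y' z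
    using beq[OF that(2)] beq[OF that(1,4)] H.block_self[of y'] that(3) by metis
  have bxr: "?r \<notin> H.block x" using Qb[OF pV] beq[OF x p] by simp
  obtain a where a: "edge_coloring (Suc ?m) (R - Q) a" using ex_H_coloring by blast
  obtain b where b: "edge_coloring (Suc ?m) (R - Q) b" and bx': "H.missing b ?x' = H.missing a x"
    and boff: "\<forall>y\<in>V - H.block ?x'. H.missing b y = H.missing a y"
    using H.swap_block[OF a V(1) cl[OF V(1)] H.missing(1)[OF a x]] by blast
  have "x \<notin> H.block ?x'" using disj[OF x V(1) Qb[OF x] H.block_self] .
  then have bxx: "H.missing b x = H.missing b ?x'" using boff bx' x by simp
  obtain p' where p': "p' \<in> H.block ?x'" "H.missing b p' = H.missing b p"
    using H.ex_missing_in_block[OF b V(1) cl[OF V(1)] ev H.missing(1)[OF b pV]] by blast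
  have p'V: "p' \<in> V" using H.block_sub[OF V(1)] p'(1) by blast
  let ?r' = "F p'"
  have r'V: "?r' \<in> V" using F[OF p'V] Q.edge_in by blast
  have "?r \<noteq> ?r'"
  proof
    assume eq: "?r = ?r'"
    have e: "(?r, p) \<in> Q" "(?r, p') \<in> Q" using F[OF pV] F[OF p'V] Q.edge_sym eq by metis+
    have "c0 ?r p = c0 ?r p'"
      using F[OF pV] F[OF p'V] edge_coloring_sym[OF c0] eq by metis
    then have "p = p'" using edge_coloring_inj[OF c0 e] by simp
    then show False using p'(1) disj[OF x V(1) Qb[OF x] p] by simp
  qed
  \<comment> \<open>The block of \<open>?r\<close> differs from those of \<open>x\<close> and
    \<open>?x'\<close>, so its missing colours can be changed without disturbing the choices made
    there.\<close>
  have "\<exists>c. edge_coloring (Suc ?m) (R - Q) c \<and> H.missing c ?r \<noteq> H.missing c ?r' \<and>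
      (\<forall>y \<in> H.block x \<union> H.block ?x'. H.missing c y = H.missing b y)"
  proof (cases "H.missing b ?r = H.missing b ?r'")
    case True
    have nr: "?r' \<notin> H.block ?r"
      using True H.missing_inj_on_block[OF b V(2) cl[OF V(2)] ev] \<open>?r \<noteq> ?r'\<close> H.block_self
      by (meson inj_onD)
    obtain i where i: "i < Suc ?m" "i \<noteq> H.missing b ?r"
    proof (cases "H.missing b ?r = 0")
      case True
      then show ?thesis using that[of 1] j by simp
    next
      case False
      then show ?thesis using that[of 0] by simp
    qed
    obtain c where c: "edge_coloring (Suc ?m) (R - Q) c" "H.missing c ?r = i"
      "\<forall>y\<in>V - H.block ?r. H.missing c y = H.missing b y"
      using H.swap_block[OF b V(2) cl[OF V(2)] i(1)] by blast
    have "H.missing c ?r \<noteq> H.missing c ?r'" using c i True nr r'V by auto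
    moreover have "H.missing c y = H.missing b y" if "y \<in> H.block x \<union> H.block ?x'" for y
      using c(3) that disj[OF x V(2) bxr, of y] disj[OF V(1) V(2) np, of y]
        H.block_sub[OF x] H.block_sub[OF V(1)] by blast
    ultimately show ?thesis using c(1) by blast
  qed (use b in blast)
  then obtain c where c: "edge_coloring (Suc ?m) (R - Q) c"
    and cr: "H.missing c ?r \<noteq> H.missing c ?r'"
    and cb: "\<And>y. y \<in> H.block x \<union> H.block ?x' \<Longrightarrow> H.missing c y = H.missing b y" by blast
  have "H.missing c x = H.missing c ?x'"
    using cb[of x] cb[of ?x'] bxx H.block_self by simp
  then obtain g where g: "color_aut V R (stack j Q c0 c) g" "g x = ?x'"
    using swapping_aut[OF c] F[OF x] by blast
  note gQ = color_aut_stack(1)[OF g(1) c0 Q(1) RV]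
    and gH = color_aut_stack(2)[OF g(1) c0 Q(1) RV]
  have gp: "g p \<in> H.block ?x'" using H.block_aut[OF color_aut_aut[OF gH] x p] g(2) by simp
  have "H.missing c (g p) = H.missing c p'"
    using H.color_aut_missing[OF c gH pV] cb[of p] cb[of p'] p p' by simp
  then have "g p = p'"
    using H.missing_inj_on_block[OF c V(1) cl[OF V(1)] ev] gp p'(1) by (meson inj_onD)
  moreover have "(g p, g ?r) \<in> Q" "c0 (g p) (g ?r) = i"
    using F[OF pV] graph_aut_edge[OF color_aut_aut[OF gQ] pV V(2)] color_aut_color[OF gQ] by auto
  ultimately have "g ?r = ?r'" using F[OF p'V] edge_coloring_inj[OF c0, of p' "g ?r" ?r'] by simp
  then show False using H.color_aut_missing[OF c gH V(2)] cr by simp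
qed

text \<open>The graph is a union of prisms over complete graphs and of perfect matchings.\<close>

lemma class_one_prisms:
  assumes cl: "\<And>x. x \<in> V \<Longrightarrow> H.clique_vertex x" and ev: "even (d - j)" and pos: "0 < j"
  shows "\<exists>c. edge_coloring d R c"
proof -
  let ?m = "d - j"
  let ?H = "R - Q"
  have "\<forall>x\<in>V. \<exists>y. (x, y) \<in> Q \<and> c0 x y = 0" using Q.all_colors[OF c0 _ pos] by blast
  then obtain F where F: "\<And>x. x \<in> V \<Longrightarrow> (x, F x) \<in> Q \<and> c0 x (F x) = 0" by metis
  have FV: "F x \<in> V" if "x \<in> V" for x using F[OF that] Q.edge_in by blast
  have Funiq: "y = F x" if "(x, y) \<in> Q" "c0 x y = 0" for x y
    using that F[of x] Q.edge_in[OF that(1)] edge_coloring_inj[OF c0, of x y "F x"] by simp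
  have FF: "F (F x) = x" if "x \<in> V" for x
    using Funiq[of "F x" x] F[OF that] Q.edge_sym edge_coloring_sym[OF c0] by metis
  have Finj: "F x = F y \<longleftrightarrow> x = y" if "x \<in> V" "y \<in> V" for x y
    using FF that by metis
  have FH: "(F x, F y) \<in> ?H" if xy: "(x, y) \<in> ?H" for x y
  proof -
    have V: "x \<in> V" "y \<in> V" "x \<noteq> y" using H.edge_in[OF xy] H.edge_ne[OF xy] by auto
    have "y \<in> H.block x" using xy by (simp add: H.block_def)
    then have "F y \<in> H.block (F x)" using partner_block[OF cl ev pos F V(1)] by blast
    then show ?thesis using H.block_edge[OF FV[OF V(1)]] Finj V by metis
  qed
  have nb: "H.block (F x) \<noteq> H.block x" if "x \<in> V" for x
  proof
    assume "H.block (F x) = H.block x"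
    then have "F x \<in> H.block x" using H.block_self by blast
    then show False using F[OF that] Q.edge_ne by (auto simp: H.block_def)
  qed
  have beq: "H.block y = H.block x" if "(x, y) \<in> ?H" for x y
    using that H.block_eq[of x y] cl H.edge_in[OF that] by (simp add: H.block_def)
  \<comment> \<open>\<open>S\<close> contains one block of each pair exchanged by \<open>F\<close>:
    the choice depends only on the unordered pair, which is the same for \<open>x\<close> and
    \<open>F x\<close>.\<close>
  define S where "S = {x. H.block x = (SOME b. b \<in> {H.block x, H.block (F x)})}"
  have S_edge: "x \<in> S \<longleftrightarrow> y \<in> S" if "(x, y) \<in> ?H" for x y
    using beq[OF that] beq[OF FH[OF that]] by (simp add: S_def)
  have S_F: "F x \<in> S \<longleftrightarrow> x \<notin> S" if x: "x \<in> V" for x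
  proof -
    let ?b = "SOME b. b \<in> {H.block x, H.block (F x)}"
    have "?b \<in> {H.block x, H.block (F x)}" by (rule someI[of _ "H.block x"]) simp
    moreover have "F x \<in> S \<longleftrightarrow> H.block (F x) = ?b"
    proof -
      have "{H.block (F x), H.block (F (F x))} = {H.block x, H.block (F x)}" using FF[OF x] by auto
      then show ?thesis by (simp only: S_def mem_Collect_eq)
    qed
    moreover have "x \<in> S \<longleftrightarrow> H.block x = ?b" by (simp add: S_def)
    ultimately show ?thesis using nb[OF x] by (metis insertE singletonD)
  qed
  obtain a where a: "edge_coloring (Suc ?m) ?H a" using ex_H_coloring by blast
  \<comment> \<open>The colouring of one block is copied to its partner, so that \<open>x\<close>
    and \<open>F x\<close> miss the same colour.\<close>
  define b where "b = (\<lambda>x y. if x \<in> S then a x y else a (F x) (F y))"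
  have b: "edge_coloring (Suc ?m) ?H b"
    unfolding edge_coloring_def
  proof (intro conjI allI impI)
    fix x y assume xy: "(x, y) \<in> ?H"
    show "b x y < Suc ?m"
      using edge_coloring_less[OF a] xy FH[OF xy] by (simp add: b_def)
    show "b y x = b x y"
      using edge_coloring_sym[OF a xy] edge_coloring_sym[OF a FH[OF xy]] S_edge[OF xy]
      by (simp add: b_def)
  next
    fix x y z assume xy: "(x, y) \<in> ?H" and xz: "(x, z) \<in> ?H" and eq: "b x y = b x z"
    show "y = z"
    proof (cases "x \<in> S")
      case True
      then show ?thesis using eq edge_coloring_inj[OF a xy xz] by (simp add: b_def)
    next
      case False
      then have "F y = F z" using eq edge_coloring_inj[OF a FH[OF xy] FH[OF xz]] by (simp add: b_def)
      then show ?thesis using Finj H.edge_in xy xz by blast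
    qed
  qed
  have bF: "b (F x) (F y) = b x y" if xy: "(x, y) \<in> ?H" for x y
    using S_F[of x] FF[of x] FF[of y] H.edge_in[OF xy] by (simp add: b_def)
  have missF: "H.missing b (F x) = H.missing b x" if x: "x \<in> V" for x
  proof (rule H.missing_eq[OF b FV[OF x] H.missing(1)[OF b x]])
    show "misses ?H b (F x) (H.missing b x)"
      unfolding misses_def
    proof (intro allI impI)
      fix z assume z: "(F x, z) \<in> ?H"
      then have "(x, F z) \<in> ?H" "z \<in> V" using FH[OF z] FF[OF x] H.edge_in[OF z] by auto
      then have "b (F x) z = b x (F z)" using bF[of x "F z"] FF by simp
      then show "b (F x) z \<noteq> H.missing b x"
        using H.missing(2)[OF b x] \<open>(x, F z) \<in> ?H\<close> by (simp add: misses_def)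
    qed
  qed
  \<comment> \<open>One colour is saved: the edge from \<open>x\<close> to \<open>F x\<close> takes
    the colour of \<open>H\<close> missing at both ends. \<open>H\<close> uses the colours up to
    \<open>?m\<close>; the remaining classes of \<open>Q\<close> take \<open>?m + 1\<close> to
    \<open>d - 1\<close>.\<close>
  define c where "c = (\<lambda>x y. if (x, y) \<notin> Q then b x y
     else if c0 x y = 0 then H.missing b x else ?m + c0 x y)"
  have miss: "b x y \<noteq> H.missing b x" if "(x, y) \<in> ?H" for x y
    using H.missing(2)[OF b] H.edge_in[OF that] that by (simp add: misses_def)
  have bless: "b x y < Suc ?m" if "(x, y) \<in> ?H" for x y using edge_coloring_less[OF b that] .
  have mless: "H.missing b x < Suc ?m" if "(x, y) \<in> Q" for x y
    using H.missing(1)[OF b] Q.edge_in[OF that] by blast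
  have "edge_coloring d R c"
    unfolding edge_coloring_def
  proof (intro conjI allI impI)
    fix x y assume xy: "(x, y) \<in> R"
    show "c x y < d"
      using edge_coloring_less[OF c0, of x y] bless[of x y] mless[of x y] xy pos j
      by (auto simp: c_def)
    show "c y x = c x y"
    proof (cases "(x, y) \<in> Q")
      case True
      have yx: "(y, x) \<in> Q" "c0 y x = c0 x y"
        using Q.edge_sym[OF True] edge_coloring_sym[OF c0 True] by auto
      have "H.missing b y = H.missing b x" if "c0 x y = 0"
        using Funiq[OF True that] missF Q.edge_in[OF True] by simp
      then show ?thesis using True yx by (simp add: c_def)
    next
      case False
      then have "(y, x) \<notin> Q" using Q.edge_sym by blast
      then show ?thesis using False xy edge_coloring_sym[OF b, of x y] by (simp add: c_def)
    qed
  next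
    fix x y z assume xy: "(x, y) \<in> R" and xz: "(x, z) \<in> R" and eq: "c x y = c x z"
    show "y = z"
    proof (cases "(x, y) \<in> Q"; cases "(x, z) \<in> Q")
      assume q: "(x, y) \<in> Q" "(x, z) \<in> Q"
      then have "c0 x y = c0 x z"
        using eq mless[of x y] by (auto simp: c_def split: if_splits)
      then show ?thesis using edge_coloring_inj[OF c0 q] by simp
    next
      assume q: "(x, y) \<in> Q" "(x, z) \<notin> Q"
      then show ?thesis
        using eq miss[of x z] bless[of x z] xz by (auto simp: c_def split: if_splits)
    next
      assume q: "(x, y) \<notin> Q" "(x, z) \<in> Q"
      then show ?thesis
        using eq miss[of x y] bless[of x y] xy by (auto simp: c_def split: if_splits)
    next
      assume q: "(x, y) \<notin> Q" "(x, z) \<notin> Q"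
      then show ?thesis using eq xy xz edge_coloring_inj[OF b, of x y z] by (simp add: c_def)
    qed
  qed
  then show ?thesis by blast
qed

text \<open>Stacking a colouring of \<open>H\<close> on \<open>c0\<close> and applying
  \<open>bad\<close> gives an automorphism of \<open>H\<close> without fixed vertices, so
  \<open>no_perfect_matching\<close> applies to \<open>H\<close> if it has no perfect
  matching.\<close>

lemma class_one_or_perfect_matching:
  "(\<exists>c. edge_coloring d R c) \<or> (\<exists>f. matching (R - Q) f \<and> (\<forall>x\<in>V. f x \<noteq> x))"
proof (rule disjCI, rule ccontr)
  assume nm: "\<nexists>f. matching (R - Q) f \<and> (\<forall>x\<in>V. f x \<noteq> x)" and n1: "\<nexists>c. edge_coloring d R c"
  interpret N: no_perfect_matching V "R - Q" "d - j"
  proof unfold_locales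
    show "V \<noteq> {}" by (rule nonempty)
    show "\<exists>x\<in>V. f x = x" if "matching (R - Q) f" for f using nm that by blast
    show "\<exists>g. color_aut V (R - Q) c g \<and> (\<forall>x\<in>V. g x \<noteq> x)"
      if "edge_coloring (Suc (d - j)) (R - Q) c" for c
      using bad[OF stack_coloring[OF that]] color_aut_stack(2)[OF _ c0 Q(1) RV] by blast
  qed
  obtain u w where u: "u \<in> V" "H.clique_vertex u" and ev: "even (d - j)"
    and w: "w \<in> V" "(u, w) \<notin> (R - Q)\<^sup>*"
    using N.ex_odd_clique_component unfolding H.clique_vertex_def by blast
  \<comment> \<open>For \<open>j = 0\<close> the rest would be the whole connected graph, where
    \<open>u\<close> reaches \<open>w\<close>.\<close>
  have "0 < j"
  proof (rule ccontr)
    assume "\<not> 0 < j"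
    then have "Q = {}" using edge_coloring_less[OF c0] by fastforce
    then show False using conn[OF u(1) w(1)] w(2) by simp
  qed
  then show False using class_one_prisms[OF all_clique_vertices[OF u] ev] n1 by blast
qed

end

section \<open>Adding perfect matchings as long as possible\<close>

context bad_graph
begin

theorem class_one: "\<exists>c. edge_coloring d R c"
proof -
  define P where "P = (\<lambda>j. \<exists>Q c0. Q \<subseteq> R \<and> sym Q \<and> (\<forall>x\<in>V. card (Q `` {x}) = j) \<and> edge_coloring j Q c0)"
  have "P 0" unfolding P_def
    by (rule exI[of _ "{}"]) (simp add: sym_def edge_coloring_def)
  moreover have Pd: "j \<le> d" if P: "P j" for j
  proof -
    obtain Q where Q: "Q \<subseteq> R" "\<forall>x\<in>V. card (Q `` {x}) = j" using P unfolding P_def by blast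
    obtain x where x: "x \<in> V" using nonempty by blast
    have "card (Q `` {x}) \<le> card (R `` {x})" using Q(1) by (intro card_mono fin_nbrs) auto
    then show ?thesis using Q(2) x reg[OF x] by simp
  qed
  ultimately obtain j where j: "P j" and max: "\<And>i. P i \<Longrightarrow> i \<le> j"
    by (metis Greatest_le_nat GreatestI_nat)
  then obtain Q c0 where Q: "Q \<subseteq> R" "sym Q" and Qreg: "\<And>x. x \<in> V \<Longrightarrow> card (Q `` {x}) = j"
    and c0: "edge_coloring j Q c0" unfolding P_def by blast
  have finQ: "finite (Q `` {x})" for x
    by (rule finite_subset[OF Image_mono[OF Q(1) order_refl] fin_nbrs])
  show ?thesis
  proof (cases "j = d")
    case True
    have "Q `` {x} = R `` {x}" if "x \<in> V" for x
      using Q(1) Qreg[OF that] reg[OF that] True by (intro card_subset_eq fin_nbrs) auto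
    then have "R \<subseteq> Q" using edge_in by (metis Image_singleton_iff subrelI)
    then have "Q = R" using Q(1) by blast
    then show ?thesis using c0 True by blast
  next
    case False
    then have jd: "j < d" using Pd[OF j] by simp
    interpret L: layered_graph V R d Q c0 j
      using Q Qreg c0 jd by unfold_locales
    show ?thesis
    proof (rule ccontr)
      assume "\<not> ?thesis"
      then obtain f where f: "matching (R - Q) f" "\<forall>x\<in>V. f x \<noteq> x"
        using L.class_one_or_perfect_matching by blast
      \<comment> \<open>The perfect matching becomes the class of colour \<open>j\<close>, against
        the maximality of \<open>j\<close>.\<close>
      let ?Q = "Q \<union> {(x, f x) | x. x \<in> V}"
      let ?c = "\<lambda>x y. if (x, y) \<in> Q then c0 x y else j"
      have fR: "(x, f x) \<in> R - Q" if "x \<in> V" for x using matching_edge[OF f(1)] f(2) that by blast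
      have ff: "f (f x) = x" for x using matching_invol[OF f(1)] .
      have "?Q \<subseteq> R" using Q(1) fR by blast
      moreover have symQ: "sym ?Q"
      proof (rule symI)
        fix x y assume "(x, y) \<in> ?Q"
        then consider "(x, y) \<in> Q" | "x \<in> V" "y = f x" by blast
        then show "(y, x) \<in> ?Q"
        proof cases
          case 1
          then show ?thesis using Q(2) by (auto dest: symD)
        next
          case 2
          then have "y \<in> V" using fR edge_in by blast
          then show ?thesis using ff[of x] 2 by auto
        qed
      qed
      moreover have "\<forall>x\<in>V. card (?Q `` {x}) = Suc j"
      proof
        fix x assume x: "x \<in> V"
        have "?Q `` {x} = insert (f x) (Q `` {x})" using x by auto
        moreover have "f x \<notin> Q `` {x}" using fR[OF x] by simp
        ultimately show "card (?Q `` {x}) = Suc j" using Qreg[OF x] finQ by simp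
      qed
      moreover have "edge_coloring (Suc j) ?Q ?c"
        unfolding edge_coloring_def
      proof (intro conjI allI impI)
        fix x y assume "(x, y) \<in> ?Q"
        show "?c x y < Suc j" using edge_coloring_less[OF c0, of x y] by auto
        have "(y, x) \<in> Q \<longleftrightarrow> (x, y) \<in> Q" using Q(2) by (auto dest: symD)
        then show "?c y x = ?c x y" using edge_coloring_sym[OF c0, of x y] by simp
      next
        fix x y z assume "(x, y) \<in> ?Q" "(x, z) \<in> ?Q" "?c x y = ?c x z"
        then show "y = z"
          using edge_coloring_inj[OF c0, of x y z] edge_coloring_less[OF c0, of x y]
            edge_coloring_less[OF c0, of x z] by (auto split: if_splits)
      qed
      ultimately have "P (Suc j)" unfolding P_def by blast
      then show False using max by fastforce
    qed
  qed
qed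

end

section \<open>Counterexamples of class one\<close>

definition cycle_on :: "nat \<Rightarrow> 'a set \<Rightarrow> ('a \<times> 'a) set \<Rightarrow> bool" where
  "cycle_on n V R \<longleftrightarrow> (\<exists>f. bij_betw f {..<n} V \<and>
     (\<forall>i<n. \<forall>j<n. (f i, f j) \<in> R \<longleftrightarrow> j = Suc i mod n \<or> i = Suc j mod n))"

definition complete_on :: "'a set \<Rightarrow> ('a \<times> 'a) set \<Rightarrow> bool" where
  "complete_on V R \<longleftrightarrow> R = {(x, y). x \<in> V \<and> y \<in> V \<and> x \<noteq> y}"

definition bipartite_on :: "nat \<Rightarrow> nat \<Rightarrow> 'a set \<Rightarrow> ('a \<times> 'a) set \<Rightarrow> bool" where
  "bipartite_on m n V R \<longleftrightarrow> (\<exists>A B. V = A \<union> B \<and> A \<inter> B = {} \<and> card A = m \<and> card B = n \<and>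
     R = A \<times> B \<union> B \<times> A)"

lemma color_aut_unique:
  assumes c: "edge_coloring k R c" and g: "color_aut V R c g" and h: "color_aut V R c h"
    and R: "R \<subseteq> V \<times> V" and x: "g x = h x" and xy: "(x, y) \<in> R\<^sup>*"
  shows "g y = h y"
  using xy
proof (induction rule: rtrancl_induct)
  case (step y z)
  have "(g y, g z) \<in> R" "(h y, h z) \<in> R"
    using graph_aut_edge[OF color_aut_aut[OF g]] graph_aut_edge[OF color_aut_aut[OF h]] step(2) R
    by auto
  moreover have "c (g y) (g z) = c (h y) (h z)"
    using color_aut_color[OF g step(2)] color_aut_color[OF h step(2)] by simp
  ultimately show ?case using edge_coloring_inj[OF c] step.IH by metis
qed (rule x)

locale class_one_bad_graph = bad_graph +
  fixes c :: "'a \<Rightarrow> 'a \<Rightarrow> nat"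
  assumes c: "edge_coloring d R c"
begin

text \<open>
  The matching \<open>S\<close> becomes the class of the new colour \<open>d\<close>; the old colour of an edge of \<open>S\<close> is
  the only one of \<open>0, \<dots>, d - 1\<close> missing at its ends.
\<close>

lemma matching_preserving_aut:
  assumes S: "S \<subseteq> R" "sym S" and m: "\<And>x y z. (x, y) \<in> S \<Longrightarrow> (x, z) \<in> S \<Longrightarrow> y = z"
  shows "\<exists>g. color_aut V R c g \<and> (\<forall>x\<in>V. g x \<noteq> x) \<and> (\<forall>x y. (x, y) \<in> S \<longrightarrow> (g x, g y) \<in> S)"
proof -
  let ?c = "\<lambda>x y. if (x, y) \<in> S then d else c x y"
  have less: "c x y < d" if "(x, y) \<in> R" for x y using edge_coloring_less[OF c that] .
  have cc: "edge_coloring (Suc d) R ?c"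
    unfolding edge_coloring_def
  proof (intro conjI allI impI)
    fix x y assume xy: "(x, y) \<in> R"
    show "?c x y < Suc d" using less[OF xy] by simp
    have "(y, x) \<in> S \<longleftrightarrow> (x, y) \<in> S" using S(2) by (auto dest: symD)
    then show "?c y x = ?c x y" using edge_coloring_sym[OF c xy] by simp
  next
    fix x y z assume "(x, y) \<in> R" "(x, z) \<in> R" "?c x y = ?c x z"
    then show "y = z"
      using m[of x y z] less[of x y] less[of x z] edge_coloring_inj[OF c, of x y z]
      by (auto split: if_splits)
  qed
  obtain g where g: "color_aut V R ?c g" "\<forall>x\<in>V. g x \<noteq> x" using bad[OF cc] by blast
  note aut = color_aut_aut[OF g(1)]
  have col: "?c (g x) (g y) = ?c x y" "(g x, g y) \<in> R" if "(x, y) \<in> R" for x y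
    using color_aut_color[OF g(1) that] graph_aut_edge[OF aut] edge_in[OF that] that by auto
  have gS: "(g x, g y) \<in> S \<longleftrightarrow> (x, y) \<in> S" if "(x, y) \<in> R" for x y
    using col[OF that] less[OF that] less[OF col(2)[OF that]] by (metis less_irrefl)
  have "c (g x) (g y) = c x y" if xy: "(x, y) \<in> R" for x y
  proof (cases "(x, y) \<in> S")
    case True
    have V: "x \<in> V" "g x \<in> V" using edge_in[OF xy] graph_aut_mem[OF aut] by auto
    have "misses R ?c x (c x y)"
      unfolding misses_def
    proof (intro allI impI)
      fix z assume xz: "(x, z) \<in> R"
      show "?c x z \<noteq> c x y"
        using less[OF xy] edge_coloring_inj[OF c xy xz] True by (cases "z = y") auto
    qed
    then have "misses R ?c (g x) (c x y)" using color_aut_misses[OF g(1) RV V(1)] by simp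
    moreover obtain z where z: "(g x, z) \<in> R" "c (g x) z = c x y"
      using all_colors[OF c V(2) less[OF xy]] by blast
    ultimately have "(g x, z) \<in> S" unfolding misses_def by metis
    moreover have "(g x, g y) \<in> S" using gS[OF xy] True by simp
    ultimately have "z = g y" by (rule m)
    then show ?thesis using z by simp
  next
    case False
    then show ?thesis using col(1)[OF xy] gS[OF xy] by simp
  qed
  then have "color_aut V R c g" using aut by (simp add: color_aut_def)
  then show ?thesis using g(2) gS S(1) by blast
qed

lemma inverting_aut:
  assumes xy: "(x, y) \<in> R"
  shows "\<exists>g. color_aut V R c g \<and> (\<forall>v\<in>V. g v \<noteq> v) \<and> g x = y \<and> g y = x"
proof -
  let ?S = "{(x, y), (y, x)}"
  have ne: "x \<noteq> y" using edge_ne[OF xy] .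
  have "?S \<subseteq> R" "sym ?S" using xy edge_sym[OF xy] by (auto simp: sym_def)
  moreover have "v = t" if "(u, v) \<in> ?S" "(u, t) \<in> ?S" for u v t using that ne by auto
  ultimately obtain g where g: "color_aut V R c g" "\<forall>v\<in>V. g v \<noteq> v"
      "\<forall>u v. (u, v) \<in> ?S \<longrightarrow> (g u, g v) \<in> ?S"
    using matching_preserving_aut[of ?S] by blast
  have "(g x, g y) \<in> ?S" using g(3) by blast
  moreover have "g x \<noteq> x" using g(2) edge_in[OF xy] by blast
  ultimately show ?thesis using g by auto
qed

text \<open>Giving the new colour to both edges yields an automorphism \<open>h\<close> preserving
  the pair. Their different old colours keep the two edges apart, so \<open>h\<close> inverts both;
  it agrees with \<open>g\<close> at \<open>x\<close>, hence everywhere by connectedness.\<close>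

lemma inverting_aut_inverts:
  assumes xy: "(x, y) \<in> R" and g: "color_aut V R c g" "g x = y"
    and zw: "(z, w) \<in> R" "c z w \<noteq> c x y" "z \<notin> {x, y}" "w \<notin> {x, y}"
  shows "g z = w"
proof -
  let ?S = "{(x, y), (y, x), (z, w), (w, z)}"
  have ne: "x \<noteq> y" "z \<noteq> w" using edge_ne[OF xy] edge_ne[OF zw(1)] by auto
  have cs: "c y x = c x y" "c w z = c z w"
    using edge_coloring_sym[OF c xy] edge_coloring_sym[OF c zw(1)] by auto
  have "?S \<subseteq> R" "sym ?S" using xy zw(1) edge_sym by (auto simp: sym_def)
  moreover have "v = t" if "(u, v) \<in> ?S" "(u, t) \<in> ?S" for u v t
    using that ne zw(3,4) by auto
  ultimately obtain h where h: "color_aut V R c h" "\<forall>v\<in>V. h v \<noteq> v"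
      "\<And>u v. (u, v) \<in> ?S \<Longrightarrow> (h u, h v) \<in> ?S"
    using matching_preserving_aut[of ?S] by blast
  have col: "c (h u) (h v) = c u v" if "(u, v) \<in> R" for u v using color_aut_color[OF h(1) that] .
  have moved: "h x \<noteq> x" "h z \<noteq> z" using h(2) edge_in[OF xy] edge_in[OF zw(1)] by auto
  have "(h x, h y) \<in> ?S" "(h z, h w) \<in> ?S" using h(3) by blast+
  then have "(h x, h y) \<in> {(x, y), (y, x)}" "(h z, h w) \<in> {(z, w), (w, z)}"
    using col[OF xy] col[OF zw(1)] zw(2) cs by auto
  then have hx: "h x = y" "h z = w" using moved by auto
  have "g z = h z"
    using color_aut_unique[OF c g(1) h(1) RV] g(2) hx(1) conn edge_in[OF xy] edge_in[OF zw(1)] by metis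
  then show ?thesis using hx(2) by simp
qed

section \<open>Degree bound, cubic and 2-regular cases\<close>

lemma closed_set_eq:
  assumes S: "x \<in> S" "S \<subseteq> V" and closed: "\<And>u v. u \<in> S \<Longrightarrow> (u, v) \<in> R \<Longrightarrow> v \<in> S"
  shows "S = V"
proof -
  have "y \<in> S" if "(x, y) \<in> R\<^sup>*" for y
    using that by (induction rule: rtrancl_induct) (use S closed in auto)
  then show ?thesis using conn S by blast
qed

lemma color_nbr:
  assumes "i < d"
  obtains f where "\<And>x. x \<in> V \<Longrightarrow> (x, f x) \<in> R \<and> c x (f x) = i \<and> f x \<in> V \<and> f x \<noteq> x \<and> f (f x) = x"
proof -
  have "\<forall>x\<in>V. \<exists>y. (x, y) \<in> R \<and> c x y = i" using all_colors[OF c _ assms] by blast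
  then obtain f where f: "\<And>x. x \<in> V \<Longrightarrow> (x, f x) \<in> R \<and> c x (f x) = i" by metis
  have "f x \<in> V \<and> f x \<noteq> x \<and> f (f x) = x" if x: "x \<in> V" for x
  proof -
    have fx: "f x \<in> V" "f x \<noteq> x" using f[OF x] edge_in edge_ne by metis+
    have "(f x, x) \<in> R" "c (f x) x = i" using f[OF x] edge_sym edge_coloring_sym[OF c] by metis+
    then have "f (f x) = x"
      using f[OF fx(1)] edge_coloring_inj[OF c, of "f x" "f (f x)" x] by simp
    then show ?thesis using fx by simp
  qed
  then show thesis using that f by blast
qed

lemma even_order: "0 < d \<Longrightarrow> even (card V)"
  by (rule color_nbr) (use even_card_involution[OF finV] in blast)+

text \<open>An edge at \<open>z\<close> that avoids \<open>x\<close> and \<open>y\<close> and has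
  another colour than \<open>x y\<close> is inverted by the automorphism inverting
  \<open>x y\<close>, so it leads to the image of \<open>z\<close>. The colour of \<open>x y\<close>
  itself accounts for one more neighbour.\<close>

lemma nbrs_bound:
  assumes xy: "(x, y) \<in> R" and z: "z \<in> V" "z \<notin> {x, y}"
  shows "\<exists>p q. R `` {z} \<subseteq> {x, y, p, q}"
proof -
  obtain g where g: "color_aut V R c g" "g x = y" using inverting_aut[OF xy] by blast
  obtain p where p: "(z, p) \<in> R" "c z p = c x y"
    using all_colors[OF c z(1) edge_coloring_less[OF c xy]] by blast
  have "R `` {z} \<subseteq> {x, y, p, g z}"
  proof
    fix w assume "w \<in> R `` {z}"
    then have w: "(z, w) \<in> R" by simp
    show "w \<in> {x, y, p, g z}"
      using edge_coloring_inj[OF c w p(1)] p(2) inverting_aut_inverts[OF xy g w _ z(2)] by auto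
  qed
  then show ?thesis by blast
qed

text \<open>For degree at least 4 the bound of \<open>nbrs_bound\<close> is attained, so every other
  vertex is adjacent to \<open>x\<close> and the order is 5. But the colour classes are perfect
  matchings, which forces even order.\<close>

lemma degree_le_3:
  assumes "d \<ge> 2" shows "d \<le> 3"
proof (rule ccontr)
  assume d: "\<not> d \<le> 3"
  obtain x where x: "x \<in> V" using nonempty by blast
  then have "R `` {x} \<noteq> {}" using reg[OF x] d by auto
  then obtain y where xy: "(x, y) \<in> R" by blast
  have four: "card {x, y, p, q} \<le> 4" for p q
    using card_length[of "[x, y, p, q]"] by simp
  have adj: "d = 4 \<and> (x, z) \<in> R" if z: "z \<in> V" "z \<notin> {x, y}" for z
  proof -
    obtain p q where pq: "R `` {z} \<subseteq> {x, y, p, q}" using nbrs_bound[OF xy z] by blast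
    then have le: "d \<le> card {x, y, p, q}" using reg[OF z(1)] card_mono[OF _ pq] by simp
    then have "card {x, y, p, q} = d" "d = 4" using four[of p q] d by linarith+
    then have "R `` {z} = {x, y, p, q}" using card_subset_eq[OF _ pq] reg[OF z(1)] by simp
    then show ?thesis using edge_sym \<open>d = 4\<close> by blast
  qed
  have "V - {x} \<subseteq> R `` {x}" using adj xy by blast
  moreover have "R `` {x} \<subseteq> V - {x}" using edge_in edge_ne by blast
  ultimately have "V - {x} = R `` {x}" by blast
  then have card: "card V = Suc d"
    using reg[OF x] x finV by (metis card_Suc_Diff1)
  have "\<not> V \<subseteq> {x, y}"
  proof
    assume "V \<subseteq> {x, y}"
    then have "card V \<le> card {x, y}" by (intro card_mono) auto
    then show False using card d card_length[of "[x, y]"] by simp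
  qed
  then have "d = 4" using adj by blast
  then show False using card even_order by simp
qed

text \<open>By \<open>nbrs_bound\<close> a vertex adjacent to neither end of an edge would have at
  most two neighbours. So the neighbourhoods of adjacent vertices cover \<open>V\<close>, and the
  order, being even, is 4 or 6.\<close>

lemma cubic:
  assumes d: "d = 3"
  shows "(card V = 4 \<and> complete_on V R) \<or> bipartite_on 3 3 V R"
proof -
  have cover: "V = R `` {x} \<union> R `` {y}" if xy: "(x, y) \<in> R" for x y
  proof
    show "V \<subseteq> R `` {x} \<union> R `` {y}"
    proof
      fix z assume z: "z \<in> V"
      show "z \<in> R `` {x} \<union> R `` {y}"
      proof (rule ccontr)
        assume nz: "z \<notin> R `` {x} \<union> R `` {y}"
        then have "z \<notin> {x, y}" using xy edge_sym[OF xy] by auto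
        then obtain p q where pq: "R `` {z} \<subseteq> {x, y, p, q}" using nbrs_bound[OF xy z] by blast
        moreover have "x \<notin> R `` {z}" "y \<notin> R `` {z}" using nz edge_sym by auto
        ultimately have "R `` {z} \<subseteq> {p, q}" by blast
        then have "card (R `` {z}) \<le> card {p, q}" by (intro card_mono) auto
        then show False using reg[OF z] d card_length[of "[p, q]"] by simp
      qed
    qed
  qed (use nbrs_sub in blast)
  obtain x where x: "x \<in> V" using nonempty by blast
  then have "R `` {x} \<noteq> {}" using reg[OF x] d by auto
  then obtain y where xy: "(x, y) \<in> R" by blast
  have card_un: "card V + card (R `` {x} \<inter> R `` {y}) = 6" if xy: "(x, y) \<in> R" for x y
    using cover[OF xy] reg[of x] reg[of y] edge_in[OF xy] d fin_nbrs
      card_Un_Int[of "R `` {x}" "R `` {y}"] by simp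
  have "insert x (R `` {x}) \<subseteq> V" using x nbrs_sub by auto
  then have "card (insert x (R `` {x})) \<le> card V" using finV by (intro card_mono) auto
  then have "4 \<le> card V" using reg[OF x] d fin_nbrs irreflR by (simp add: card_insert_if irrefl_def)
  moreover have "even (card V)" using even_order d by simp
  moreover have "card V \<le> 6" using card_un[OF xy] by simp
  ultimately have "card V = 4 \<or> card V = 6" by presburger
  then show ?thesis
  proof
    assume 4: "card V = 4"
    have "R `` {z} = V - {z}" if z: "z \<in> V" for z
    proof (rule card_subset_eq)
      show "R `` {z} \<subseteq> V - {z}" using nbrs_sub edge_ne by blast
      show "card (R `` {z}) = card (V - {z})" using reg[OF z] z 4 d by simp
    qed (use finV in simp)
    then have "(z, w) \<in> R \<longleftrightarrow> z \<in> V \<and> w \<in> V \<and> z \<noteq> w" for z w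
      using edge_in[of z w] by blast
    then have "complete_on V R" by (auto simp: complete_on_def)
    then show ?thesis using 4 by blast
  next
    assume 6: "card V = 6"
    have tri: "R `` {s} \<inter> R `` {t} = {}" if "(s, t) \<in> R" for s t
      using card_un[OF that] 6 fin_nbrs by simp
    let ?A = "R `` {x}" and ?B = "R `` {y}"
    \<comment> \<open>In order 6 adjacent vertices have disjoint neighbourhoods, so the neighbours
      of \<open>z\<close> avoid those of \<open>s\<close> and must lie among those of
      \<open>t\<close>.\<close>
    have nb: "R `` {z} = R `` {t}"
      if z: "(s, z) \<in> R" and st: "(s, t) \<in> R" for s t z
    proof (rule card_subset_eq)
      show "R `` {z} \<subseteq> R `` {t}" using tri[OF z] cover[OF st] nbrs_sub by blast
      show "card (R `` {z}) = card (R `` {t})" using reg edge_in[OF z] edge_in[OF st] by simp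
    qed (rule fin_nbrs)
    have A: "R `` {z} = ?B" if "z \<in> ?A" for z using nb[of x z y] that xy by simp
    have B: "R `` {z} = ?A" if "z \<in> ?B" for z using nb[of y z x] that edge_sym[OF xy] by simp
    have "(z, w) \<in> ?A \<times> ?B \<union> ?B \<times> ?A" if zw: "(z, w) \<in> R" for z w
    proof (cases "z \<in> ?A")
      case True
      then show ?thesis using A[OF True] zw by blast
    next
      case False
      then have zB: "z \<in> ?B" using cover[OF xy] edge_in[OF zw] by blast
      then show ?thesis using B[OF zB] zw by blast
    qed
    moreover have "(z, w) \<in> R" if "(z, w) \<in> ?A \<times> ?B \<union> ?B \<times> ?A" for z w
      using that A[of z] B[of z] by blast
    ultimately have RAB: "R = ?A \<times> ?B \<union> ?B \<times> ?A"
      by (intro subset_antisym subrelI)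
    have "card ?A = 3" "card ?B = 3" using reg edge_in[OF xy] d by simp_all
    then have "bipartite_on 3 3 V R"
      unfolding bipartite_on_def using cover[OF xy] tri[OF xy] RAB
      by (intro exI[of _ ?A] exI[of _ ?B] conjI)
    then show ?thesis by blast
  qed
qed

text \<open>Two alternating steps from the edge \<open>x y\<close> in both directions give the path
  \<open>q\<close>, \<open>p\<close>, \<open>x\<close>, \<open>y\<close>, \<open>p'\<close>,
  \<open>q'\<close>. If \<open>q = p'\<close>, it closes to a 4-cycle. Otherwise the automorphism
  inverting \<open>x y\<close> sends \<open>q\<close> to \<open>q'\<close> and inverts the edge of
  the second colour at \<open>q\<close>, which thus ends in \<open>q'\<close>.\<close>

lemma quadratic:
  assumes d: "d = 2"
  shows "cycle_on 4 V R \<or> cycle_on 6 V R"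
proof -
  obtain x where x: "x \<in> V" using nonempty by blast
  then have "R `` {x} \<noteq> {}" using reg[OF x] d by auto
  then obtain y where xy: "(x, y) \<in> R" by blast
  define i where "i = c x y"
  have i: "i < 2" using edge_coloring_less[OF c xy] d by (simp add: i_def)
  obtain \<alpha> where \<alpha>: "\<And>v. v \<in> V \<Longrightarrow> (v, \<alpha> v) \<in> R \<and> c v (\<alpha> v) = i \<and> \<alpha> v \<in> V \<and> \<alpha> v \<noteq> v \<and> \<alpha> (\<alpha> v) = v"
    using color_nbr i d by metis
  \<comment> \<open>The colours are 0 and 1, so \<open>1 - i\<close> is the other one.\<close>
  obtain \<beta> where \<beta>: "\<And>v. v \<in> V \<Longrightarrow> (v, \<beta> v) \<in> R \<and> c v (\<beta> v) = 1 - i \<and> \<beta> v \<in> V \<and> \<beta> v \<noteq> v \<and> \<beta> (\<beta> v) = v"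
  proof -
    have "1 - i < d" using d by simp
    then show thesis by (rule color_nbr) (rule that)
  qed
  have ne: "\<alpha> v \<noteq> \<beta> v" if "v \<in> V" for v
  proof
    assume "\<alpha> v = \<beta> v"
    then have "i = 1 - i" using \<alpha>[OF that] \<beta>[OF that] by metis
    then show False using i by presburger
  qed
  have N: "R `` {v} = {\<alpha> v, \<beta> v}" if "v \<in> V" for v
  proof (rule sym, rule card_subset_eq)
    show "{\<alpha> v, \<beta> v} \<subseteq> R `` {v}" using \<alpha>[OF that] \<beta>[OF that] by simp
    show "card {\<alpha> v, \<beta> v} = card (R `` {v})" using ne[OF that] reg[OF that] d by simp
  qed (rule fin_nbrs)
  have edge: "(v, w) \<in> R \<longleftrightarrow> w = \<alpha> v \<or> w = \<beta> v" if "v \<in> V" for v w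
    using N[OF that] by auto
  obtain g where g: "color_aut V R c g" "g x = y" using inverting_aut[OF xy] by blast
  note aut = color_aut_aut[OF g(1)]
  have g\<alpha>: "g (\<alpha> v) = \<alpha> (g v)" if v: "v \<in> V" for v
  proof -
    have "(g v, g (\<alpha> v)) \<in> R" "c (g v) (g (\<alpha> v)) = i"
      using \<alpha>[OF v] graph_aut_edge[OF aut v] color_aut_color[OF g(1)] by auto
    then show ?thesis
      using \<alpha>[OF graph_aut_mem[OF aut v]] edge_coloring_inj[OF c, of "g v" "g (\<alpha> v)" "\<alpha> (g v)"] by simp
  qed
  have g\<beta>: "g (\<beta> v) = \<beta> (g v)" if v: "v \<in> V" for v
  proof -
    have "(g v, g (\<beta> v)) \<in> R" "c (g v) (g (\<beta> v)) = 1 - i"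
      using \<beta>[OF v] graph_aut_edge[OF aut v] color_aut_color[OF g(1)] by auto
    then show ?thesis
      using \<beta>[OF graph_aut_mem[OF aut v]] edge_coloring_inj[OF c, of "g v" "g (\<beta> v)" "\<beta> (g v)"] by simp
  qed
  define p where "p = \<beta> x"
  define p' where "p' = \<beta> y"
  define q where "q = \<alpha> p"
  define q' where "q' = \<alpha> p'"
  have y: "y \<in> V" "\<alpha> x = y" "\<alpha> y = x"
  proof -
    show "y \<in> V" using edge_in[OF xy] by simp
    show "\<alpha> x = y" using edge_coloring_inj[OF c _ xy, of "\<alpha> x"] \<alpha>[OF x] by (simp add: i_def)
    then show "\<alpha> y = x" using \<alpha>[OF x] by simp
  qed
  have p: "p \<in> V" "\<beta> x = p" "\<beta> p = x" using \<beta>[OF x] by (simp_all add: p_def)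
  have p': "p' \<in> V" "\<beta> y = p'" "\<beta> p' = y" using \<beta>[OF y(1)] by (simp_all add: p'_def)
  have q: "q \<in> V" "\<alpha> p = q" "\<alpha> q = p" using \<alpha>[OF p(1)] by (simp_all add: q_def)
  have q': "q' \<in> V" "\<alpha> p' = q'" "\<alpha> q' = p'" using \<alpha>[OF p'(1)] by (simp_all add: q'_def)
  have d1: "x \<noteq> y" "p \<noteq> x" "p' \<noteq> y" "q \<noteq> p" "q' \<noteq> p'"
    using edge_ne[OF xy] \<beta>[OF x] \<beta>[OF y(1)] \<alpha>[OF p(1)] \<alpha>[OF p'(1)] p p' q q' by metis+
  have d2: "p \<noteq> y" "p' \<noteq> x" using ne[OF x] ne[OF y(1)] y p p' by auto
  have d3: "p \<noteq> p'" using d1(1) p p' by metis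
  have d4: "q \<noteq> x" "q \<noteq> y" "q' \<noteq> x" "q' \<noteq> y" "q \<noteq> q'" using d1 d2 d3 y q q' by metis+
  show ?thesis
  proof (cases "q = p'")
    case True
    then have q2: "\<alpha> p = p'" "\<alpha> p' = p" using q by auto
    have V: "{x, y, p', p} = V"
      by (rule closed_set_eq[of x]) (use x y p p' q2 edge in auto)
    let ?f = "\<lambda>i. [x, y, p', p] ! i"
    have "bij_betw ?f {..<4} V"
    proof (rule bij_betw_imageI)
      show "inj_on ?f {..<4}" using d1 d2 d3
        by (intro inj_on_nth) auto
      show "?f ` {..<4} = V" using V by (auto simp: image_iff lessThan_nat_numeral lessThan_Suc)
    qed
    moreover have "(?f i, ?f j) \<in> R \<longleftrightarrow> j = Suc i mod 4 \<or> i = Suc j mod 4" if "i < 4" "j < 4" for i j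
    proof -
      have "i = 0 \<or> i = 1 \<or> i = 2 \<or> i = 3" "j = 0 \<or> j = 1 \<or> j = 2 \<or> j = 3" using that by auto
      then show ?thesis
        by (elim disjE) (simp_all add: edge x y p p' q2 d1 d2 d3 d1[symmetric] d2[symmetric] d3[symmetric])
    qed
    ultimately have "cycle_on 4 V R" unfolding cycle_on_def by blast
    then show ?thesis by blast
  next
    case False
    have d5: "q' \<noteq> p" using False q q' by metis
    have gp: "g p = p'" using g\<beta>[OF x] g(2) p p' by simp
    have "g q = q'" using g\<alpha>[OF p(1)] gp q q' by simp
    moreover have "g q = \<beta> q"
    proof (rule inverting_aut_inverts[OF xy g])
      show "(q, \<beta> q) \<in> R" using \<beta>[OF q(1)] by simp
      have "1 - i \<noteq> i" using i by presburger
      then show "c q (\<beta> q) \<noteq> c x y" using \<beta>[OF q(1)] by (simp add: i_def)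
      show "q \<notin> {x, y}" using d4 by simp
      have "\<beta> q \<noteq> x" "\<beta> q \<noteq> y" using \<beta>[OF q(1)] p p' d1 False by metis+
      then show "\<beta> q \<notin> {x, y}" by simp
    qed
    ultimately have q2: "\<beta> q = q'" "\<beta> q' = q" using \<beta>[OF q(1)] by auto
    have V: "{x, y, p', q', q, p} = V"
      by (rule closed_set_eq[of x]) (use x y p p' q q' q2 edge in auto)
    let ?f = "\<lambda>i. [x, y, p', q', q, p] ! i"
    have "bij_betw ?f {..<6} V"
    proof (rule bij_betw_imageI)
      show "inj_on ?f {..<6}" using d1 d2 d3 d4 d5 False
        by (intro inj_on_nth) auto
      show "?f ` {..<6} = V" using V by (auto simp: image_iff lessThan_nat_numeral lessThan_Suc)
    qed
    moreover have "(?f i, ?f j) \<in> R \<longleftrightarrow> j = Suc i mod 6 \<or> i = Suc j mod 6" if "i < 6" "j < 6" for i j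
    proof -
      have "i = 0 \<or> i = 1 \<or> i = 2 \<or> i = 3 \<or> i = 4 \<or> i = 5"
        "j = 0 \<or> j = 1 \<or> j = 2 \<or> j = 3 \<or> j = 4 \<or> j = 5" using that by auto
      then show ?thesis
        by (elim disjE) (simp_all add: edge x y p p' q q' q2 d1 d2 d3 d4 d5 False
            d1[symmetric] d2[symmetric] d3[symmetric] d4[symmetric] d5[symmetric] False[symmetric])
    qed
    ultimately have "cycle_on 6 V R" unfolding cycle_on_def by blast
    then show ?thesis by blast
  qed
qed

end

theorem (in bad_graph) exceptional:
  assumes "d \<ge> 2"
  shows "cycle_on 4 V R \<or> (card V = 4 \<and> complete_on V R) \<or> cycle_on 6 V R \<or> bipartite_on 3 3 V R"
proof -
  obtain c where c: "edge_coloring d R c" using class_one by blast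
  interpret class_one_bad_graph V R d c by unfold_locales (rule c)
  have "d = 2 \<or> d = 3" using degree_le_3[OF assms] assms by linarith
  then show ?thesis using quadratic cubic by blast
qed

section \<open>Symmetric colourings of the exceptional graphs\<close>

text \<open>\<open>f\<close> labels the vertices by numbers and \<open>E\<close> lists each edge in
  one direction, so the conditions on \<open>p\<close> become finite checks. Since \<open>p\<close>
  is an involution, preserving edges forwards already gives the converse.\<close>

lemma involution_color_aut:
  assumes f: "bij_betw f {..<n} V" and R: "R \<subseteq> V \<times> V"
    and adj: "\<And>i j. i < n \<Longrightarrow> j < n \<Longrightarrow> (f i, f j) \<in> R \<longleftrightarrow> (i, j) \<in> E \<or> (j, i) \<in> E"
    and c: "edge_coloring k R c"
    and perm: "\<forall>i<n. p i < n \<and> p (p i) = i"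
    and edges: "\<forall>(i, j)\<in>E. ((p i, p j) \<in> E \<or> (p j, p i) \<in> E) \<and>
      c (f (p i)) (f (p j)) = c (f i) (f j)"
    and i0: "i0 < n" "p i0 \<noteq> i0"
  shows "\<exists>g. color_aut V R c g \<and> (\<exists>v\<in>V. g v \<noteq> v)"
proof -
  have p: "p i < n \<and> p (p i) = i" if "i < n" for i using perm that by blast
  have E: "((p i, p j) \<in> E \<or> (p j, p i) \<in> E) \<and> c (f (p i)) (f (p j)) = c (f i) (f j)"
    if "(i, j) \<in> E" for i j using edges that by blast
  define h where "h = inv_into {..<n} f"
  have inj: "inj_on f {..<n}" and img: "f ` {..<n} = V" using f by (auto simp: bij_betw_def)
  have hf: "h (f i) = i" if "i < n" for i using inj that by (simp add: h_def)
  have fh: "h v < n \<and> f (h v) = v" if "v \<in> V" for v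
    using that img hf by (metis imageE lessThan_iff)
  have fV: "f i \<in> V" if "i < n" for i using img that by auto
  let ?g = "\<lambda>v. f (p (h v))"
  have gV: "?g v \<in> V" if "v \<in> V" for v using fV fh[OF that] p by blast
  have gg: "?g (?g v) = v" if "v \<in> V" for v
    using fh[OF that] p hf by simp
  have pp: "(f (p i), f (p j)) \<in> R \<and> c (f (p i)) (f (p j)) = c (f i) (f j)"
    if i: "i < n" "j < n" and e: "(f i, f j) \<in> R" for i j
  proof -
    have "(i, j) \<in> E \<or> (j, i) \<in> E" using adj i e by simp
    then have e': "(f (p i), f (p j)) \<in> R"
      using adj[of "p i" "p j"] p i E[of i j] E[of j i] by blast
    have "c (f (p i)) (f (p j)) = c (f i) (f j)"
      using \<open>(i, j) \<in> E \<or> (j, i) \<in> E\<close>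
    proof
      assume "(j, i) \<in> E"
      then show ?thesis
        using E[of j i] edge_coloring_sym[OF c e] edge_coloring_sym[OF c e'] by simp
    qed (use E in blast)
    then show ?thesis using e' by simp
  qed
  have g: "(?g u, ?g v) \<in> R \<and> c (?g u) (?g v) = c u v" if "(u, v) \<in> R" for u v
  proof -
    have "u \<in> V" "v \<in> V" using that R by auto
    then show ?thesis using pp[of "h u" "h v"] fh that by simp
  qed
  have "bij_betw ?g V V"
    by (rule bij_betw_byWitness[of _ ?g]) (use gg gV in auto)
  moreover have "(?g u, ?g v) \<in> R \<longleftrightarrow> (u, v) \<in> R" if "u \<in> V" "v \<in> V" for u v
    using g[of u v] g[of "?g u" "?g v"] gg that by auto
  ultimately have "color_aut V R c ?g" using g by (simp add: color_aut_def graph_aut_def)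
  moreover have "?g (f i0) \<noteq> f i0"
    using hf[OF i0(1)] inj i0 p[OF i0(1)] by (simp add: inj_on_eq_iff)
  ultimately show ?thesis using fV[OF i0(1)] by blast
qed

lemma pigeonhole_distinct:
  assumes "distinct xs" "\<And>x. x \<in> set xs \<Longrightarrow> x < k" shows "length xs \<le> k"
proof -
  have "card (set xs) \<le> card {..<k}" using assms(2) by (intro card_mono) auto
  then show ?thesis using distinct_card[OF assms(1)] by simp
qed

lemma less_4: "i < 4 \<longleftrightarrow> i = 0 \<or> i = 1 \<or> i = 2 \<or> i = (3 :: nat)"
  and less_6: "i < 6 \<longleftrightarrow> i = 0 \<or> i = 1 \<or> i = 2 \<or> i = 3 \<or> i = 4 \<or> i = (5 :: nat)"
  by auto

lemma all_less_4: "(\<forall>i<4. P i) \<longleftrightarrow> P 0 \<and> P 1 \<and> P 2 \<and> P (3 :: nat)"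
  and all_less_6: "(\<forall>i<6. P i) \<longleftrightarrow> P 0 \<and> P 1 \<and> P 2 \<and> P 3 \<and> P 4 \<and> P (5 :: nat)"
  by (simp_all add: less_4 less_6 imp_disjL all_conj_distrib)

text \<open>Four edges share three colours, so two opposite edges agree. The reflection exchanging
  them inverts the other two edges.\<close>

lemma cycle_4_symmetric:
  assumes R: "R \<subseteq> V \<times> V" and cyc: "cycle_on 4 V R" and c: "edge_coloring 3 R c"
  shows "\<exists>g. color_aut V R c g \<and> (\<exists>v\<in>V. g v \<noteq> v)"
proof -
  obtain f where f: "bij_betw f {..<4} V"
    and adj: "\<And>i j. i < 4 \<Longrightarrow> j < 4 \<Longrightarrow> (f i, f j) \<in> R \<longleftrightarrow> j = Suc i mod 4 \<or> i = Suc j mod 4"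
    using cyc unfolding cycle_on_def by blast
  let ?E = "{(0, 1), (1, 2), (2, 3), (3, 0 :: nat)}"
  have E: "(f i, f j) \<in> R \<longleftrightarrow> (i, j) \<in> ?E \<or> (j, i) \<in> ?E" if "i < 4" "j < 4" for i j
    using adj[OF that] that unfolding less_4 by (elim disjE) simp_all
  have eR: "(f i, f j) \<in> R" if "(i, j) \<in> ?E" for i j using that E by auto
  have sym: "c (f j) (f i) = c (f i) (f j)" if "(i, j) \<in> ?E" for i j
    using edge_coloring_sym[OF c eR[OF that]] .
  have syms: "c (f 1) (f 0) = c (f 0) (f 1)" "c (f 2) (f 1) = c (f 1) (f 2)"
    "c (f 3) (f 2) = c (f 2) (f 3)" "c (f 0) (f 3) = c (f 3) (f 0)" by (rule sym; simp)+
  have ne: "f i \<noteq> f j" if "i < 4" "j < 4" "i \<noteq> j" for i j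
    using f that by (auto simp: bij_betw_def inj_on_def)
  have diff: "c (f i) (f j) \<noteq> c (f j) (f l)" if "(i, j) \<in> ?E" "(j, l) \<in> ?E" "i \<noteq> l" for i j l
  proof
    assume "c (f i) (f j) = c (f j) (f l)"
    moreover have "(f j, f i) \<in> R" using that E by auto
    ultimately have "f i = f l" using edge_coloring_inj[OF c _ eR[OF that(2)]] sym[OF that(1)] by simp
    then show False using ne[of i l] that by auto
  qed
  have diffs: "c (f 0) (f 1) \<noteq> c (f 1) (f 2)" "c (f 1) (f 2) \<noteq> c (f 2) (f 3)"
    "c (f 2) (f 3) \<noteq> c (f 3) (f 0)" "c (f 3) (f 0) \<noteq> c (f 0) (f 1)" by (rule diff; simp)+
  have less: "c (f i) (f j) < 3" if "(i, j) \<in> ?E" for i j using edge_coloring_less[OF c eR[OF that]] .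
  consider "c (f 0) (f 1) = c (f 2) (f 3)" | "c (f 1) (f 2) = c (f 3) (f 0)"
    using pigeonhole_distinct[of "[c (f 0) (f 1), c (f 1) (f 2), c (f 2) (f 3), c (f 3) (f 0)]" 3]
      diffs less by fastforce
  then show ?thesis
  proof cases
    case 1
    show ?thesis
      by (rule involution_color_aut[OF f R E c, where p = "\<lambda>i. [3, 2, 1, 0] ! i" and ?i0.0 = 0])
        (simp_all add: all_less_4 1[unfolded One_nat_def] syms[unfolded One_nat_def])
  next
    case 2
    show ?thesis
      by (rule involution_color_aut[OF f R E c, where p = "\<lambda>i. [1, 0, 3, 2] ! i" and ?i0.0 = 0])
        (simp_all add: all_less_4 2[unfolded One_nat_def] syms[unfolded One_nat_def])
  qed
qed

text \<open>The colours around a hexagon, with \<open>e\<close> the third colour besides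
  \<open>x0\<close> and \<open>x1\<close>. The alternatives are the three reflections in axes
  through opposite edges and the half turn.\<close>

lemma three_symbols_hexagon:
  fixes x0 x1 x2 x3 x4 x5 e :: 'a
  assumes "x2 = x0 \<or> x2 = e" "x5 = x1 \<or> x5 = e" "x3 = x0 \<or> x3 = x1 \<or> x3 = e"
    "x4 = x0 \<or> x4 = x1 \<or> x4 = e" "x0 \<noteq> x1" "x0 \<noteq> e" "x1 \<noteq> e"
    "x2 \<noteq> x3" "x3 \<noteq> x4" "x4 \<noteq> x5"
  shows "(x1 = x5 \<and> x2 = x4) \<or> (x2 = x0 \<and> x3 = x5) \<or> (x3 = x1 \<and> x4 = x0) \<or>
    (x0 = x3 \<and> x1 = x4 \<and> x2 = x5)"
  using assms by (elim disjE) simp_all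

lemma ex_last_element:
  assumes "finite S" "finite A" "card S = Suc (card A)" "A \<subseteq> S"
  shows "\<exists>e. e \<notin> A \<and> S = insert e A"
proof -
  have "card (S - A) = 1" using assms by (simp add: card_Diff_subset)
  then obtain e where "S - A = {e}" by (auto simp: card_1_singleton_iff)
  then show ?thesis using assms(4) by blast
qed

lemma cycle_6_symmetric:
  assumes R: "R \<subseteq> V \<times> V" and cyc: "cycle_on 6 V R" and c: "edge_coloring 3 R c"
  shows "\<exists>g. color_aut V R c g \<and> (\<exists>v\<in>V. g v \<noteq> v)"
proof -
  obtain f where f: "bij_betw f {..<6} V"
    and adj: "\<And>i j. i < 6 \<Longrightarrow> j < 6 \<Longrightarrow> (f i, f j) \<in> R \<longleftrightarrow> j = Suc i mod 6 \<or> i = Suc j mod 6"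
    using cyc unfolding cycle_on_def by blast
  let ?E = "{(0, 1), (1, 2), (2, 3), (3, 4), (4, 5), (5, 0 :: nat)}"
  have E: "(f i, f j) \<in> R \<longleftrightarrow> (i, j) \<in> ?E \<or> (j, i) \<in> ?E" if "i < 6" "j < 6" for i j
    using adj[OF that] that unfolding less_6 by (elim disjE) simp_all
  have eR: "(f i, f j) \<in> R" if "(i, j) \<in> ?E" for i j using that E by auto
  have sym: "c (f j) (f i) = c (f i) (f j)" if "(i, j) \<in> ?E" for i j
    using edge_coloring_sym[OF c eR[OF that]] .
  have syms: "c (f 1) (f 0) = c (f 0) (f 1)" "c (f 2) (f 1) = c (f 1) (f 2)"
    "c (f 3) (f 2) = c (f 2) (f 3)" "c (f 4) (f 3) = c (f 3) (f 4)"
    "c (f 5) (f 4) = c (f 4) (f 5)" "c (f 0) (f 5) = c (f 5) (f 0)" by (rule sym; simp)+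
  have ne: "f i \<noteq> f j" if "i < 6" "j < 6" "i \<noteq> j" for i j
    using f that by (auto simp: bij_betw_def inj_on_def)
  have diff: "c (f i) (f j) \<noteq> c (f j) (f l)" if "(i, j) \<in> ?E" "(j, l) \<in> ?E" "i \<noteq> l" for i j l
  proof
    assume "c (f i) (f j) = c (f j) (f l)"
    moreover have "(f j, f i) \<in> R" using that E by auto
    ultimately have "f i = f l" using edge_coloring_inj[OF c _ eR[OF that(2)]] sym[OF that(1)] by simp
    then show False using ne[of i l] that by auto
  qed
  define x0 x1 x2 x3 x4 x5 where x_def: "x0 = c (f 0) (f 1)" "x1 = c (f 1) (f 2)" "x2 = c (f 2) (f 3)"
    "x3 = c (f 3) (f 4)" "x4 = c (f 4) (f 5)" "x5 = c (f 5) (f 0)"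
  have diffs: "x0 \<noteq> x1" "x1 \<noteq> x2" "x2 \<noteq> x3" "x3 \<noteq> x4" "x4 \<noteq> x5" "x5 \<noteq> x0"
    unfolding x_def by (rule diff; simp)+
  have less: "c (f i) (f j) < 3" if "(i, j) \<in> ?E" for i j using edge_coloring_less[OF c eR[OF that]] .
  have x: "x0 < 3" "x1 < 3" "x2 < 3" "x3 < 3" "x4 < 3" "x5 < 3" unfolding x_def by (rule less; simp)+
  have "{x0, x1} \<subseteq> {..<3}" using x by auto
  then obtain e where e: "e \<notin> {x0, x1}" "{..<3} = insert e {x0, x1}"
    using ex_last_element[of "{..<3}" "{x0, x1}"] diffs(1) by auto
  have cases: "y = x0 \<or> y = x1 \<or> y = e" if "y < 3" for y
    using that e(2) by (metis empty_iff insert_iff lessThan_iff)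
  have "x2 = x0 \<or> x2 = e" "x5 = x1 \<or> x5 = e" "x0 \<noteq> e" "x1 \<noteq> e"
    using cases[OF x(3)] cases[OF x(6)] diffs e(1) by auto
  then consider "x1 = x5" "x2 = x4" | "x2 = x0" "x3 = x5" | "x3 = x1" "x4 = x0"
    | "x0 = x3" "x1 = x4" "x2 = x5"
    using three_symbols_hexagon[OF _ _ cases[OF x(4)] cases[OF x(5)] diffs(1) _ _ diffs(3-5)] by blast
  then show ?thesis
  proof cases
    case 1
    show ?thesis
      by (rule involution_color_aut[OF f R E c, where p = "\<lambda>i. [1, 0, 5, 4, 3, 2] ! i" and ?i0.0 = 0])
        (simp_all add: all_less_6 1[unfolded x_def One_nat_def] syms[unfolded One_nat_def])
  next
    case 2
    show ?thesis
      by (rule involution_color_aut[OF f R E c, where p = "\<lambda>i. [3, 2, 1, 0, 5, 4] ! i" and ?i0.0 = 0])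
        (simp_all add: all_less_6 2[unfolded x_def One_nat_def] syms[unfolded One_nat_def])
  next
    case 3
    show ?thesis
      by (rule involution_color_aut[OF f R E c, where p = "\<lambda>i. [5, 4, 3, 2, 1, 0] ! i" and ?i0.0 = 0])
        (simp_all add: all_less_6 3[unfolded x_def One_nat_def] syms[unfolded One_nat_def])
  next
    case 4
    show ?thesis
      by (rule involution_color_aut[OF f R E c, where p = "\<lambda>i. [3, 4, 5, 0, 1, 2] ! i" and ?i0.0 = 0])
        (simp_all add: all_less_6 4[unfolded x_def One_nat_def] syms[unfolded One_nat_def])
  qed
qed

text \<open>The pairs \<open>a a'\<close>, \<open>b b'\<close>, \<open>e e'\<close> are the three
  perfect matchings, and edges of different pairs meet. Two pairs with unequal colours and an edge
  of the third would need five colours, so two pairs are monochromatic; the involution exchanging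
  the edges within each of them inverts the edges of the third.\<close>

lemma complete_4_symmetric:
  fixes V :: "'a set"
  assumes V: "card V = 4" and com: "complete_on V R" and c: "edge_coloring 4 R c"
  shows "\<exists>g. color_aut V R c g \<and> (\<exists>v\<in>V. g v \<noteq> v)"
proof -
  have R: "R \<subseteq> V \<times> V" using com by (auto simp: complete_on_def)
  have "finite V" using V by (metis card.infinite zero_neq_numeral)
  then obtain f :: "nat \<Rightarrow> 'a" where f: "bij_betw f {..<4} V"
    using ex_bij_betw_nat_finite[of V] V by (auto simp: atLeast0LessThan)
  have ne: "f i = f j \<longleftrightarrow> i = j" if "i < 4" "j < 4" for i j
    using f that by (auto simp: bij_betw_def inj_on_def)
  have fV: "f i \<in> V" if "i < 4" for i using f that by (auto simp: bij_betw_def)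
  have adj: "(f i, f j) \<in> R \<longleftrightarrow> i \<noteq> j" if "i < 4" "j < 4" for i j
    using com fV[OF that(1)] fV[OF that(2)] ne[OF that] by (simp add: complete_on_def)
  let ?E = "{(0, 1), (0, 2), (0, 3), (1, 2), (1, 3), (2, 3 :: nat)}"
  have E: "(f i, f j) \<in> R \<longleftrightarrow> (i, j) \<in> ?E \<or> (j, i) \<in> ?E" if "i < 4" "j < 4" for i j
    using adj[OF that] that unfolding less_4 by (elim disjE) simp_all
  have sym: "c (f j) (f i) = c (f i) (f j)" if "i < 4" "j < 4" for i j
    using edge_coloring_sym[OF c, of "f i" "f j"] adj[OF that] by (cases "i = j") auto
  have syms: "c (f 1) (f 0) = c (f 0) (f 1)" "c (f 2) (f 0) = c (f 0) (f 2)"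
    "c (f 3) (f 0) = c (f 0) (f 3)" "c (f 2) (f 1) = c (f 1) (f 2)"
    "c (f 3) (f 1) = c (f 1) (f 3)" "c (f 3) (f 2) = c (f 2) (f 3)" by (rule sym; simp)+
  have diff: "c (f i) (f j) \<noteq> c (f i) (f l)" if "i < 4" "j < 4" "l < 4" "i \<noteq> j" "i \<noteq> l" "j \<noteq> l" for i j l
    using edge_coloring_inj[OF c, of "f i" "f j" "f l"] adj ne that by auto
  define a a' b b' e e' where x_def: "a = c (f 0) (f 1)" "a' = c (f 2) (f 3)"
    "b = c (f 0) (f 2)" "b' = c (f 1) (f 3)" "e = c (f 0) (f 3)" "e' = c (f 1) (f 2)"
  have diffs: "a \<noteq> b" "a \<noteq> b'" "a \<noteq> e" "a \<noteq> e'" "a' \<noteq> b" "a' \<noteq> b'" "a' \<noteq> e" "a' \<noteq> e'"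
    "b \<noteq> e" "b \<noteq> e'" "b' \<noteq> e" "b' \<noteq> e'"
    unfolding x_def
    using diff[of 0 1 2] diff[of 1 0 3] diff[of 0 1 3] diff[of 1 0 2] diff[of 2 3 0] diff[of 3 2 1]
      diff[of 3 2 0] diff[of 2 3 1] diff[of 0 2 3] diff[of 2 0 1] diff[of 3 1 0] diff[of 1 3 2]
    by (simp_all add: syms[unfolded One_nat_def])
  have less: "c (f i) (f j) < 4" if "i < 4" "j < 4" "i \<noteq> j" for i j
    using edge_coloring_less[OF c] adj that by blast
  have x: "a < 4" "a' < 4" "b < 4" "b' < 4" "e < 4" "e' < 4" unfolding x_def by (rule less; simp)+
  consider "a = a'" "b = b'" | "a = a'" "e = e'" | "b = b'" "e = e'"
  proof -
    have "\<not> (a \<noteq> a' \<and> b \<noteq> b')" using pigeonhole_distinct[of "[a, a', b, b', e]" 4] diffs x by auto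
    moreover have "\<not> (a \<noteq> a' \<and> e \<noteq> e')" using pigeonhole_distinct[of "[a, a', e, e', b]" 4] diffs x by auto
    moreover have "\<not> (b \<noteq> b' \<and> e \<noteq> e')" using pigeonhole_distinct[of "[b, b', e, e', a]" 4] diffs x by auto
    ultimately show thesis using that by blast
  qed
  then show ?thesis
  proof cases
    case 1
    show ?thesis
      by (rule involution_color_aut[OF f R E c, where p = "\<lambda>i. [3, 2, 1, 0] ! i" and ?i0.0 = 0])
        (simp_all add: all_less_4 1[unfolded x_def One_nat_def] syms[unfolded One_nat_def])
  next
    case 2
    show ?thesis
      by (rule involution_color_aut[OF f R E c, where p = "\<lambda>i. [2, 3, 0, 1] ! i" and ?i0.0 = 0])
        (simp_all add: all_less_4 2[unfolded x_def One_nat_def] syms[unfolded One_nat_def])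
  next
    case 3
    show ?thesis
      by (rule involution_color_aut[OF f R E c, where p = "\<lambda>i. [1, 0, 3, 2] ! i" and ?i0.0 = 0])
        (simp_all add: all_less_4 3[unfolded x_def One_nat_def] syms[unfolded One_nat_def])
  qed
qed

text \<open>These are the eleven rows that can stand below the row \<open>x y z\<close> in a proper
  array on the symbols \<open>x\<close>, \<open>y\<close>, \<open>z\<close>,
  \<open>e\<close>.\<close>

lemma latin_row_cases:
  fixes x y z e u0 u1 u2 :: 'a
  assumes "u0 = y \<or> u0 = z \<or> u0 = e" "u1 = x \<or> u1 = z \<or> u1 = e" "u2 = x \<or> u2 = y \<or> u2 = e"
    and "u0 \<noteq> u1" "u0 \<noteq> u2" "u1 \<noteq> u2"
  shows "(u0, u1, u2) \<in> {(y, x, e), (y, z, x), (y, z, e), (y, e, x), (z, x, y), (z, x, e), (z, e, x),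
    (z, e, y), (e, x, y), (e, z, x), (e, z, y)}"
  using assms by (elim disjE) simp_all

text \<open>
  The columns of a proper \<open>3 \<times> 3\<close> array on four symbols with first row \<open>x y z\<close> can be permuted
  so that it becomes symmetric.
\<close>

lemma latin_array_symmetrizable:
  fixes x y z e :: 'a
  assumes ne: "x \<noteq> y" "x \<noteq> z" "y \<noteq> z" "x \<noteq> e" "y \<noteq> e" "z \<noteq> e"
  defines "T \<equiv> {(y, x, e), (y, z, x), (y, z, e), (y, e, x), (z, x, y), (z, x, e), (z, e, x),
    (z, e, y), (e, x, y), (e, z, x), (e, z, y)}"
  shows "\<forall>(u0, u1, u2)\<in>T. \<forall>(w0, w1, w2)\<in>T. w0 \<noteq> u0 \<longrightarrow> w1 \<noteq> u1 \<longrightarrow> w2 \<noteq> u2 \<longrightarrow>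
    (y = u0 \<and> z = w0 \<and> u2 = w1) \<or> (y = w0 \<and> z = u0 \<and> u1 = w2) \<or>
    (x = u1 \<and> z = w1 \<and> u2 = w0) \<or> (z = u1 \<and> x = w1 \<and> u0 = w2) \<or>
    (x = u2 \<and> y = w2 \<and> u1 = w0) \<or> (y = u2 \<and> x = w2 \<and> u0 = w1)"
  unfolding T_def by (simp add: ne ne[symmetric])

text \<open>The colours form an array with rows indexed by \<open>A\<close> and columns by
  \<open>B\<close>. If permuting the columns makes it symmetric, then exchanging each row vertex
  with the corresponding column vertex preserves all colours; the six alternatives are the six
  permutations.\<close>

lemma bipartite_3_3_symmetric:
  fixes V :: "'a set"
  assumes bip: "bipartite_on 3 3 V R" and c: "edge_coloring 4 R c"
  shows "\<exists>g. color_aut V R c g \<and> (\<exists>v\<in>V. g v \<noteq> v)"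
proof -
  obtain A B where V: "V = A \<union> B" "A \<inter> B = {}" "card A = 3" "card B = 3" and RAB: "R = A \<times> B \<union> B \<times> A"
    using bip unfolding bipartite_on_def by blast
  have R: "R \<subseteq> V \<times> V" using RAB V by auto
  have fin: "finite A" "finite B" using V(3,4) by (metis card.infinite zero_neq_numeral)+
  obtain fa :: "nat \<Rightarrow> 'a" where fa: "bij_betw fa {..<3} A"
    using ex_bij_betw_nat_finite[OF fin(1)] V by (auto simp: atLeast0LessThan)
  obtain fb :: "nat \<Rightarrow> 'a" where fb: "bij_betw fb {..<3} B"
    using ex_bij_betw_nat_finite[OF fin(2)] V by (auto simp: atLeast0LessThan)
  define f where "f = (\<lambda>i. if i < 3 then fa i else fb (i - 3))"
  have fA: "f i \<in> A" if "i < 3" for i using fa that by (auto simp: f_def bij_betw_def)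
  have fB: "f i \<in> B" if "3 \<le> i" "i < 6" for i
    using fb that by (auto simp: f_def bij_betw_def)
  have "bij_betw f {..<3} A" using fa by (rule bij_betw_cong[THEN iffD1, rotated]) (simp add: f_def)
  moreover have "bij_betw f {3..<6} B"
  proof -
    have "bij_betw (\<lambda>i. i - 3) {3..<6} {..<3 :: nat}"
      by (rule bij_betw_byWitness[of _ "\<lambda>i. i + 3"]) auto
    from bij_betw_trans[OF this fb] show ?thesis
      by (rule bij_betw_cong[THEN iffD1, rotated]) (simp add: f_def)
  qed
  ultimately have "bij_betw f ({..<3} \<union> {3..<6}) (A \<union> B)" using V(2) by (rule bij_betw_combine)
  moreover have "{..<3} \<union> {3..<6} = {..<6 :: nat}" by auto
  ultimately have f: "bij_betw f {..<6} V" using V(1) by simp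
  have ne: "f i = f j \<longleftrightarrow> i = j" if "i < 6" "j < 6" for i j
    using f that by (auto simp: bij_betw_def inj_on_def)
  have adj: "(f i, f j) \<in> R \<longleftrightarrow> (i < 3 \<longleftrightarrow> 3 \<le> j)" if "i < 6" "j < 6" for i j
  proof -
    have "f i \<in> A \<longleftrightarrow> i < 3" "f i \<in> B \<longleftrightarrow> 3 \<le> i" if "i < 6" for i
      using fA[of i] fB[of i] V(2) that by (cases "i < 3"; auto)+
    then show ?thesis using that RAB by auto
  qed
  let ?E = "{(0, 3), (0, 4), (0, 5), (1, 3), (1, 4), (1, 5), (2, 3), (2, 4), (2, 5 :: nat)}"
  have E: "(f i, f j) \<in> R \<longleftrightarrow> (i, j) \<in> ?E \<or> (j, i) \<in> ?E" if "i < 6" "j < 6" for i j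
    using adj[OF that] that unfolding less_6 by (elim disjE) simp_all
  have sym: "c (f j) (f i) = c (f i) (f j)" if "i < 3" "3 \<le> j" "j < 6" for i j
    using edge_coloring_sym[OF c, of "f i" "f j"] adj[of i j] that by simp
  have syms: "c (f 3) (f 0) = c (f 0) (f 3)" "c (f 4) (f 0) = c (f 0) (f 4)" "c (f 5) (f 0) = c (f 0) (f 5)"
    "c (f 3) (f 1) = c (f 1) (f 3)" "c (f 4) (f 1) = c (f 1) (f 4)" "c (f 5) (f 1) = c (f 1) (f 5)"
    "c (f 3) (f 2) = c (f 2) (f 3)" "c (f 4) (f 2) = c (f 2) (f 4)" "c (f 5) (f 2) = c (f 2) (f 5)"
    by (rule sym; simp)+
  have row: "c (f i) (f j) \<noteq> c (f i) (f l)" if "i < 3" "3 \<le> j" "j < 6" "3 \<le> l" "l < 6" "j \<noteq> l" for i j l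
    using edge_coloring_inj[OF c, of "f i" "f j" "f l"] adj[of i j] adj[of i l] ne that by auto
  have col: "c (f i) (f j) \<noteq> c (f l) (f j)" if "i < 3" "l < 3" "3 \<le> j" "j < 6" "i \<noteq> l" for i j l
    using edge_coloring_inj[OF c, of "f j" "f i" "f l"] adj[of j i] adj[of j l] ne[of i l] sym[of i j] sym[of l j] that
    by auto
  have less: "c (f i) (f j) < 4" if "i < 3" "3 \<le> j" "j < 6" for i j
    using edge_coloring_less[OF c] adj that by simp
  define x y z where x_def: "x = c (f 0) (f 3)" "y = c (f 0) (f 4)" "z = c (f 0) (f 5)"
  define u0 u1 u2 where u_def: "u0 = c (f 1) (f 3)" "u1 = c (f 1) (f 4)" "u2 = c (f 1) (f 5)"
  define w0 w1 w2 where w_def: "w0 = c (f 2) (f 3)" "w1 = c (f 2) (f 4)" "w2 = c (f 2) (f 5)"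
  note defs = x_def u_def w_def
  have rows: "x \<noteq> y" "x \<noteq> z" "y \<noteq> z" "u0 \<noteq> u1" "u0 \<noteq> u2" "u1 \<noteq> u2" "w0 \<noteq> w1" "w0 \<noteq> w2" "w1 \<noteq> w2"
    unfolding defs by (rule row; simp)+
  have cols: "u0 \<noteq> x" "u1 \<noteq> y" "u2 \<noteq> z" "w0 \<noteq> x" "w1 \<noteq> y" "w2 \<noteq> z" "w0 \<noteq> u0" "w1 \<noteq> u1" "w2 \<noteq> u2"
    unfolding defs by (rule col; simp)+
  have lt: "x < 4" "y < 4" "z < 4" "u0 < 4" "u1 < 4" "u2 < 4" "w0 < 4" "w1 < 4" "w2 < 4"
    unfolding defs by (rule less; simp)+
  have "{x, y, z} \<subseteq> {..<4}" using lt by auto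
  then obtain e where e: "e \<notin> {x, y, z}" "{..<4} = insert e {x, y, z}"
    using ex_last_element[of "{..<4}" "{x, y, z}"] rows(1-3) by auto
  have cases: "t = x \<or> t = y \<or> t = z \<or> t = e" if "t < 4" for t
    using that e(2) by (metis empty_iff insert_iff lessThan_iff)
  have d: "x \<noteq> e" "y \<noteq> e" "z \<noteq> e" using e by auto
  have u: "u0 = y \<or> u0 = z \<or> u0 = e" "u1 = x \<or> u1 = z \<or> u1 = e" "u2 = x \<or> u2 = y \<or> u2 = e"
    using cases[OF lt(4)] cases[OF lt(5)] cases[OF lt(6)] cols(1-3) by blast+
  have w: "w0 = y \<or> w0 = z \<or> w0 = e" "w1 = x \<or> w1 = z \<or> w1 = e" "w2 = x \<or> w2 = y \<or> w2 = e"
    using cases[OF lt(7)] cases[OF lt(8)] cases[OF lt(9)] cols(4-6) by blast+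
  have "(y = u0 \<and> z = w0 \<and> u2 = w1) \<or> (y = w0 \<and> z = u0 \<and> u1 = w2) \<or>
    (x = u1 \<and> z = w1 \<and> u2 = w0) \<or> (z = u1 \<and> x = w1 \<and> u0 = w2) \<or>
    (x = u2 \<and> y = w2 \<and> u1 = w0) \<or> (y = u2 \<and> x = w2 \<and> u0 = w1)"
    using bspec[OF latin_array_symmetrizable[OF rows(1-3) d] latin_row_cases[OF u rows(4-6)],
        unfolded prod.case, THEN bspec, OF latin_row_cases[OF w rows(7-9)]] cols(7-9)
    by (simp only: prod.case simp_thms)
  then consider "y = u0" "z = w0" "u2 = w1" | "y = w0" "z = u0" "u1 = w2" | "x = u1" "z = w1" "u2 = w0"
    | "z = u1" "x = w1" "u0 = w2" | "x = u2" "y = w2" "u1 = w0" | "y = u2" "x = w2" "u0 = w1"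
    by blast
  then show ?thesis
  proof cases
    case 1
    show ?thesis
      by (rule involution_color_aut[OF f R E c, where p = "\<lambda>i. [3, 4, 5, 0, 1, 2] ! i" and ?i0.0 = 0])
        (simp_all add: all_less_6 1[unfolded defs One_nat_def] syms[unfolded One_nat_def])
  next
    case 2
    show ?thesis
      by (rule involution_color_aut[OF f R E c, where p = "\<lambda>i. [3, 5, 4, 0, 2, 1] ! i" and ?i0.0 = 0])
        (simp_all add: all_less_6 2[unfolded defs One_nat_def] syms[unfolded One_nat_def])
  next
    case 3
    show ?thesis
      by (rule involution_color_aut[OF f R E c, where p = "\<lambda>i. [4, 3, 5, 1, 0, 2] ! i" and ?i0.0 = 0])
        (simp_all add: all_less_6 3[unfolded defs One_nat_def] syms[unfolded One_nat_def])
  next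
    case 4
    show ?thesis
      by (rule involution_color_aut[OF f R E c, where p = "\<lambda>i. [4, 5, 3, 2, 0, 1] ! i" and ?i0.0 = 0])
        (simp_all add: all_less_6 4[unfolded defs One_nat_def] syms[unfolded One_nat_def])
  next
    case 5
    show ?thesis
      by (rule involution_color_aut[OF f R E c, where p = "\<lambda>i. [5, 3, 4, 1, 2, 0] ! i" and ?i0.0 = 0])
        (simp_all add: all_less_6 5[unfolded defs One_nat_def] syms[unfolded One_nat_def])
  next
    case 6
    show ?thesis
      by (rule involution_color_aut[OF f R E c, where p = "\<lambda>i. [5, 4, 3, 2, 1, 0] ! i" and ?i0.0 = 0])
        (simp_all add: all_less_6 6[unfolded defs One_nat_def] syms[unfolded One_nat_def])
  qed
qed

section \<open>Middle graphs\<close>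

text \<open>A proper distinguishing colouring of the middle graph, read on the graph itself.
  Original vertices are pairwise non-adjacent in the middle graph, so \<open>h\<close> is not
  constrained between neighbours.\<close>

definition dist_total_colorable :: "'a set \<Rightarrow> ('a \<times> 'a) set \<Rightarrow> nat \<Rightarrow> bool" where
  "dist_total_colorable V R k \<longleftrightarrow> (\<exists>c h. edge_coloring k R c \<and>
     (\<forall>v\<in>V. h v < k \<and> misses R c v (h v)) \<and>
     (\<forall>g. color_aut V R c g \<longrightarrow> (\<forall>v\<in>V. h (g v) = h v) \<longrightarrow> (\<forall>v\<in>V. g v = v)))"

lemma pverts_middle: "pverts (middle_graph G) = pverts G <+> uedges G"
  by (simp add: middle_graph_def)

lemma verts_middle [simp]:
  "Inl v \<in> pverts (middle_graph G) \<longleftrightarrow> v \<in> pverts G"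
  "Inr e \<in> pverts (middle_graph G) \<longleftrightarrow> e \<in> uedges G"
  by (auto simp: pverts_middle)

lemma arcs_middle [simp]:
  "(Inl v, Inl w) \<notin> parcs (middle_graph G)"
  "(Inl v, Inr e) \<in> parcs (middle_graph G) \<longleftrightarrow> v \<in> pverts G \<and> e \<in> uedges G \<and> v \<in> e"
  "(Inr e, Inl v) \<in> parcs (middle_graph G) \<longleftrightarrow> v \<in> pverts G \<and> e \<in> uedges G \<and> v \<in> e"
  "(Inr e, Inr f) \<in> parcs (middle_graph G) \<longleftrightarrow>
     e \<in> uedges G \<and> f \<in> uedges G \<and> e \<noteq> f \<and> e \<inter> f \<noteq> {}"
  by (auto simp: middle_graph_def)

locale pair_simple_graph =
  fixes G :: "'a pair_pre_digraph"
  assumes G: "pair_graph G"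
begin

abbreviation "V \<equiv> pverts G"
abbreviation "R \<equiv> parcs G"
abbreviation "M \<equiv> middle_graph G"

sublocale pair_graph G by (rule G)

sublocale S: simple_graph V R
proof
  show "sym R" using sym_arcs by (simp add: symmetric_def)
  show "irrefl R" using no_loops' by (auto simp: irrefl_def)
qed (use pair_finite_verts in_arcsD1 in_arcsD2 in auto)

lemma uedge_iff: "{u, v} \<in> uedges G \<longleftrightarrow> (u, v) \<in> R"
  using S.edge_sym by (auto simp: uedges_def doubleton_eq_iff)

lemma uedgeE:
  assumes "e \<in> uedges G"
  obtains u v where "e = {u, v}" "(u, v) \<in> R" "u \<noteq> v" "u \<in> V" "v \<in> V"
  using assms S.edge_ne S.edge_in unfolding uedges_def by blast

lemma uedge_at:
  assumes "e \<in> uedges G" "v \<in> e"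
  shows "\<exists>w. e = {v, w} \<and> (v, w) \<in> R"
  using assms(1)
proof (rule uedgeE)
  fix s t assume "e = {s, t}" "(s, t) \<in> R"
  then show ?thesis using assms(2) S.edge_sym by auto
qed

lemma degree_eq: "out_degree (with_proj G) v = card (R `` {v})"
proof -
  have "out_arcs (with_proj G) v = Pair v ` (R `` {v})" by (auto simp: out_arcs_def)
  then show ?thesis by (simp add: out_degree_def card_image inj_on_def)
qed

lemma degree_le_max: "v \<in> V \<Longrightarrow> card (R `` {v}) \<le> max_degree G"
  unfolding max_degree_def degree_eq using pair_finite_verts by (intro Max_ge) auto

lemma ex_max_degree: "V \<noteq> {} \<Longrightarrow> \<exists>v\<in>V. card (R `` {v}) = max_degree G"
  using Max_in[of "out_degree (with_proj G) ` V"] pair_finite_verts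
  unfolding max_degree_def degree_eq by fastforce

text \<open>
  The neighbourhood of an original vertex in the middle graph is a clique, while the two ends of an
  edge are not adjacent.
\<close>

lemma middle_automorphism:
  assumes \<psi>: "automorphism M \<psi>"
  obtains g where "graph_aut V R g" "\<And>v. v \<in> V \<Longrightarrow> \<psi> (Inl v) = Inl (g v)"
    "\<And>u v. (u, v) \<in> R \<Longrightarrow> \<psi> (Inr {u, v}) = Inr {g u, g v}"
proof -
  have bij: "bij_betw \<psi> (pverts M) (pverts M)"
    and adj: "\<And>x y. x \<in> pverts M \<Longrightarrow> y \<in> pverts M \<Longrightarrow> (\<psi> x, \<psi> y) \<in> parcs M \<longleftrightarrow> (x, y) \<in> parcs M"
    using \<psi> by (auto simp: automorphism_def)
  have inM: "Inl v \<in> pverts M \<longleftrightarrow> v \<in> V" "Inr e \<in> pverts M \<longleftrightarrow> e \<in> uedges G" for v e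
    by auto
  have inj: "\<psi> x = \<psi> y \<longleftrightarrow> x = y" if "x \<in> pverts M" "y \<in> pverts M" for x y
    using bij that by (auto simp: bij_betw_def inj_on_eq_iff)
  have mem: "\<psi> x \<in> pverts M" if "x \<in> pverts M" for x using bij that by (auto simp: bij_betw_def)
  have surj: "\<exists>x\<in>pverts M. y = \<psi> x" if "y \<in> pverts M" for y
    using bij that by (auto simp: bij_betw_def)
  have clique: "(x, y) \<in> parcs M"
    if "(Inl v, x) \<in> parcs M" "(Inl v, y) \<in> parcs M" "x \<noteq> y" for v x y
    using that by (cases x; cases y) auto
  have "\<exists>w\<in>V. \<psi> (Inl v) = Inl w" if v: "v \<in> V" for v
  proof (cases "\<psi> (Inl v)")
    case (Inl w)
    then show ?thesis using mem[of "Inl v"] inM v by auto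
  next
    case (Inr e)
    then have "e \<in> uedges G" using mem[of "Inl v"] inM v by auto
    then obtain s t where st: "e = {s, t}" "(s, t) \<in> R" "s \<noteq> t" "s \<in> V" "t \<in> V" by (rule uedgeE)
    obtain x y where x: "x \<in> pverts M" "Inl s = \<psi> x" and y: "y \<in> pverts M" "Inl t = \<psi> y"
      using surj inM st by metis
    have "(\<psi> (Inl v), \<psi> x) \<in> parcs M" "(\<psi> (Inl v), \<psi> y) \<in> parcs M"
      unfolding x(2)[symmetric] y(2)[symmetric] using Inr st \<open>e \<in> uedges G\<close> by auto
    then have "(Inl v, x) \<in> parcs M" "(Inl v, y) \<in> parcs M" using adj x y v inM by blast+
    moreover have "x \<noteq> y" using x y st(3) by (metis sum.inject(1))
    ultimately have "(\<psi> x, \<psi> y) \<in> parcs M" using clique adj x y by blast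
    then show ?thesis using x y by (metis arcs_middle(1))
  qed
  then obtain g where g: "\<And>v. v \<in> V \<Longrightarrow> g v \<in> V \<and> \<psi> (Inl v) = Inl (g v)" by metis
  have ginj: "g u = g v \<longleftrightarrow> u = v" if "u \<in> V" "v \<in> V" for u v
    using g that inj[of "Inl u" "Inl v"] inM by auto
  have gedge: "\<psi> (Inr {u, v}) = Inr {g u, g v}" if uv: "(u, v) \<in> R" for u v
  proof -
    have V: "u \<in> V" "v \<in> V" "u \<noteq> v" using S.edge_in[OF uv] S.edge_ne[OF uv] by auto
    have e: "{u, v} \<in> uedges G" using uedge_iff uv by simp
    have a: "(Inl (g u), \<psi> (Inr {u, v})) \<in> parcs M" "(Inl (g v), \<psi> (Inr {u, v})) \<in> parcs M"
      using adj[of "Inl u" "Inr {u, v}"] adj[of "Inl v" "Inr {u, v}"] g V e inM by auto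
    then obtain e' where e': "\<psi> (Inr {u, v}) = Inr e'"
      by (cases "\<psi> (Inr {u, v})") auto
    then have "e' \<in> uedges G" "g u \<in> e'" "g v \<in> e'" using a by auto
    moreover from this(1) obtain s t where "e' = {s, t}" by (rule uedgeE)
    moreover have "g u \<noteq> g v" using ginj V by simp
    ultimately show ?thesis using e' by auto
  qed
  have "bij_betw g V V"
  proof -
    have inj: "inj_on g V" using ginj by (auto intro: inj_onI)
    have "g ` V \<subseteq> V" using g by auto
    then have "g ` V = V" using endo_inj_surj[OF pair_finite_verts _ inj] by blast
    then show ?thesis using inj by (simp add: bij_betw_def)
  qed
  moreover have "(g u, g v) \<in> R \<longleftrightarrow> (u, v) \<in> R" if V: "u \<in> V" "v \<in> V" for u v
  proof
    assume "(u, v) \<in> R"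
    then have "\<psi> (Inr {u, v}) = Inr {g u, g v}" "Inr {u, v} \<in> pverts M"
      using gedge inM uedge_iff by auto
    then show "(g u, g v) \<in> R" using mem inM uedge_iff by metis
  next
    assume "(g u, g v) \<in> R"
    then have "Inr {g u, g v} \<in> pverts M" using inM uedge_iff by simp
    then obtain x where x: "x \<in> pverts M" "Inr {g u, g v} = \<psi> x" using surj by blast
    then obtain e where e: "x = Inr e" "e \<in> uedges G"
      using g inM by (cases x) auto
    obtain s t where st: "e = {s, t}" "(s, t) \<in> R" "s \<in> V" "t \<in> V" using uedgeE[OF e(2)] by metis
    then have "{g u, g v} = {g s, g t}" using gedge[OF st(2)] x e by simp
    then have "{u, v} = {s, t}" using ginj V st by (auto simp: doubleton_eq_iff)
    then show "(u, v) \<in> R" using uedge_iff st by metis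
  qed
  ultimately have "graph_aut V R g" by (simp add: graph_aut_def)
  then show thesis using that g gedge by blast
qed

lemma lift_automorphism:
  assumes g: "graph_aut V R g"
  shows "automorphism M (map_sum g (image g))"
proof -
  let ?\<psi> = "map_sum g (image g)"
  have inj: "inj_on g V" and img: "g ` V = V" using g by (auto simp: graph_aut_def bij_betw_def)
  have sub: "e \<subseteq> V" if "e \<in> uedges G" for e using uedgeE[OF that] by blast
  have ge: "g ` e \<in> uedges G" if e: "e \<in> uedges G" for e
  proof -
    obtain u v where "e = {u, v}" "(u, v) \<in> R" "u \<in> V" "v \<in> V" using e by (rule uedgeE)
    then show ?thesis using graph_aut_edge[OF g] uedge_iff[of "g u" "g v"] by simp
  qed
  have einj: "g ` e = g ` f \<longleftrightarrow> e = f" if "e \<in> uedges G" "f \<in> uedges G" for e f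
    using inj_on_image_eq_iff[OF inj] sub that by blast
  have injM: "inj_on ?\<psi> (pverts M)"
  proof (rule inj_onI)
    fix x y assume "x \<in> pverts M" "y \<in> pverts M" "?\<psi> x = ?\<psi> y"
    then show "x = y" using einj inj_on_eq_iff[OF inj] by (cases x; cases y) simp_all
  qed
  have subM: "?\<psi> ` pverts M \<subseteq> pverts M"
  proof (rule image_subsetI)
    fix x assume "x \<in> pverts M"
    then show "?\<psi> x \<in> pverts M" using img ge by (cases x) auto
  qed
  have "finite (uedges G)"
    using finite_subset[of "uedges G" "Pow V"] sub pair_finite_verts by auto
  then have "finite (pverts M)" using pair_finite_verts by (simp add: pverts_middle)
  then have "bij_betw ?\<psi> (pverts M) (pverts M)"
    using endo_inj_surj[OF _ subM injM] injM by (simp add: bij_betw_def)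
  moreover have "(?\<psi> x, ?\<psi> y) \<in> parcs M \<longleftrightarrow> (x, y) \<in> parcs M"
    if x: "x \<in> pverts M" and y: "y \<in> pverts M" for x y
  proof -
    have mem: "g v \<in> g ` e \<longleftrightarrow> v \<in> e" if "v \<in> V" "e \<in> uedges G" for v e
      using inj_on_image_mem_iff[OF inj that(1) sub[OF that(2)]] .
    have int: "g ` e \<inter> g ` f = {} \<longleftrightarrow> e \<inter> f = {}" if "e \<in> uedges G" "f \<in> uedges G" for e f
      using inj_on_image_Int[OF inj sub[OF that(1)] sub[OF that(2)]] by (metis image_is_empty)
    show ?thesis
      using x y graph_aut_mem[OF g] by (cases x; cases y) (simp_all add: mem int einj ge)
  qed
  ultimately show ?thesis by (simp add: automorphism_def)
qed

lemma dist_total_colorable_iff: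
  "dist_total_colorable V R k \<longleftrightarrow>
     (\<exists>col. vertex_coloring M k col \<and> proper_coloring M col \<and> distinguishing M col)"
proof
  assume "dist_total_colorable V R k"
  then obtain c h where c: "edge_coloring k R c" and h: "\<And>v. v \<in> V \<Longrightarrow> h v < k \<and> misses R c v (h v)"
    and rigid: "\<And>g. color_aut V R c g \<Longrightarrow> (\<forall>v\<in>V. h (g v) = h v) \<Longrightarrow> (\<forall>v\<in>V. g v = v)"
    unfolding dist_total_colorable_def by blast
  \<comment> \<open>The choice is harmless, since both orientations of an edge have the same
    colour.\<close>
  define ce where "ce = (\<lambda>e. SOME i. \<exists>u v. e = {u, v} \<and> (u, v) \<in> R \<and> i = c u v)"
  have ce: "ce {u, v} = c u v" if uv: "(u, v) \<in> R" for u v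
  proof -
    have "\<exists>s t. {u, v} = {s, t} \<and> (s, t) \<in> R \<and> ce {u, v} = c s t"
      unfolding ce_def by (rule someI_ex) (use uv in blast)
    then show ?thesis using edge_coloring_sym[OF c uv] by (auto simp: doubleton_eq_iff)
  qed
  \<comment> \<open>\<open>vertex_coloring\<close> counts colours from 1,
    \<open>edge_coloring\<close> from 0.\<close>
  define col where "col = case_sum (\<lambda>v. Suc (h v)) (\<lambda>e. Suc (ce e))"
  have "vertex_coloring M k col"
    unfolding vertex_coloring_def
  proof (rule image_subsetI)
    fix x assume x: "x \<in> pverts M"
    show "col x \<in> {1..k}"
    proof (cases x)
      case (Inl v)
      then show ?thesis using x h[of v] by (auto simp: col_def)
    next
      case (Inr e)
      then have "e \<in> uedges G" using x by auto
      then show ?thesis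
        using Inr ce edge_coloring_less[OF c] by (elim uedgeE) (auto simp: col_def Suc_le_eq)
    qed
  qed
  moreover have "proper_coloring M col"
  proof -
    have ve: "h v \<noteq> ce e" if v: "v \<in> V" and e: "e \<in> uedges G" "v \<in> e" for v e
    proof -
      obtain w where "e = {v, w}" "(v, w) \<in> R"
        using uedge_at[OF e] by blast
      then show ?thesis using h[OF v] ce by (auto simp: misses_def)
    qed
    have ee: "ce e \<noteq> ce f" if e: "e \<in> uedges G" and f: "f \<in> uedges G" and ne: "e \<noteq> f" "e \<inter> f \<noteq> {}" for e f
    proof -
      obtain v where v: "v \<in> e" "v \<in> f" using ne by blast
      obtain w where w: "e = {v, w}" "(v, w) \<in> R"
        using uedge_at[OF e v(1)] by blast
      obtain t where t: "f = {v, t}" "(v, t) \<in> R"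
        using uedge_at[OF f v(2)] by blast
      show ?thesis using w t ne(1) ce edge_coloring_inj[OF c w(2) t(2)] by auto
    qed
    show ?thesis
      unfolding proper_coloring_def
    proof (intro ballI, clarify)
      fix x y assume "(x, y) \<in> parcs M" "col x = col y"
      then show False using ve ee by (cases x; cases y) (auto simp: col_def, metis)
    qed
  qed
  moreover have "distinguishing M col"
    unfolding distinguishing_def
  proof (intro allI impI ballI)
    fix \<psi> x assume \<psi>: "automorphism M \<psi> \<and> preserves_coloring M col \<psi>" and x: "x \<in> pverts M"
    then have pres: "\<And>y. y \<in> pverts M \<Longrightarrow> col (\<psi> y) = col y" by (simp add: preserves_coloring_def)
    obtain g where g: "graph_aut V R g" and gv: "\<And>v. v \<in> V \<Longrightarrow> \<psi> (Inl v) = Inl (g v)"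
      and ge: "\<And>u v. (u, v) \<in> R \<Longrightarrow> \<psi> (Inr {u, v}) = Inr {g u, g v}"
      using middle_automorphism \<psi> by blast
    have "c (g u) (g v) = c u v" if uv: "(u, v) \<in> R" for u v
    proof -
      have "(g u, g v) \<in> R" using graph_aut_edge[OF g] S.edge_in[OF uv] uv by simp
      moreover have "Inr {u, v} \<in> pverts M" using uedge_iff uv by simp
      ultimately show ?thesis using pres[of "Inr {u, v}"] ge[OF uv] ce uv by (simp add: col_def)
    qed
    then have "color_aut V R c g" using g by (simp add: color_aut_def)
    moreover have "h (g v) = h v" if "v \<in> V" for v
      using pres[of "Inl v"] gv[OF that] that by (simp add: col_def)
    ultimately have id: "\<forall>v\<in>V. g v = v" using rigid by blast
    show "\<psi> x = x"
    proof (cases x)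
      case (Inl v)
      then show ?thesis using x gv id by auto
    next
      case (Inr e)
      then have "e \<in> uedges G" using x by auto
      then obtain u v where "e = {u, v}" "(u, v) \<in> R" "u \<in> V" "v \<in> V" by (rule uedgeE)
      then show ?thesis using Inr ge id by simp
    qed
  qed
  ultimately show "\<exists>col. vertex_coloring M k col \<and> proper_coloring M col \<and> distinguishing M col"
    by blast
next
  assume "\<exists>col. vertex_coloring M k col \<and> proper_coloring M col \<and> distinguishing M col"
  then obtain col where v: "vertex_coloring M k col" and p: "proper_coloring M col"
    and d: "distinguishing M col" by blast
  have range: "col x \<ge> 1 \<and> col x \<le> k" if "x \<in> pverts M" for x
    using v that by (auto simp: vertex_coloring_def)
  have proper: "col x \<noteq> col y" if "(x, y) \<in> parcs M" for x y
    using p that by (auto simp: proper_coloring_def)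
  define c where "c = (\<lambda>u v. col (Inr {u, v}) - 1)"
  define h where "h = (\<lambda>v. col (Inl v) - 1)"
  have eM: "Inr {u, v} \<in> pverts M" if "(u, v) \<in> R" for u v
    using that uedge_iff by simp
  have vM: "Inl v \<in> pverts M" if "v \<in> V" for v using that by simp
  have colc: "col (Inr {u, v}) = Suc (c u v)" if "(u, v) \<in> R" for u v
    using range[OF eM[OF that]] by (simp add: c_def)
  have colh: "col (Inl v) = Suc (h v)" if "v \<in> V" for v
    using range[OF vM[OF that]] by (simp add: h_def)
  have c: "edge_coloring k R c"
    unfolding edge_coloring_def
  proof (intro conjI allI impI)
    fix x y assume xy: "(x, y) \<in> R"
    show "c x y < k" using range[OF eM[OF xy]] colc[OF xy] by simp
    show "c y x = c x y" by (simp add: c_def insert_commute)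
  next
    fix x y z assume xy: "(x, y) \<in> R" and xz: "(x, z) \<in> R" and eq: "c x y = c x z"
    show "y = z"
    proof (rule ccontr)
      assume "y \<noteq> z"
      then have "(Inr {x, y}, Inr {x, z}) \<in> parcs M"
        using xy xz uedge_iff by (auto simp: doubleton_eq_iff)
      then show False using proper colc[OF xy] colc[OF xz] eq by fastforce
    qed
  qed
  moreover have "h v < k \<and> misses R c v (h v)" if v: "v \<in> V" for v
  proof
    show "h v < k" using range[OF vM[OF v]] colh[OF v] by simp
    show "misses R c v (h v)"
      unfolding misses_def
    proof (intro allI impI notI)
      fix w assume vw: "(v, w) \<in> R" and eq: "c v w = h v"
      have "(Inl v, Inr {v, w}) \<in> parcs M" using v vw uedge_iff by simp
      then show False using proper colc[OF vw] colh[OF v] eq by fastforce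
    qed
  qed
  moreover have "\<forall>v\<in>V. g v = v" if g: "color_aut V R c g" and hg: "\<forall>v\<in>V. h (g v) = h v" for g
  proof -
    note aut = color_aut_aut[OF g]
    have "col (map_sum g (image g) x) = col x" if x: "x \<in> pverts M" for x
    proof (cases x)
      case (Inl v)
      then have "v \<in> V" using x by auto
      then show ?thesis using Inl colh graph_aut_mem[OF aut] hg by simp
    next
      case (Inr e)
      then have "e \<in> uedges G" using x by auto
      then obtain u v where uv: "e = {u, v}" "(u, v) \<in> R" "u \<in> V" "v \<in> V" by (rule uedgeE)
      then have "(g u, g v) \<in> R" using graph_aut_edge[OF aut] by simp
      then show ?thesis using Inr uv colc color_aut_color[OF g] by simp
    qed
    then have "preserves_coloring M col (map_sum g (image g))"
      by (simp add: preserves_coloring_def)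
    then have "map_sum g (image g) x = x" if "x \<in> pverts M" for x
      using d lift_automorphism[OF aut] that unfolding distinguishing_def by blast
    then show ?thesis using vM by fastforce
  qed
  ultimately show "dist_total_colorable V R k" unfolding dist_total_colorable_def by blast
qed

lemma dist_chromatic_number_middle: "dist_chromatic_number M = (LEAST k. dist_total_colorable V R k)"
  by (simp add: dist_chromatic_number_def dist_total_colorable_iff)

end

text \<open>A vertex and its incident edges are pairwise adjacent in the middle graph; this gives
  the lower bound \<Delta> + 1.\<close>

lemma dist_total_colorable_gt_degree:
  assumes k: "dist_total_colorable V R k" and v: "v \<in> V"
  shows "card (R `` {v}) < k"
proof -
  obtain c h where c: "edge_coloring k R c" and h: "h v < k" "misses R c v (h v)"
    using k v unfolding dist_total_colorable_def by blast
  have "inj_on (c v) (R `` {v})" using edge_coloring_inj[OF c] by (auto intro!: inj_onI)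
  then have "card (R `` {v}) = card (c v ` (R `` {v}))" by (simp add: card_image)
  also have "c v ` (R `` {v}) \<subseteq> {..<k} - {h v}"
    using edge_coloring_less[OF c] h(2) by (auto simp: misses_def)
  then have "card (c v ` (R `` {v})) \<le> card ({..<k} - {h v})" by (intro card_mono) auto
  also have "\<dots> < k" using h(1) by simp
  finally show ?thesis .
qed

text \<open>
  A vertex with two available colours can be given a colour that no equivalent vertex receives.
\<close>

lemma (in simple_graph) dist_total_colorable_spare:
  assumes conn: "\<And>x y. x \<in> V \<Longrightarrow> y \<in> V \<Longrightarrow> (x, y) \<in> R\<^sup>*"
    and deg: "\<And>x. x \<in> V \<Longrightarrow> card (R `` {x}) < k" and v: "v \<in> V" "card (R `` {v}) + 2 \<le> k"
  shows "dist_total_colorable V R k"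
proof -
  obtain c where c: "edge_coloring k R c" using ex_edge_coloring[OF deg] v(2) by auto
  have "card (c v ` (R `` {v})) + 2 \<le> k"
    using card_image_le[OF fin_nbrs, of "c v" v] v(2) by simp
  then have "card ({..<k} - c v ` (R `` {v})) \<ge> 2"
    using diff_card_le_card_Diff[of "c v ` (R `` {v})" "{..<k}"] fin_nbrs by simp
  then obtain T where "T \<subseteq> {..<k} - c v ` (R `` {v})" "card T = 2"
    by (meson obtain_subset_with_card_n)
  then obtain i j where "i \<noteq> j" "{i, j} \<subseteq> {..<k} - c v ` (R `` {v})"
    by (auto simp: card_2_iff)
  then have ij: "i \<noteq> j" "i < k" "j < k" "misses R c v i" "misses R c v j"
    by (auto simp: misses_def)
  \<comment> \<open>An image of \<open>v\<close> also misses \<open>j\<close>, and every vertex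
    missing \<open>j\<close> other than \<open>v\<close> receives \<open>j\<close>, whereas
    \<open>v\<close> has colour \<open>i\<close>.\<close>
  define h where "h = (\<lambda>w. if w = v then i else if misses R c w j then j else SOME l. l < k \<and> misses R c w l)"
  have "h w < k \<and> misses R c w (h w)" if "w \<in> V" for w
  proof -
    have "\<exists>l. l < k \<and> misses R c w l" using ex_missing_color[OF finR deg[OF that]] by blast
    from someI_ex[OF this] show ?thesis using ij by (simp add: h_def)
  qed
  moreover have "\<forall>w\<in>V. g w = w" if g: "color_aut V R c g" and hg: "\<forall>w\<in>V. h (g w) = h w" for g
  proof -
    have "misses R c (g v) j" using color_aut_misses[OF g RV v(1)] ij by simp
    then have "g v = v" using hg v(1) ij(1) by (metis h_def)
    then show ?thesis using color_aut_fixpoint[OF c g RV v(1)] conn[OF v(1)] by blast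
  qed
  ultimately show ?thesis using c unfolding dist_total_colorable_def by blast
qed

context regular_graph
begin

lemma dist_total_colorable_regular:
  assumes c: "edge_coloring (Suc d) R c"
    and rigid: "\<And>g. color_aut V R c g \<Longrightarrow> \<forall>v\<in>V. g v = v"
  shows "dist_total_colorable V R (Suc d)"
  unfolding dist_total_colorable_def
  using c missing[OF c] rigid by (intro exI[of _ c] exI[of _ "missing c"]) blast

text \<open>With one colour left at each vertex, \<open>h\<close> must agree with
  \<open>missing c\<close>, which colour-preserving automorphisms respect automatically.\<close>

lemma not_dist_total_colorable_regular:
  assumes sym: "\<And>c. edge_coloring (Suc d) R c \<Longrightarrow> \<exists>g. color_aut V R c g \<and> (\<exists>v\<in>V. g v \<noteq> v)"
  shows "\<not> dist_total_colorable V R (Suc d)"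
proof
  assume "dist_total_colorable V R (Suc d)"
  then obtain c h where c: "edge_coloring (Suc d) R c"
    and h: "\<forall>v\<in>V. h v < Suc d \<and> misses R c v (h v)"
    and rigid: "\<forall>g. color_aut V R c g \<longrightarrow> (\<forall>v\<in>V. h (g v) = h v) \<longrightarrow> (\<forall>v\<in>V. g v = v)"
    unfolding dist_total_colorable_def by blast
  obtain g where g: "color_aut V R c g" "\<exists>v\<in>V. g v \<noteq> v" using sym[OF c] by blast
  have hm: "h v = missing c v" if "v \<in> V" for v using missing_eq[OF c that] h that by metis
  then have "\<forall>v\<in>V. h (g v) = h v"
    using color_aut_missing[OF c g(1)] graph_aut_mem[OF color_aut_aut[OF g(1)]] by simp
  then show False using rigid g by blast
qed

end

section \<open>Relational descriptions of the exceptional graphs\<close>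

lemma digraph_iso_image:
  assumes "digraph_iso (with_proj G) (with_proj H)"
  shows "\<exists>h. inj_on h (pverts G) \<and> pverts H = h ` pverts G \<and>
    parcs H = (\<lambda>(u, v). (h u, h v)) ` parcs G"
proof -
  obtain f where f: "pre_digraph.digraph_isomorphism (with_proj G) f"
    and H: "with_proj H = app_iso f (with_proj G)"
    using assms unfolding digraph_iso_def by blast
  let ?h = "iso_verts f"
  \<comment> \<open>Both digraphs have the projections as \<open>tail\<close> and
    \<open>head\<close>, so an isomorphism acts on arcs through their end vertices.\<close>
  have tails: "iso_tail f = fst" "iso_head f = snd"
    and V: "pverts H = ?h ` pverts G" and A: "parcs H = iso_arcs f ` parcs G"
    using arg_cong[OF H, of tail] arg_cong[OF H, of head] arg_cong[OF H, of verts] arg_cong[OF H, of arcs]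
    by (simp_all add: app_iso_def)
  have "iso_arcs f a = (case a of (u, v) \<Rightarrow> (?h u, ?h v))" if "a \<in> parcs G" for a
    using f that tails unfolding pre_digraph.digraph_isomorphism_def
    by (auto simp: case_prod_beta prod_eq_iff)
  then have "parcs H = (\<lambda>(u, v). (?h u, ?h v)) ` parcs G" unfolding A by (rule image_cong[OF refl])
  moreover have "inj_on ?h (pverts G)"
    using f unfolding pre_digraph.digraph_isomorphism_def by simp
  ultimately show ?thesis using V by blast
qed

lemma digraph_isoI:
  assumes G: "pair_wf_digraph G" and h: "inj_on h (pverts G)" "pverts H = h ` pverts G"
    "parcs H = (\<lambda>(u, v). (h u, h v)) ` parcs G"
  shows "digraph_iso (with_proj G) (with_proj H)"
proof -
  interpret pair_wf_digraph G by (rule G)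
  let ?f = "\<lparr> iso_verts = h, iso_arcs = (\<lambda>(u, v). (h u, h v)), iso_head = snd, iso_tail = fst \<rparr>"
  have "inj_on (\<lambda>(u, v). (h u, h v)) (parcs G)"
    using h(1) in_arcsD1 in_arcsD2 by (auto simp: inj_on_def)
  then have "pre_digraph.digraph_isomorphism (with_proj G) ?f"
    unfolding pre_digraph.digraph_isomorphism_def using h(1) wf_digraph_wp_iff G by auto
  moreover have "with_proj H = app_iso ?f (with_proj G)"
    using h(2,3) by (simp add: app_iso_def with_proj_def)
  ultimately show ?thesis unfolding digraph_iso_def by blast
qed

context pair_simple_graph
begin

lemma cycle_on_iff: "digraph_iso (with_proj G) (with_proj (cycle_graph n)) \<longleftrightarrow> cycle_on n V R"
proof
  assume "digraph_iso (with_proj G) (with_proj (cycle_graph n))"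
  then obtain h where h: "inj_on h V" "{..<n} = h ` V"
    and A: "parcs (cycle_graph n) = (\<lambda>(u, v). (h u, h v)) ` R"
    using digraph_iso_image[of G "cycle_graph n"] by (auto simp: cycle_graph_def)
  have bij: "bij_betw h V {..<n}" using h by (simp add: bij_betw_def)
  let ?f = "inv_into V h"
  have f: "?f i \<in> V" "h (?f i) = i" if "i < n" for i
    using bij_betw_inv_into_right[OF bij] bij_betwE[OF bij_betw_inv_into[OF bij]] that by auto
  have arc: "(h u, h v) \<in> parcs (cycle_graph n) \<longleftrightarrow> (u, v) \<in> R" if "u \<in> V" "v \<in> V" for u v
  proof
    assume "(h u, h v) \<in> parcs (cycle_graph n)"
    then obtain s t where st: "(s, t) \<in> R" "h u = h s" "h v = h t" unfolding A by auto
    then show "(u, v) \<in> R" using inj_on_eq_iff[OF h(1)] S.edge_in[OF st(1)] that by simp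
  next
    assume "(u, v) \<in> R"
    then show "(h u, h v) \<in> parcs (cycle_graph n)" unfolding A by force
  qed
  have "(?f i, ?f j) \<in> R \<longleftrightarrow> j = Suc i mod n \<or> i = Suc j mod n" if "i < n" "j < n" for i j
    using arc[of "?f i" "?f j"] f that by (simp add: cycle_graph_def)
  then show "cycle_on n V R" unfolding cycle_on_def using bij_betw_inv_into[OF bij] by blast
next
  assume "cycle_on n V R"
  then obtain f where f: "bij_betw f {..<n} V"
    and adj: "\<And>i j. i < n \<Longrightarrow> j < n \<Longrightarrow> (f i, f j) \<in> R \<longleftrightarrow> j = Suc i mod n \<or> i = Suc j mod n"
    unfolding cycle_on_def by blast
  let ?h = "inv_into {..<n} f"
  have bij: "bij_betw ?h V {..<n}" by (rule bij_betw_inv_into[OF f])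
  have h: "?h v < n" "f (?h v) = v" if "v \<in> V" for v
    using bij_betwE[OF bij] bij_betw_inv_into_right[OF f] that by auto
  have hf: "?h (f i) = i" if "i < n" for i using bij_betw_inv_into_left[OF f] that by simp
  show "digraph_iso (with_proj G) (with_proj (cycle_graph n))"
  proof (rule digraph_isoI)
    show "pair_wf_digraph G" by unfold_locales
    show "inj_on ?h V" "pverts (cycle_graph n) = ?h ` V"
      using bij by (auto simp: bij_betw_def cycle_graph_def)
    show "parcs (cycle_graph n) = (\<lambda>(u, v). (?h u, ?h v)) ` R"
    proof (intro subset_antisym subrelI)
      fix i j assume "(i, j) \<in> parcs (cycle_graph n)"
      then have ij: "i < n" "j < n" "(f i, f j) \<in> R" using adj by (auto simp: cycle_graph_def)
      then show "(i, j) \<in> (\<lambda>(u, v). (?h u, ?h v)) ` R"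
        using hf by (intro image_eqI[of _ _ "(f i, f j)"]) auto
    next
      fix i j assume "(i, j) \<in> (\<lambda>(u, v). (?h u, ?h v)) ` R"
      then obtain u v where uv: "(u, v) \<in> R" "i = ?h u" "j = ?h v" by auto
      then have "u \<in> V" "v \<in> V" using S.edge_in by blast+
      then show "(i, j) \<in> parcs (cycle_graph n)"
        using adj[of i j] h uv by (simp add: cycle_graph_def)
    qed
  qed
qed

lemma exceptional_graph_iff:
  "exceptional_graph G \<longleftrightarrow>
     cycle_on 4 V R \<or> (card V = 4 \<and> complete_on V R) \<or> cycle_on 6 V R \<or> bipartite_on 3 3 V R"
  unfolding exceptional_graph_def cycle_on_iff complete_digraph_pair_def
    complete_bipartite_digraph_pair_def complete_on_def bipartite_on_def
  using pair_finite_verts by auto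

end

section \<open>Colourability of regular graphs\<close>

lemma cycle_regular:
  assumes R: "R \<subseteq> V \<times> V" and cyc: "cycle_on n V R" and n: "n = 4 \<or> n = 6" and x: "x \<in> V"
  shows "card (R `` {x}) = 2"
proof -
  obtain f where f: "bij_betw f {..<n} V"
    and adj: "\<And>i j. i < n \<Longrightarrow> j < n \<Longrightarrow> (f i, f j) \<in> R \<longleftrightarrow> j = Suc i mod n \<or> i = Suc j mod n"
    using cyc unfolding cycle_on_def by blast
  obtain i where i: "i < n" "x = f i" using f x by (auto simp: bij_betw_def)
  let ?N = "{j \<in> {..<n}. j = Suc i mod n \<or> i = Suc j mod n}"
  have "R `` {x} = f ` ?N"
  proof
    show "R `` {x} \<subseteq> f ` ?N"
    proof
      fix y assume y: "y \<in> R `` {x}"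
      then have "y \<in> V" using R by auto
      then obtain j where "j < n" "y = f j" using f by (auto simp: bij_betw_def)
      then show "y \<in> f ` ?N" using adj[OF i(1)] y i(2) by auto
    qed
    show "f ` ?N \<subseteq> R `` {x}" using adj[OF i(1)] i(2) by auto
  qed
  moreover have "inj_on f ?N" using f by (auto simp: bij_betw_def intro: inj_on_subset)
  ultimately have "card (R `` {x}) = card ?N" by (simp add: card_image)
  also have "?N = {Suc i mod n, (i + n - 1) mod n}"
    using n
  proof
    assume "n = 4"
    then show ?thesis using i(1) by (auto simp: less_4)
  next
    assume "n = 6"
    then show ?thesis using i(1) by (auto simp: less_6)
  qed
  also have "card \<dots> = 2"
    using n
  proof
    assume "n = 4"
    then show ?thesis using i(1) by (auto simp: less_4)
  next
    assume "n = 6"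
    then show ?thesis using i(1) by (auto simp: less_6)
  qed
  finally show ?thesis .
qed

lemma complete_regular:
  assumes "card V = 4" "complete_on V R" "x \<in> V"
  shows "card (R `` {x}) = 3"
proof -
  have "R `` {x} = V - {x}" using assms(2,3) by (auto simp: complete_on_def)
  then show ?thesis using assms(1,3) by simp
qed

lemma bipartite_regular:
  assumes "bipartite_on m m V R" "x \<in> V"
  shows "card (R `` {x}) = m"
proof -
  obtain A B where AB: "V = A \<union> B" "A \<inter> B = {}" "card A = m" "card B = m" "R = A \<times> B \<union> B \<times> A"
    using assms(1) unfolding bipartite_on_def by blast
  then have "R `` {x} = (if x \<in> A then B else A)" using assms(2) by auto
  then show ?thesis using AB by simp
qed

lemma (in simple_graph) exceptional_not_colorable:
  assumes ex: "cycle_on 4 V R \<or> (card V = 4 \<and> complete_on V R) \<or> cycle_on 6 V R \<or> bipartite_on 3 3 V R"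
    and x: "x \<in> V"
  shows "\<not> dist_total_colorable V R (Suc (card (R `` {x})))"
proof -
  have reg: "regular_graph V R d" if "\<And>y. y \<in> V \<Longrightarrow> card (R `` {y}) = d" for d
    using that by unfold_locales
  show ?thesis
  proof (cases "cycle_on 4 V R \<or> cycle_on 6 V R")
    case True
    then have two: "card (R `` {y}) = 2" if "y \<in> V" for y using cycle_regular[OF RV _ _ that] by blast
    have "\<exists>g. color_aut V R c g \<and> (\<exists>v\<in>V. g v \<noteq> v)" if "edge_coloring (Suc 2) R c" for c
      using cycle_4_symmetric[OF RV] cycle_6_symmetric[OF RV] True that
      by (metis eval_nat_numeral(3))
    then show ?thesis
      using regular_graph.not_dist_total_colorable_regular[OF reg[OF two]] two[OF x] by metis
  next
    case False
    then have ex': "(card V = 4 \<and> complete_on V R) \<or> bipartite_on 3 3 V R" using ex by blast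
    then have three: "card (R `` {y}) = 3" if "y \<in> V" for y
      using ex' complete_regular[OF _ _ that] bipartite_regular[OF _ that] by metis
    have "\<exists>g. color_aut V R c g \<and> (\<exists>v\<in>V. g v \<noteq> v)" if "edge_coloring (Suc 3) R c" for c
    proof -
      have "edge_coloring 4 R c" using that by (simp add: eval_nat_numeral)
      then show ?thesis using complete_4_symmetric bipartite_3_3_symmetric ex' by blast
    qed
    then show ?thesis
      using regular_graph.not_dist_total_colorable_regular[OF reg[OF three]] three[OF x] by metis
  qed
qed

text \<open>Non-colourability is turned into \<open>bad_graph\<close>. The order enters through
  \<open>d \<ge> 2\<close>: in degree at most 1 a component has at most two vertices.\<close>

lemma (in simple_graph) regular_not_colorable_exceptional:
  assumes conn: "\<And>x y. x \<in> V \<Longrightarrow> y \<in> V \<Longrightarrow> (x, y) \<in> R\<^sup>*" and V: "card V \<ge> 3"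
    and reg: "\<And>x. x \<in> V \<Longrightarrow> card (R `` {x}) = d"
    and not: "\<not> dist_total_colorable V R (Suc d)"
  shows "cycle_on 4 V R \<or> (card V = 4 \<and> complete_on V R) \<or> cycle_on 6 V R \<or> bipartite_on 3 3 V R"
proof -
  interpret regular_graph V R d using reg by unfold_locales
  have ne: "V \<noteq> {}" using V by auto
  interpret bad_graph V R d
  proof unfold_locales
    fix c assume c: "edge_coloring (Suc d) R c"
    then obtain g v where g: "color_aut V R c g" "v \<in> V" "g v \<noteq> v"
      using dist_total_colorable_regular not by blast
    then have "\<forall>x\<in>V. g x \<noteq> x"
      using color_aut_fixpoint[OF c g(1) RV] conn by blast
    then show "\<exists>g. color_aut V R c g \<and> (\<forall>x\<in>V. g x \<noteq> x)" using g(1) by blast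
  qed (use conn ne in auto)
  have "d \<ge> 2"
  proof (rule ccontr)
    assume d: "\<not> d \<ge> 2"
    obtain x where x: "x \<in> V" using ne by blast
    let ?S = "insert x (R `` {x})"
    have "y \<in> ?S" if "(x, y) \<in> R\<^sup>*" for y
      using that
    proof (induction rule: rtrancl_induct)
      case (step y z)
      show ?case
      proof (cases "y = x")
        case False
        then have "(y, x) \<in> R" using step.IH edge_sym by blast
        moreover have "card (R `` {y}) \<le> 1" using deg_le[of y] d by simp
        ultimately have "z = x"
          using step(2) card_le_Suc0_iff_eq[OF fin_nbrs[of y]] by auto
        then show ?thesis by simp
      qed (use step in simp)
    qed simp
    then have "V \<subseteq> ?S" using conn[OF x] by blast
    then have "card V \<le> card ?S" using fin_nbrs by (intro card_mono) auto
    also have "\<dots> \<le> Suc d" using deg_le[of x] card_insert_le_m1[of "Suc d" "R `` {x}" x] by simp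
    finally show False using V d by simp
  qed
  then show ?thesis by (rule exceptional)
qed

section \<open>The distinguishing chromatic number of a middle graph\<close>

theorem theorem2p8:
  fixes G :: "'a pair_pre_digraph"
  assumes "pair_graph G"
    and "Digraph_Component.connected (with_proj G)"
    and "card (pverts G) \<ge> 3"
  shows "(\<not> exceptional_graph G \<longrightarrow>
            dist_chromatic_number (middle_graph G) = max_degree G + 1)
       \<and> (exceptional_graph G \<longrightarrow>
            dist_chromatic_number (middle_graph G) = max_degree G + 2)"
proof -
  interpret pair_simple_graph G by (rule pair_simple_graph.intro) (rule assms(1))
  have ne: "V \<noteq> {}" using assms(3) by auto
  \<comment> \<open>Connectedness is defined through the symmetric closure, which adds no arc
    here.\<close>
  have "mk_symmetric (with_proj G) = G"
    unfolding mk_symmetric_def using S.edge_sym by (intro pair_pre_digraph.equality) force+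
  then have conn: "(x, y) \<in> R\<^sup>*" if "x \<in> V" "y \<in> V" for x y
    using assms(2) that
    unfolding Digraph_Component.connected_def strongly_connected_def reachable_def
    by (auto intro: rtrancl_on_rtranclI)
  have lower: "max_degree G < k" if "dist_total_colorable V R k" for k
    using dist_total_colorable_gt_degree[OF that] ex_max_degree[OF ne] by metis
  \<comment> \<open>With \<open>max_degree G + 1\<close> colours this applies to a vertex of smaller
    degree, with \<open>max_degree G + 2\<close> colours to any vertex.\<close>
  have upper: "dist_total_colorable V R k"
    if "v \<in> V" "card (R `` {v}) + 2 \<le> k" "max_degree G < k" for v k
    by (rule S.dist_total_colorable_spare[OF conn _ that(1,2)])
      (use degree_le_max that(3) in \<open>auto intro: le_less_trans\<close>)
  obtain w where w: "w \<in> V" "card (R `` {w}) = max_degree G" using ex_max_degree[OF ne] by blast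
  show ?thesis
    unfolding dist_chromatic_number_middle exceptional_graph_iff
  proof (intro conjI impI Least_equality)
    assume nex: "\<not> (cycle_on 4 V R \<or> card V = 4 \<and> complete_on V R \<or> cycle_on 6 V R \<or> bipartite_on 3 3 V R)"
    show "dist_total_colorable V R (max_degree G + 1)"
    proof (cases "\<exists>v\<in>V. card (R `` {v}) < max_degree G")
      case True
      then show ?thesis using upper[of _ "max_degree G + 1"] by fastforce
    next
      case False
      then have reg: "card (R `` {v}) = max_degree G" if "v \<in> V" for v
        using degree_le_max that by (meson le_antisym not_less)
      show ?thesis
        using S.regular_not_colorable_exceptional[OF conn assms(3) reg] nex by auto
    qed
  next
    show "max_degree G + 1 \<le> k" if "dist_total_colorable V R k" for k using lower[OF that] by simp
  next
    show "dist_total_colorable V R (max_degree G + 2)" using upper[OF w(1)] w(2) by simp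
  next
    fix k assume ex: "cycle_on 4 V R \<or> card V = 4 \<and> complete_on V R \<or> cycle_on 6 V R \<or> bipartite_on 3 3 V R"
      and k: "dist_total_colorable V R k"
    have "k \<noteq> Suc (max_degree G)" using S.exceptional_not_colorable[OF ex w(1)] w(2) k by auto
    then show "max_degree G + 2 \<le> k" using lower[OF k] by simp
  qed
qed

end
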